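(* There is a non-Hirsch polytope of dimension $43$ with $86$ facets; that is, there is a $43$-dimensional convex polytope with exactly $86$ facets whose combinatorial diameter is greater than $86-43=43$.
   Context: The combinatorial diameter of a polytope is the diameter of its graph (formed by vertices and edges): the maximum over pairs of vertices of the minimum number of edges in an edge path connecting them. A $d$-polytope with $n$ facets is called non-Hirsch if its combinatorial diameter is greater than $n-d$. *)

theory Defs
  imports "HOL-Analysis.Analysis" "HOL-Library.Extended_Nat"
begin

(* Adjacency in the graph of P.  The endpoints of such a segment are automatically distinct
   (an edge has affine dimension 1) and vertices of P. *)
definition edge_rel :: "'a::euclidean_space set \<Rightarrow> ('a \<times> 'a) set" where
  "edge_rel P = {(v, w). closed_segment v w edge_of P}"

(* Minimum number of edges in an edge path from v to w.  As usual the distance is infinite if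
   no path exists; this does not occur for vertices of a polytope, whose graph is connected. *)
definition graph_dist :: "'a::euclidean_space set \<Rightarrow> 'a \<Rightarrow> 'a \<Rightarrow> enat" where
  "graph_dist P v w = (INF k\<in>{k. (v, w) \<in> edge_rel P ^^ k}. enat k)"

definition combinatorial_diameter :: "'a::euclidean_space set \<Rightarrow> enat" where
  "combinatorial_diameter P =
     (SUP v\<in>{v. v extreme_point_of P}. SUP w\<in>{w. w extreme_point_of P}. graph_dist P v w)"

definition num_facets :: "'a::euclidean_space set \<Rightarrow> nat" where
  "num_facets P = card {F. F facet_of P}"

(* Truncation by nat is harmless: a d-polytope has at least d facets. *)
definition non_Hirsch :: "'a::euclidean_space set \<Rightarrow> bool" where
  "non_Hirsch P \<longleftrightarrow>
     polytope P \<and> combinatorial_diameter P > enat (nat (int (num_facets P) - aff_dim P))"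

end

theory Submission
  imports Defs
begin

text \<open>
  Santos' construction. A spindle is a polytope with two vertices \<open>u\<close>, \<open>v\<close> such that every facet
  contains exactly one of them; its length is the distance of \<open>u\<close> and \<open>v\<close> in the graph. If more
  than \<open>d\<close> facets of a \<open>d\<close>-dimensional spindle contain \<open>u\<close>, then the wedge over a facet \<open>j0\<close>
  through \<open>v\<close> has a vertical edge over \<open>u\<close>, and tilting a redundant facet \<open>i0\<close> through \<open>u\<close> contracts
  this edge to a single new apex. This adds one dimension, one facet and at least one unit of
  length (the strong d-step theorem). Starting from a 5-dimensional spindle of length 6 with \<open>24 + 24\<close>
  facets, \<open>19 + 19\<close> such steps yield dimension 43, \<open>43 + 43\<close> facets and length at least 44.

  The spindles are given by inequalities \<open>g i \<bullet> x \<le> 1\<close> inside a subspace \<open>S\<close> of a fixed space. No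
  genericity is needed: instead of making the spindle simple, the steps propagate that the relevant
  facets are essential, i.e. not redundant at the vertices that they share with facets on the other side.
\<close>

section \<open>Spindles given by inequalities\<close>

text \<open>The obstacle is that a non-simple spindle may change its face lattice completely under a
  tilt, however small. What survives is a one-sided comparison: for a small tilt, every set of rows
  tight at a point of the tilted body is also tight at some point of the untilted wedge. This
  follows from compactness, since there are only finitely many sets of rows. Projecting that point
  along the new axis gives a shadow in the old spindle, and walks upstairs are compared with the
  walks of their shadows. A vertex on neither copy of the wedged row is fixed in height by the
  tilted row alone, which forces height zero. The first step out of this class of vertices does not
  move the shadow, whence the extra unit. Only at a degenerate vertex where the tilted row is
  redundant and the wedged row is tight could this fail; \<open>essential\<close> excludes exactly
  that. In the base spindle, vertices other than the apices lie on exactly 5 rows, so essentiality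
  is a dimension count. Walks use rank conditions instead of faces: \<open>adj\<close> contains the
  edge graph, so lower bounds on its walks carry over.\<close>

definition ker :: "'a::euclidean_space set \<Rightarrow> ('i \<Rightarrow> 'a) \<Rightarrow> 'i set \<Rightarrow> 'a set" where
  "ker S g A = {h \<in> S. \<forall>i\<in>A. g i \<bullet> h = 0}"

text \<open>The right-hand side 1 puts the origin strictly inside every row, so points can be scaled
  towards it or away from it.\<close>

definition pol :: "'a::euclidean_space set \<Rightarrow> ('i \<Rightarrow> 'a) \<Rightarrow> 'i set \<Rightarrow> 'a set" where
  "pol S g I = {x \<in> S. \<forall>i\<in>I. g i \<bullet> x \<le> 1}"

definition tight :: "('i \<Rightarrow> 'a::euclidean_space) \<Rightarrow> 'i set \<Rightarrow> 'a \<Rightarrow> 'i set" where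
  "tight g I x = {i \<in> I. g i \<bullet> x = 1}"

definition vert :: "'a::euclidean_space set \<Rightarrow> ('i \<Rightarrow> 'a) \<Rightarrow> 'i set \<Rightarrow> 'a \<Rightarrow> bool" where
  "vert S g I x \<longleftrightarrow> x \<in> pol S g I \<and> dim (ker S g (tight g I x)) = 0"

text \<open>Reflexive on vertices, so that walks may pause.\<close>
definition adj :: "'a::euclidean_space set \<Rightarrow> ('i \<Rightarrow> 'a) \<Rightarrow> 'i set \<Rightarrow> ('a \<times> 'a) set" where
  "adj S g I = {(x, y). vert S g I x \<and> vert S g I y \<and>
     dim (ker S g (tight g I x \<inter> tight g I y)) \<le> 1}"

text \<open>At a simple vertex every tight row is essential. Only this consequence of simplicity is
  kept, and only at vertices shared with the row \<open>j\<close>.\<close>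

definition essential :: "'a::euclidean_space set \<Rightarrow> ('i \<Rightarrow> 'a) \<Rightarrow> 'i set \<Rightarrow> 'i \<Rightarrow> 'i \<Rightarrow> bool" where
  "essential S g I i j \<longleftrightarrow> (\<forall>x. vert S g I x \<longrightarrow> i \<in> tight g I x \<longrightarrow> j \<in> tight g I x \<longrightarrow>
     dim (ker S g (tight g I x - {i})) \<noteq> 0)"

text \<open>The points at which a single row is tight and all others are strict make every row a
  facet, so that counting rows finally counts facets. The rank conditions make the apices
  vertices.\<close>

definition pre_spindle ::
  "'a::euclidean_space set \<Rightarrow> ('i \<Rightarrow> 'a) \<Rightarrow> 'i set \<Rightarrow> 'i set \<Rightarrow> 'a \<Rightarrow> 'a \<Rightarrow> bool" where
  "pre_spindle S g U V u v \<longleftrightarrow> subspace S \<and> finite U \<and> finite V \<and> U \<inter> V = {} \<and>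
     g ` (U \<union> V) \<subseteq> S \<and> bounded (pol S g (U \<union> V)) \<and>
     (\<forall>i\<in>U \<union> V. \<exists>x\<in>S. g i \<bullet> x = 1 \<and> (\<forall>k\<in>U \<union> V - {i}. g k \<bullet> x < 1)) \<and>
     u \<in> S \<and> (\<forall>i\<in>U. g i \<bullet> u = 1) \<and> (\<forall>i\<in>V. g i \<bullet> u < 1) \<and> dim (ker S g U) = 0 \<and>
     v \<in> S \<and> (\<forall>i\<in>V. g i \<bullet> v = 1) \<and> (\<forall>i\<in>U. g i \<bullet> v < 1) \<and> dim (ker S g V) = 0"

text \<open>\<open>U'\<close> and \<open>V'\<close> are the rows over which no wedge has been taken yet.\<close>
definition spindle ::
  "'a::euclidean_space set \<Rightarrow> ('i \<Rightarrow> 'a) \<Rightarrow> 'i set \<Rightarrow> 'i set \<Rightarrow> 'i set \<Rightarrow> 'i set \<Rightarrow> nat \<Rightarrow> bool" where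
  "spindle S g U V U' V' l \<longleftrightarrow> U' \<subseteq> U \<and> V' \<subseteq> V \<and>
     (\<forall>i\<in>U. \<forall>j\<in>V'. essential S g (U \<union> V) i j) \<and>
     (\<forall>j\<in>V. \<forall>i\<in>U'. essential S g (U \<union> V) j i) \<and>
     (\<exists>u v. pre_spindle S g U V u v \<and> (\<forall>k<l. (u, v) \<notin> adj S g (U \<union> V) ^^ k))"

section \<open>Kernels of row systems and dimension counts\<close>

lemma subspace_ker: "subspace S \<Longrightarrow> subspace (ker S g A)"
  unfolding ker_def subspace_def by (auto simp: inner_add_right)

lemma ker_mono: "A \<subseteq> B \<Longrightarrow> ker S g B \<subseteq> ker S g A"
  unfolding ker_def by auto

lemma dim_le_inj_linear:
  fixes f :: "'a::euclidean_space \<Rightarrow> 'b::euclidean_space"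
  assumes "linear f" "subspace K" "f ` K \<subseteq> L" "\<And>h. h \<in> K \<Longrightarrow> f h = 0 \<Longrightarrow> h = 0"
  shows "dim K \<le> dim L"
proof -
  have "inj_on f K"
    unfolding linear_inj_on_iff_eq_0[OF assms(1,2)] using assms(4) by blast
  then have "dim (f ` K) = dim K"
    using assms(1,2) by (metis dim_image_eq span_eq_iff)
  then show ?thesis using dim_subset[OF assms(3)] by simp
qed

lemma dim_0_D: "dim (K :: 'a::euclidean_space set) = 0 \<Longrightarrow> h \<in> K \<Longrightarrow> h = 0"
  by (auto simp: dim_eq_0)

lemma dim_1_multiple:
  fixes h k :: "'a::euclidean_space"
  assumes "dim K \<le> 1" "h \<in> K" "k \<in> K" "h \<noteq> 0"
  shows "\<exists>c. k = c *\<^sub>R h"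
proof -
  have "dim {h} = 1" using assms(4) by simp
  then have "dim {h} = dim K"
    using assms(1,2) by (metis dim_subset empty_subsetI insert_subset le_antisym)
  then have "span K = span {h}"
    by (metis assms(2) dim_eq_span empty_subsetI insert_subset order_refl)
  then show ?thesis using span_base[OF assms(3)] by (auto simp: span_singleton)
qed

lemma diff_in_ker:
  assumes "subspace S" "x \<in> S" "y \<in> S" "\<forall>i\<in>A. g i \<bullet> x = g i \<bullet> y"
  shows "x - y \<in> ker S g A"
  using assms by (simp add: ker_def subspace_diff inner_diff_right)

lemma ker_eq_0_unique:
  assumes "subspace S" "dim (ker S g A) = 0" "x \<in> S" "y \<in> S" "\<forall>i\<in>A. g i \<bullet> x = g i \<bullet> y"
  shows "x = y"
  using dim_0_D[OF assms(2) diff_in_ker[OF assms(1,3,4,5)]] by simp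

lemma dim_ker_eq_0I:
  assumes "\<And>h. h \<in> ker S g A \<Longrightarrow> h = 0" shows "dim (ker S g A) = 0"
  using assms by (auto simp: dim_eq_0)

text \<open>Each equation cuts the dimension by at most one: a multiple of one vector
  \<open>k\<close> with \<open>g a \<bullet> k \<noteq> 0\<close> moves any vector of the larger
  kernel into the smaller one.\<close>

lemma dim_le_dim_ker_plus_card:
  assumes "subspace S" "finite A"
  shows "dim S \<le> dim (ker S g A) + card A"
  using assms(2)
proof (induction A)
  case empty
  then show ?case by (simp add: ker_def)
next
  case (insert a A)
  let ?K = "ker S g A" and ?L = "ker S g (insert a A)"
  have "dim ?K \<le> dim ?L + 1"
  proof (cases "\<exists>k\<in>?K. g a \<bullet> k \<noteq> 0")
    case False
    then have "?K \<subseteq> ?L" unfolding ker_def by blast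
    from dim_subset[OF this] show ?thesis by simp
  next
    case True
    then obtain k where k: "k \<in> ?K" "g a \<bullet> k \<noteq> 0" by blast
    have "?K \<subseteq> span (insert k ?L)"
    proof
      fix h assume h: "h \<in> ?K"
      define c where "c = (g a \<bullet> h) / (g a \<bullet> k)"
      have "h - c *\<^sub>R k \<in> ?K"
        using h k subspace_ker[OF assms(1), of g A] by (simp add: subspace_diff subspace_scale)
      moreover have "g a \<bullet> (h - c *\<^sub>R k) = 0"
        using k by (simp add: c_def inner_diff_right)
      ultimately have "h - c *\<^sub>R k \<in> ?L" unfolding ker_def by blast
      then have "(h - c *\<^sub>R k) + c *\<^sub>R k \<in> span (insert k ?L)"
        by (intro span_add span_scale span_base) auto
      then show "h \<in> span (insert k ?L)" by simp
    qed
    then have "dim ?K \<le> dim (insert k ?L)"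
      using dim_subset[of ?K "span (insert k ?L)"] by simp
    also have "\<dots> \<le> dim ?L + 1" by (simp add: dim_insert)
    finally show ?thesis .
  qed
  then show ?case using insert by simp
qed

text \<open>Supplies the row to be tilted. A basis chosen among the rows has at most
  \<open>dim S\<close> elements, hence misses an index, and the missed row vanishes wherever the
  basis does.\<close>

lemma exists_redundant_row:
  assumes "subspace S" "finite U" "g ` U \<subseteq> S" "dim (ker S g U) = 0" "dim S < card U"
  shows "\<exists>i\<in>U. dim (ker S g (U - {i})) = 0"
proof -
  obtain B where B: "B \<subseteq> g ` U" "independent B" "g ` U \<subseteq> span B"
    using maximal_independent_subset by blast
  have "card B \<le> dim S"
    using B(1,2) assms(3) by (intro independent_card_le_dim) auto
  \<comment> \<open>\<open>g\<close> may repeat a row, so one index is chosen for each basis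
    vector.\<close>
  obtain C where C: "C \<subseteq> U" "B = g ` C" "card C = card B"
    using B(1) unfolding subset_image_inj by (auto simp: card_image)
  have "\<exists>i\<in>U. i \<notin> C"
  proof (rule ccontr)
    assume "\<not> ?thesis"
    with C(1) have "C = U" by blast
    with C(3) \<open>card B \<le> dim S\<close> assms(5) show False by simp
  qed
  then obtain i where i: "i \<in> U" "i \<notin> C" by blast
  have "dim (ker S g (U - {i})) = 0"
  proof (rule dim_ker_eq_0I)
    fix h assume h: "h \<in> ker S g (U - {i})"
    have B0: "\<forall>b\<in>B. b \<bullet> h = 0"
    proof
      fix b assume "b \<in> B"
      then obtain c where "c \<in> C" "b = g c" using C(2) by blast
      then have "c \<in> U - {i}" using C(1) i by blast
      then show "b \<bullet> h = 0" using h \<open>b = g c\<close> by (simp add: ker_def)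
    qed
    have "subspace {b. b \<bullet> h = 0}" by (simp add: subspace_def inner_add_left)
    with B0 have "span B \<subseteq> {b. b \<bullet> h = 0}" by (intro span_minimal) auto
    with h B(3) have "h \<in> ker S g U" unfolding ker_def by blast
    then show "h = 0" using dim_0_D assms(4) by blast
  qed
  with i show ?thesis by blast
qed

section \<open>The wedge over a facet with one tilted row\<close>

locale wedge_tilt =
  fixes S :: "'a::euclidean_space set" and g :: "'i \<Rightarrow> 'a" and I :: "'i set"
    and e :: 'a and i0 j0 n :: 'i and \<epsilon> :: real
  assumes S: "subspace S" and gS: "\<And>i. i \<in> I \<Longrightarrow> g i \<in> S"
    and ee: "e \<bullet> e = 1" and eS: "\<And>x. x \<in> S \<Longrightarrow> e \<bullet> x = 0"
    and i0: "i0 \<in> I" and j0: "j0 \<in> I" and ij: "i0 \<noteq> j0" and n: "n \<notin> I" and eps: "\<epsilon> > 0"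
begin

definition S' where "S' = {w. w - (e \<bullet> w) *\<^sub>R e \<in> S}"
definition I' where "I' = insert n I"
text \<open>Rows \<open>j0\<close> and \<open>n\<close> together bound the absolute value of the
  height \<open>e \<bullet> w\<close> by \<open>1 - g j0 \<bullet> w\<close>: this is the wedge over
  the facet \<open>j0\<close>. The tilted row agrees with the old row \<open>i0\<close> at height
  zero, so it cuts the vertical line over any point of the old facet there.\<close>

definition g' where "g' i = (if i = i0 then g i0 + \<epsilon> *\<^sub>R e else if i = j0 then g j0 + e
  else if i = n then g j0 - e else g i)"
definition base where "base w = w - (e \<bullet> w) *\<^sub>R e"

text \<open>Rows \<open>j0\<close> and \<open>n\<close> are both tight exactly at the points of height \<open>e \<bullet> w = 0\<close> on the old row \<open>j0\<close>.\<close>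
definition pr where "pr A = (A - {j0, n}) \<union> (if j0 \<in> A \<and> n \<in> A then {j0} else {})"

text \<open>Only an inclusion of tight sets is asked, so \<open>x\<close> may be more degenerate
  than \<open>w\<close>; this is what a small tilt can guarantee.\<close>

definition shadow where "shadow w x \<longleftrightarrow> x \<in> pol S g I \<and> pr (tight g' I' w) \<subseteq> tight g I x"

text \<open>For such a vertex the tilted row \<open>i0\<close> is the only one that can fix the
  height. The apex \<open>u\<close> is of this kind, the apex \<open>v\<close> is not.\<close>

definition flat where
  "flat w \<longleftrightarrow> vert S' g' I' w \<and> j0 \<notin> tight g' I' w \<and> n \<notin> tight g' I' w"

lemma i0n: "i0 \<noteq> n" and j0n: "j0 \<noteq> n"
  using i0 j0 n by auto

lemma eS': "x \<in> S \<Longrightarrow> x \<bullet> e = 0"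
  using eS[of x] by (subst inner_commute)

lemma base_S: "w \<in> S' \<Longrightarrow> base w \<in> S"
  by (simp add: S'_def base_def)

lemma lift_S': "x \<in> S \<Longrightarrow> x + t *\<^sub>R e \<in> S'"
  by (simp add: S'_def inner_add_right eS ee)

lemma e_lift: "x \<in> S \<Longrightarrow> e \<bullet> (x + t *\<^sub>R e) = t"
  by (simp add: inner_add_right eS ee)

lemma base_lift: "x \<in> S \<Longrightarrow> base (x + t *\<^sub>R e) = x"
  by (simp add: base_def e_lift)

lemma lift_0:
  assumes "x \<in> S" "x + t *\<^sub>R e = 0" shows "x = 0"
proof -
  have "x = base (x + t *\<^sub>R e)" using base_lift[OF assms(1)] by simp
  also have "\<dots> = 0" unfolding assms(2) by (simp add: base_def)
  finally show ?thesis .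
qed

lemma S_S': "x \<in> S \<Longrightarrow> x \<in> S'"
  using lift_S'[of x 0] by simp

lemma S'_e0: "w \<in> S' \<Longrightarrow> e \<bullet> w = 0 \<Longrightarrow> w \<in> S"
  by (simp add: S'_def)

lemma subspace_S': "subspace S'"
proof -
  have "linear (\<lambda>w. w - (e \<bullet> w) *\<^sub>R e)"
    by (intro linearI) (auto simp: algebra_simps inner_add_right)
  then have "subspace ((\<lambda>w. w - (e \<bullet> w) *\<^sub>R e) -` S)"
    using S by (rule linear_subspace_vimage)
  then show ?thesis by (simp add: S'_def vimage_def)
qed

lemma base_inner: "i \<in> I \<Longrightarrow> g i \<bullet> base w = g i \<bullet> w"
  using gS eS' by (simp add: base_def inner_diff_right)

lemma g'_S': "i \<in> I' \<Longrightarrow> g' i \<in> S'"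
proof -
  assume i: "i \<in> I'"
  have "g i0 + \<epsilon> *\<^sub>R e \<in> S'" "g j0 + 1 *\<^sub>R e \<in> S'" "g j0 + (-1) *\<^sub>R e \<in> S'"
    using lift_S' gS i0 j0 by blast+
  moreover have "i \<in> I \<Longrightarrow> g i \<in> S'" using gS S_S' by blast
  ultimately show ?thesis using i by (auto simp: g'_def I'_def)
qed

lemma g'_i0: "g' i0 \<bullet> w = g i0 \<bullet> w + \<epsilon> * (e \<bullet> w)"
  by (simp add: g'_def inner_add_left)
lemma g'_j0: "g' j0 \<bullet> w = g j0 \<bullet> w + e \<bullet> w"
  using ij by (simp add: g'_def inner_add_left)
lemma g'_n: "g' n \<bullet> w = g j0 \<bullet> w - e \<bullet> w"
  using i0n j0n by (simp add: g'_def inner_diff_left)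
lemma g'_other: "i \<noteq> i0 \<Longrightarrow> i \<noteq> j0 \<Longrightarrow> i \<noteq> n \<Longrightarrow> g' i \<bullet> w = g i \<bullet> w"
  by (simp add: g'_def)

lemma pol'_S': "w \<in> pol S' g' I' \<Longrightarrow> w \<in> S'"
  by (simp add: pol_def)

lemma vert_pol: "vert S' g' I' w \<Longrightarrow> w \<in> pol S' g' I'"
  by (simp add: vert_def)

lemma tight_I': "tight g' I' w \<subseteq> I'" by (auto simp: tight_def)

lemma tightD: "i \<in> tight g' I' w \<Longrightarrow> g' i \<bullet> w = 1" by (auto simp: tight_def)

lemma shadow_D:
  assumes "shadow w x" "i \<in> tight g' I' w" "i \<noteq> j0" "i \<noteq> n"
  shows "g i \<bullet> x = 1"
proof -
  have "i \<in> pr (tight g' I' w)" using assms by (simp add: pr_def)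
  with assms(1) have "i \<in> tight g I x" unfolding shadow_def by blast
  then show ?thesis by (simp add: tight_def)
qed

lemma shadow_S: "shadow w x \<Longrightarrow> x \<in> S" by (simp add: shadow_def pol_def)

lemma g'_e0: "e \<bullet> w = 0 \<Longrightarrow> i \<in> I \<Longrightarrow> g' i \<bullet> w = g i \<bullet> w"
  using n ij by (cases "i = i0"; cases "i = j0") (auto simp: g'_i0 g'_j0 intro: g'_other)

lemma e0_both:
  assumes "e \<bullet> w = 0" shows "j0 \<in> tight g' I' w \<longleftrightarrow> n \<in> tight g' I' w"
  using assms j0 by (simp add: tight_def I'_def g'_j0 g'_n)

lemma both_e0:
  assumes "j0 \<in> tight g' I' w" "n \<in> tight g' I' w"
  shows "e \<bullet> w = 0" "g j0 \<bullet> w = 1"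
  using tightD[OF assms(1)] tightD[OF assms(2)] by (simp_all add: g'_j0 g'_n)

lemma tight_e0:
  assumes "e \<bullet> w = 0"
  shows "tight g I w = pr (tight g' I' w)"
proof -
  have "tight g I w = tight g' I' w - {n}"
    using n by (auto simp: tight_def I'_def g'_e0[OF assms])
  also have "\<dots> = pr (tight g' I' w)"
    using e0_both[OF assms] j0n by (auto simp: pr_def)
  finally show ?thesis .
qed

lemma pol_e0:
  assumes "w \<in> pol S' g' I'" "e \<bullet> w = 0"
  shows "w \<in> pol S g I"
  using assms S'_e0 by (auto simp: pol_def I'_def g'_e0[OF assms(2)])

lemma shadow_e0: "w \<in> pol S' g' I' \<Longrightarrow> e \<bullet> w = 0 \<Longrightarrow> shadow w w"
  unfolding shadow_def using pol_e0 tight_e0 by blast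

text \<open>Letting the tilt tend to zero never drops the rank of a set of rows that are tight at a
  common point \<open>w\<close>: a drop forces the hyperplane \<open>i0\<close> to contain the whole flat through \<open>w\<close>, hence
  \<open>w\<close> to have height zero.\<close>
lemma dim_ker_pr_le:
  assumes w: "w \<in> pol S' g' I'" "C \<subseteq> tight g' I' w" and sh: "shadow w x0"
    and one: "(j0 \<in> C) \<noteq> (n \<in> C) \<Longrightarrow> e \<bullet> w \<noteq> 0"
  shows "dim (ker S g (pr C)) \<le> dim (ker S' g' C)"
proof -
  let ?K = "ker S g (pr C)" and ?L = "ker S' g' C"
  have CI: "C \<subseteq> I'" using w tight_I' by blast
  have KS: "h \<in> S" if "h \<in> ?K" for h using that by (simp add: ker_def)
  have K0: "g i \<bullet> h = 0" if "h \<in> ?K" "i \<in> pr C" for h i using that by (simp add: ker_def)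
  have tight_w: "g' i \<bullet> w = 1" if "i \<in> C" for i using that w(2) tightD by blast
  \<comment> \<open>Treats \<open>k = j0\<close> with \<open>s = 1\<close> and \<open>k = n\<close>
    with \<open>s = -1\<close> at once: when exactly one copy of the wedged row is in
    \<open>C\<close>, it can be solved for the height.\<close>
  have single: "dim (ker S g (C - {j0, n})) \<le> dim ?L"
    if k: "k \<in> C" "C \<inter> {j0, n} = {k}" and s: "s * s = (1::real)"
      "\<And>w. g' k \<bullet> w = g j0 \<bullet> w + s * (e \<bullet> w)" for k s
  proof -
    let ?K1 = "ker S g (C - {j0, n})"
    have "k = j0 \<or> k = n" using k(2) by blast
    then have e_w: "e \<bullet> w \<noteq> 0" using k one j0n by (cases "n \<in> C"; cases "j0 \<in> C") auto
    have CI': "C - {j0, n} \<subseteq> I" using CI by (auto simp: I'_def)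
    have KS1: "h \<in> S" if "h \<in> ?K1" for h using that by (simp add: ker_def)
    have row: "g' i \<bullet> (y + t *\<^sub>R e) = g i \<bullet> y" if "i \<in> C" "i \<noteq> k" "i \<noteq> i0" for i y t
    proof -
      have i: "i \<noteq> j0" "i \<noteq> n" "i \<in> I" using that k CI by (auto simp: I'_def)
      then show ?thesis using that(3) eS'[OF gS[OF i(3)]] by (simp add: g'_other inner_add_right)
    qed
    have rowk: "g' k \<bullet> (y + t *\<^sub>R e) = g j0 \<bullet> y + s * t" if "y \<in> S" for y t
      unfolding s(2) e_lift[OF that] using eS'[OF gS[OF j0]] by (simp add: inner_add_right)
    have rowi0: "g' i0 \<bullet> (y + t *\<^sub>R e) = g i0 \<bullet> y + \<epsilon> * t" if "y \<in> S" for y t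
      unfolding g'_i0 e_lift[OF that] using eS'[OF gS[OF i0]] by (simp add: inner_add_right)
    show ?thesis
    proof (cases "i0 \<notin> C \<or> (\<forall>h\<in>?K1. g j0 \<bullet> h = 0)")
      case True
      \<comment> \<open>The height \<open>- s * (g j0 \<bullet> h)\<close> is the one forced by row
        \<open>k\<close>. Of the other rows in \<open>C\<close> only \<open>i0\<close> could notice
        it, and if \<open>i0\<close> is present the height is zero.\<close>
      show ?thesis
      proof (rule dim_le_inj_linear[where f = "\<lambda>h. h + (- s * (g j0 \<bullet> h)) *\<^sub>R e"])
        show "linear (\<lambda>h. h + (- s * (g j0 \<bullet> h)) *\<^sub>R e)"
          by (intro linearI) (auto simp: inner_add_right algebra_simps)
        show "subspace ?K1" using S by (rule subspace_ker)
        show "(\<lambda>h. h + (- s * (g j0 \<bullet> h)) *\<^sub>R e) ` ?K1 \<subseteq> ?L"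
        proof safe
          fix h assume h: "h \<in> ?K1"
          let ?w = "h + (- s * (g j0 \<bullet> h)) *\<^sub>R e"
          have "g' i \<bullet> ?w = 0" if i: "i \<in> C" for i
          proof -
            consider "i = k" | "i \<noteq> k" "i = i0" | "i \<noteq> k" "i \<noteq> i0" by blast
            then show ?thesis
            proof cases
              case 1
              then show ?thesis using rowk[OF KS1[OF h]] s(1)
                by (metis add.right_inverse minus_mult_right mult.assoc mult.left_neutral mult_minus_left)
            next
              case 2
              then have "g j0 \<bullet> h = 0" using True i h by blast
              moreover have "g i0 \<bullet> h = 0" using h i 2 ij i0n by (simp add: ker_def)
              ultimately show ?thesis unfolding 2(2) rowi0[OF KS1[OF h]] by simp
            next
              case 3
              moreover have "g i \<bullet> h = 0" using h i 3 k by (auto simp: ker_def)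
              ultimately show ?thesis unfolding row[OF i 3] by simp
            qed
          qed
          then show "?w \<in> ?L" unfolding ker_def using lift_S'[OF KS1[OF h]] by blast
        qed
        show "h = 0" if "h \<in> ?K1" "h + (- s * (g j0 \<bullet> h)) *\<^sub>R e = 0" for h
          using lift_0[OF KS1[OF that(1)] that(2)] .
      qed
    next
      case False
      then obtain h1 where h1: "h1 \<in> ?K1" "g j0 \<bullet> h1 \<noteq> 0" and i0C: "i0 \<in> C" by blast
      let ?K2 = "ker S g (C - {j0, n, i0})"
      have K12: "?K1 \<subseteq> ?K2" by (intro ker_mono) auto
      have "\<exists>k1\<in>?K2. g i0 \<bullet> k1 \<noteq> 0"
      proof (rule ccontr)
        assume a: "\<not> ?thesis"
        have "base w - x0 \<in> ?K2"
        proof (rule diff_in_ker[OF S base_S[OF pol'_S'[OF w(1)]] shadow_S[OF sh]], rule ballI)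
          fix i assume i: "i \<in> C - {j0, n, i0}"
          then have "i \<in> I" using CI by (auto simp: I'_def)
          then have "g i \<bullet> base w = 1"
            using tight_w[of i] i base_inner g'_other by auto
          moreover have "g i \<bullet> x0 = 1" using shadow_D[OF sh] i w(2) by auto
          ultimately show "g i \<bullet> base w = g i \<bullet> x0" by simp
        qed
        then have "g i0 \<bullet> (base w - x0) = 0" using a by blast
        moreover have "g i0 \<bullet> x0 = 1" using shadow_D[OF sh] i0C w(2) ij i0n by auto
        ultimately have "g i0 \<bullet> w = 1" using base_inner[OF i0] by (simp add: inner_diff_right)
        moreover have "g i0 \<bullet> w + \<epsilon> * (e \<bullet> w) = 1" using tight_w[OF i0C] g'_i0 by simp
        ultimately show False using eps e_w by simp
      qed
      then obtain k1 where k1: "k1 \<in> ?K2" "g i0 \<bullet> k1 \<noteq> 0" by blast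
      define k2 where "k2 = k1 - ((g j0 \<bullet> k1) / (g j0 \<bullet> h1)) *\<^sub>R h1"
      have k2: "k2 \<in> ?K2" "g j0 \<bullet> k2 = 0" "g i0 \<bullet> k2 \<noteq> 0"
      proof -
        show "k2 \<in> ?K2" unfolding k2_def using k1 h1 K12 subspace_ker[OF S]
          by (intro subspace_diff subspace_scale) auto
        show "g j0 \<bullet> k2 = 0" using h1 by (simp add: k2_def inner_diff_right)
        have "g i0 \<bullet> h1 = 0" using h1 i0C ij i0n by (simp add: ker_def)
        then show "g i0 \<bullet> k2 \<noteq> 0" using k1 by (simp add: k2_def inner_diff_right)
      qed
      \<comment> \<open>Subtracting \<open>c h *\<^sub>R k2\<close> cancels what the height of
        \<open>F h\<close> adds to the tilted row; \<open>k2\<close> vanishes on \<open>g j0\<close>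
        and on the remaining rows of \<open>C\<close>, so nothing else is disturbed.\<close>
      define c where "c h = - \<epsilon> * s * (g j0 \<bullet> h) / (g i0 \<bullet> k2)" for h
      define F where "F h = (h - c h *\<^sub>R k2) + (- s * (g j0 \<bullet> h)) *\<^sub>R e" for h
      have k2S: "k2 \<in> S" using k2(1) by (simp add: ker_def)
      have FS: "h - c h *\<^sub>R k2 \<in> S" if "h \<in> ?K1" for h
        using KS1[OF that] k2S S by (intro subspace_diff subspace_scale)
      show ?thesis
      proof (rule dim_le_inj_linear[where f = F])
        show "linear F" unfolding F_def c_def
          by (intro linearI) (auto simp: inner_add_right algebra_simps add_divide_distrib diff_divide_distrib)
        show "subspace ?K1" using S by (rule subspace_ker)
        show "F ` ?K1 \<subseteq> ?L"
        proof safe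
          fix h assume h: "h \<in> ?K1"
          have "g' i \<bullet> F h = 0" if i: "i \<in> C" for i
          proof -
            consider "i = k" | "i \<noteq> k" "i = i0" | "i \<noteq> k" "i \<noteq> i0" by blast
            then show ?thesis
            proof cases
              case 1
              have "g' k \<bullet> F h = g j0 \<bullet> h - (s * s) * (g j0 \<bullet> h)"
                unfolding F_def rowk[OF FS[OF h]] by (simp add: inner_diff_right k2(2) algebra_simps)
              then show ?thesis using s(1) 1 by simp
            next
              case 2
              have "g i0 \<bullet> h = 0" using h i 2 ij i0n by (simp add: ker_def)
              then have "g' i0 \<bullet> F h = - (c h * (g i0 \<bullet> k2)) - \<epsilon> * s * (g j0 \<bullet> h)"
                unfolding F_def rowi0[OF FS[OF h]] by (simp add: inner_diff_right algebra_simps)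
              then show ?thesis using k2(3) 2 by (simp add: c_def)
            next
              case 3
              moreover have "g i \<bullet> h = 0" "g i \<bullet> k2 = 0" using h k2(1) i 3 k by (auto simp: ker_def)
              ultimately show ?thesis unfolding F_def row[OF i 3] by (simp add: inner_diff_right)
            qed
          qed
          then show "F h \<in> ?L" unfolding ker_def F_def using lift_S'[OF FS[OF h]] by blast
        qed
        show "h = 0" if h: "h \<in> ?K1" and F0: "F h = 0" for h
        proof -
          have "h - c h *\<^sub>R k2 = 0" using lift_0[OF FS[OF h]] F0 unfolding F_def by blast
          then have hc: "h = c h *\<^sub>R k2" by simp
          have "g i0 \<bullet> h = 0" using h i0C ij i0n by (simp add: ker_def)
          then have "c h * (g i0 \<bullet> k2) = 0" using arg_cong[OF hc, of "\<lambda>z. g i0 \<bullet> z"] by simp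
          then show ?thesis using k2(3) hc by simp
        qed
      qed
    qed
  qed
  show ?thesis
  proof (cases "j0 \<in> C")
    case jC: True
    show ?thesis
    proof (cases "n \<in> C")
      case nC: True
      have prC: "pr C = C - {n}" using jC nC j0n by (auto simp: pr_def)
      have "?K \<subseteq> ?L"
      proof
        fix h assume h: "h \<in> ?K"
        have "g' i \<bullet> h = 0" if "i \<in> C" for i
          using K0[OF h] eS[OF KS[OF h]] that jC j0n i0n by (cases "i = n") (auto simp: prC g'_n g'_def inner_add_left inner_diff_left)
        then show "h \<in> ?L" using S_S' KS[OF h] by (simp add: ker_def)
      qed
      then show ?thesis by (rule dim_subset)
    next
      case nC: False
      show ?thesis using single[of j0 1] jC nC by (simp add: g'_j0 pr_def)
    qed
  next
    case jC: False
    show ?thesis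
    proof (cases "n \<in> C")
      case nC: True
      show ?thesis using single[of n "-1"] jC nC by (simp add: g'_n pr_def)
    next
      case nC: False
      have prC: "pr C = C" using jC nC by (auto simp: pr_def)
      have "?K \<subseteq> ?L"
      proof
        fix h assume h: "h \<in> ?K"
        have "g' i \<bullet> h = 0" if "i \<in> C" for i
          using K0[OF h] eS[OF KS[OF h]] that jC nC CI prC by (metis g'_e0 I'_def insertE subsetD)
        then show "h \<in> ?L" using S_S' KS[OF h] by (simp add: ker_def)
      qed
      then show ?thesis by (rule dim_subset)
    qed
  qed
qed

text \<open>Without the two wedge rows, only the tilted row sees the height. It is solved for the
  height and then imposes nothing on the horizontal part.\<close>

lemma dim_ker_vertical:
  assumes "C \<subseteq> I'" "i0 \<in> C" "j0 \<notin> C" "n \<notin> C"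
  shows "dim (ker S g (C - {i0})) \<le> dim (ker S' g' C)"
proof (rule dim_le_inj_linear[where f = "\<lambda>h. h + (- (g i0 \<bullet> h) / \<epsilon>) *\<^sub>R e"])
  show "linear (\<lambda>h. h + (- (g i0 \<bullet> h) / \<epsilon>) *\<^sub>R e)"
    by (intro linearI) (auto simp: inner_add_right algebra_simps add_divide_distrib diff_divide_distrib)
  show "subspace (ker S g (C - {i0}))" using S by (rule subspace_ker)
  show "(\<lambda>h. h + (- (g i0 \<bullet> h) / \<epsilon>) *\<^sub>R e) ` ker S g (C - {i0}) \<subseteq> ker S' g' C"
  proof safe
    fix h assume h: "h \<in> ker S g (C - {i0})"
    then have hS: "h \<in> S" by (simp add: ker_def)
    let ?w = "h + (- (g i0 \<bullet> h) / \<epsilon>) *\<^sub>R e"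
    have "g' i \<bullet> ?w = 0" if "i \<in> C" for i
    proof (cases "i = i0")
      case True
      have "g i0 \<bullet> ?w = g i0 \<bullet> h" using eS'[OF gS[OF i0]] by (simp add: inner_add_right inner_diff_right)
      then show ?thesis unfolding True g'_i0 e_lift[OF hS] using eps by simp
    next
      case False
      with that assms have i: "i \<in> I" "i \<noteq> j0" "i \<noteq> n" by (auto simp: I'_def)
      have "g i \<bullet> ?w = g i \<bullet> h" using eS'[OF gS[OF i(1)]] by (simp add: inner_add_right inner_diff_right)
      moreover have "g i \<bullet> h = 0" using h that False by (simp add: ker_def)
      ultimately show ?thesis unfolding g'_other[OF False i(2,3)] by simp
    qed
    then show "?w \<in> ker S' g' C" unfolding ker_def using lift_S'[OF hS] by blast
  qed
  show "h = 0" if "h \<in> ker S g (C - {i0})" "h + (- (g i0 \<bullet> h) / \<epsilon>) *\<^sub>R e = 0" for h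
    using lift_0[OF _ that(2)] that(1) by (simp add: ker_def)
qed

lemma e_S': "e \<in> S'"
  using lift_S'[OF subspace_0[OF S], of 1] by simp

lemma e_nonzero: "e \<noteq> 0" using ee by auto

lemma vertical_ker:
  assumes "C \<subseteq> I'" "i0 \<notin> C" "j0 \<notin> C" "n \<notin> C"
  shows "e \<in> ker S' g' C"
proof -
  have "g' i \<bullet> e = 0" if "i \<in> C" for i
  proof -
    have "i \<in> I" "i \<noteq> i0" "i \<noteq> j0" "i \<noteq> n" using assms that by (auto simp: I'_def)
    then show ?thesis using eS'[OF gS] by (simp add: g'_other)
  qed
  then show ?thesis using e_S' by (simp add: ker_def)
qed

section \<open>Vertices and walks of the tilted wedge compared with their shadows\<close>

lemma shadow_vert:
  assumes w: "w \<in> pol S' g' I'" and C: "C \<subseteq> tight g' I' w" and sh: "shadow w x"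
    and one: "(j0 \<in> C) \<noteq> (n \<in> C) \<Longrightarrow> e \<bullet> w \<noteq> 0" and d: "dim (ker S' g' C) = 0"
  shows "dim (ker S g (pr C)) = 0" "vert S g I x"
proof -
  show *: "dim (ker S g (pr C)) = 0"
    using dim_ker_pr_le[OF w C sh one] d by simp
  have "pr C \<subseteq> pr (tight g' I' w)" using C by (auto simp: pr_def split: if_splits)
  then have "ker S g (tight g I x) \<subseteq> ker S g (pr C)"
    using sh unfolding shadow_def by (intro ker_mono) blast
  then have "dim (ker S g (tight g I x)) = 0" using * dim_subset by fastforce
  then show "vert S g I x" using sh by (simp add: vert_def shadow_def)
qed

lemma tight_one: "(j0 \<in> tight g' I' w) \<noteq> (n \<in> tight g' I' w) \<Longrightarrow> e \<bullet> w \<noteq> 0"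
  using e0_both by blast

lemma vert'_shadow_vert:
  assumes "vert S' g' I' w" "shadow w x"
  shows "dim (ker S g (pr (tight g' I' w))) = 0" "vert S g I x"
proof -
  have "w \<in> pol S' g' I'" "dim (ker S' g' (tight g' I' w)) = 0" using assms(1) by (auto simp: vert_def)
  from shadow_vert[OF this(1) order_refl assms(2) tight_one this(2)]
  show "dim (ker S g (pr (tight g' I' w))) = 0" "vert S g I x" by blast+
qed

lemma shadow_unique:
  assumes "vert S' g' I' w" "shadow w x" "shadow w y"
  shows "x = y"
proof (rule ker_eq_0_unique[OF S vert'_shadow_vert(1)[OF assms(1,2)]])
  have "pr (tight g' I' w) \<subseteq> tight g I x \<inter> tight g I y" using assms(2,3) by (simp add: shadow_def)
  then show "\<forall>i\<in>pr (tight g' I' w). g i \<bullet> x = g i \<bullet> y"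
    unfolding tight_def by fastforce
qed (use assms shadow_S in auto)

text \<open>The projected common rows are tight at both shadows, and by the rank comparison they
  leave at most one direction free. The shadows may coincide, which is harmless because
  \<open>adj\<close> allows pauses at vertices.\<close>

lemma shadow_adj:
  assumes ww: "(w, w') \<in> adj S' g' I'" and x: "shadow w x" and x': "shadow w' x'"
  shows "(x, x') \<in> adj S g I"
proof -
  let ?C = "tight g' I' w \<inter> tight g' I' w'"
  have w: "vert S' g' I' w" "vert S' g' I' w'" and d: "dim (ker S' g' ?C) \<le> 1"
    using ww by (auto simp: adj_def)
  \<comment> \<open>The rank comparison is applied at an endpoint of nonzero height. If both heights
    are zero, \<open>j0\<close> and \<open>n\<close> are tight only together, so its side condition
    is void.\<close>
  have "dim (ker S g (pr ?C)) \<le> dim (ker S' g' ?C)"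
  proof (cases "e \<bullet> w = 0")
    case False
    then show ?thesis using dim_ker_pr_le[OF vert_pol[OF w(1)] _ x] by blast
  next
    case True
    show ?thesis
    proof (cases "e \<bullet> w' = 0")
      case False
      then show ?thesis using dim_ker_pr_le[OF vert_pol[OF w(2)] _ x'] by blast
    next
      case True': True
      show ?thesis
        using dim_ker_pr_le[OF vert_pol[OF w(1)] _ x, of ?C] e0_both[OF True] e0_both[OF True'] by blast
    qed
  qed
  moreover have "pr ?C \<subseteq> tight g I x \<inter> tight g I x'"
  proof -
    have "pr ?C \<subseteq> pr (tight g' I' w)" "pr ?C \<subseteq> pr (tight g' I' w')"
      by (auto simp: pr_def split: if_splits)
    then show ?thesis using x x' by (auto simp: shadow_def)
  qed
  then have "dim (ker S g (tight g I x \<inter> tight g I x')) \<le> dim (ker S g (pr ?C))"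
    by (intro dim_subset ker_mono)
  ultimately show ?thesis
    using d vert'_shadow_vert(2)[OF w(1) x] vert'_shadow_vert(2)[OF w(2) x'] by (simp add: adj_def)
qed

text \<open>If \<open>i0\<close> were missing as well, \<open>e\<close> would lie in the kernel. The
  rows other than \<open>i0\<close> pin the base point to the shadow, and comparing row
  \<open>i0\<close> with its tilted form then forces height zero. The subset \<open>C\<close> allows
  an application after one wedge row has been deleted.\<close>

lemma flat_D_aux:
  assumes w: "w \<in> pol S' g' I'" and sh: "shadow w x"
    and C: "C \<subseteq> tight g' I' w" "j0 \<notin> C" "n \<notin> C" "dim (ker S' g' C) = 0"
  shows "i0 \<in> C" "e \<bullet> w = 0" "dim (ker S g (C - {i0})) = 0"
proof -
  have CI: "C \<subseteq> I'" using C(1) tight_I' by blast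
  show i0C: "i0 \<in> C"
  proof (rule ccontr)
    assume "i0 \<notin> C"
    from vertical_ker[OF CI this C(2,3)] dim_0_D[OF C(4)] e_nonzero show False by blast
  qed
  show *: "dim (ker S g (C - {i0})) = 0"
    using dim_ker_vertical[OF CI i0C C(2,3)] C(4) by simp
  have "base w = x"
  proof (rule ker_eq_0_unique[OF S * base_S[OF pol'_S'[OF w]] shadow_S[OF sh]], rule ballI)
    fix i assume i: "i \<in> C - {i0}"
    then have "i \<in> I" "i \<noteq> j0" "i \<noteq> n" using CI C by (auto simp: I'_def)
    moreover have "g' i \<bullet> w = 1" using i C(1) tightD by blast
    moreover have "g i \<bullet> x = 1" using shadow_D[OF sh] i C by blast
    ultimately show "g i \<bullet> base w = g i \<bullet> x" using i by (simp add: base_inner g'_other)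
  qed
  then have "g i0 \<bullet> w = 1"
    using shadow_D[OF sh _ ij i0n] i0C C(1) base_inner[OF i0, of w] by auto
  moreover have "g i0 \<bullet> w + \<epsilon> * (e \<bullet> w) = 1" using g'_i0 i0C C(1) tightD by (metis subsetD)
  ultimately show "e \<bullet> w = 0" using eps by simp
qed

lemma flat_D:
  assumes "flat w" "shadow w x"
  shows "e \<bullet> w = 0" "i0 \<in> tight g' I' w" "tight g I w = tight g' I' w"
    "dim (ker S g (tight g' I' w - {i0})) = 0" "shadow w w"
proof -
  have w: "w \<in> pol S' g' I'" "j0 \<notin> tight g' I' w" "n \<notin> tight g' I' w"
     "dim (ker S' g' (tight g' I' w)) = 0"
    using assms(1) by (auto simp: flat_def vert_def)
  note f = flat_D_aux[OF w(1) assms(2) order_refl w(2-4)]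
  show e: "e \<bullet> w = 0" and "i0 \<in> tight g' I' w" "dim (ker S g (tight g' I' w - {i0})) = 0"
    using f by auto
  show "tight g I w = tight g' I' w" using tight_e0[OF e] w by (simp add: pr_def)
  show "shadow w w" using shadow_e0[OF w(1) e] .
qed

text \<open>The step that leaves height zero is invisible in the shadow: this is the extra unit of length.\<close>
lemma flat_leave:
  assumes ess: "essential S g I i0 j0"
    and w: "flat w" "shadow w x" and w': "\<not> flat w'" "shadow w' x'"
    and ww: "(w, w') \<in> adj S' g' I'"
  shows "x' = w"
proof -
  let ?C = "tight g' I' w \<inter> tight g' I' w'"
  note f = flat_D[OF w]
  have vw: "vert S' g' I' w" "vert S' g' I' w'" and d: "dim (ker S' g' ?C) \<le> 1"
    using ww by (auto simp: adj_def)
  have CI: "?C \<subseteq> I'" using tight_I' by blast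
  have jC: "j0 \<notin> ?C" "n \<notin> ?C" using w(1) by (auto simp: flat_def)
  have wS: "w \<in> S" using shadow_S[OF f(5)] .
  have x'C: "g i \<bullet> w = g i \<bullet> x'" if "i \<in> ?C" for i
  proof -
    have "i \<in> tight g I w" using that f(3) by blast
    moreover have "g i \<bullet> x' = 1" using shadow_D[OF w'(2)] that jC by blast
    ultimately show ?thesis by (simp add: tight_def)
  qed
  have eq: "x' = w" if "dim (ker S g ?C) = 0"
    using ker_eq_0_unique[OF S that wS shadow_S[OF w'(2)]] x'C by auto
  show ?thesis
  proof (cases "i0 \<in> ?C")
    case False
    \<comment> \<open>No common row sees the height, so the kernel upstairs is the line of
      \<open>e\<close>, which contains no nonzero horizontal vector.\<close>
    have "ker S g ?C \<subseteq> {0}"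
    proof
      fix h assume h: "h \<in> ker S g ?C"
      then have hS: "h \<in> S" by (simp add: ker_def)
      have "g' i \<bullet> h = 0" if "i \<in> ?C" for i
        using h that False jC CI g'_other[of i h] by (auto simp: ker_def)
      then have "h \<in> ker S' g' ?C" using S_S'[OF hS] by (simp add: ker_def)
      from dim_1_multiple[OF d vertical_ker[OF CI False jC] this e_nonzero]
      obtain c where "h = c *\<^sub>R e" by blast
      then show "h \<in> {0}" using eS[OF hS] ee by simp
    qed
    then show ?thesis using eq by simp
  next
    case True
    have d1: "dim (ker S g (?C - {i0})) \<le> 1"
      using dim_ker_vertical[OF CI True jC] d by simp
    show ?thesis
    proof (cases "\<exists>k\<in>ker S g (?C - {i0}). g i0 \<bullet> k \<noteq> 0")
      case k: True
      then obtain k where k: "k \<in> ker S g (?C - {i0})" "g i0 \<bullet> k \<noteq> 0" by blast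
      have "h = 0" if h: "h \<in> ker S g ?C" for h
      proof -
        have "h \<in> ker S g (?C - {i0})" using h by (auto simp: ker_def)
        from dim_1_multiple[OF d1 k(1) this] k(2) obtain c where c: "h = c *\<^sub>R k" by fastforce
        have "g i0 \<bullet> h = 0" using h True unfolding ker_def by blast
        then show "h = 0" using c k(2) by simp
      qed
      then show ?thesis by (intro eq dim_ker_eq_0I)
    next
      case False
      \<comment> \<open>Here row \<open>i0\<close> is implied by the other common rows. This puts
        \<open>w'\<close> at height zero too, as a vertex of the old spindle on \<open>j0\<close> at
        which \<open>i0\<close> is redundant: the case that \<open>ess\<close> rules out.\<close>
      have w'p: "w' \<in> pol S' g' I'" using vert_pol[OF vw(2)] .
      have "base w' - w \<in> ker S g (?C - {i0})"
      proof (rule diff_in_ker[OF S base_S[OF pol'_S'[OF w'p]] wS], rule ballI)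
        fix i assume i: "i \<in> ?C - {i0}"
        then have "i \<in> I" "i \<noteq> j0" "i \<noteq> n" using CI jC by (auto simp: I'_def)
        moreover have "g' i \<bullet> w' = 1" "g' i \<bullet> w = 1" using i tightD by blast+
        ultimately show "g i \<bullet> base w' = g i \<bullet> w" using i by (simp add: base_inner g'_other)
      qed
      then have "g i0 \<bullet> (base w' - w) = 0" using False by blast
      then have "g i0 \<bullet> w' = g i0 \<bullet> w" using base_inner[OF i0] by (simp add: inner_diff_right)
      moreover have "g i0 \<bullet> w = 1" using f(2,3) by (auto simp: tight_def)
      moreover have "g i0 \<bullet> w' + \<epsilon> * (e \<bullet> w') = 1" using g'_i0 True tightD by (metis IntD2)
      ultimately have e': "e \<bullet> w' = 0" using eps by simp
      have t': "tight g I w' = pr (tight g' I' w')" using tight_e0[OF e'] .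
      have "j0 \<in> tight g' I' w' \<and> n \<in> tight g' I' w'"
        using w'(1) vw(2) e0_both[OF e'] unfolding flat_def by blast
      then have mem: "j0 \<in> tight g I w'" "i0 \<in> tight g I w'"
        using True ij i0n t' by (auto simp: pr_def)
      have vw': "vert S g I w'"
        using vert'_shadow_vert(2)[OF vw(2) shadow_e0[OF w'p e']] .
      have "ker S g (tight g I w' - {i0}) \<subseteq> ker S g (tight g I w')"
      proof
        fix h assume h: "h \<in> ker S g (tight g I w' - {i0})"
        have "?C - {i0} \<subseteq> tight g I w' - {i0}" using t' jC by (auto simp: pr_def)
        then have "h \<in> ker S g (?C - {i0})" using h ker_mono by blast
        then have "g i0 \<bullet> h = 0" using False by blast
        then show "h \<in> ker S g (tight g I w')" using h by (auto simp: ker_def)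
      qed
      then have "dim (ker S g (tight g I w' - {i0})) = 0"
        using vw' dim_subset unfolding vert_def by fastforce
      then show ?thesis using ess vw' mem unfolding essential_def by blast
    qed
  qed
qed

text \<open>The first step out of the flat vertices earns one step of credit, since the shadow
  stands still. Between other vertices the shadow follows at equal pace. A return to a flat vertex
  gives the credit back, and the proof fills it with a pause.\<close>

lemma walk_shadow:
  assumes ess: "essential S g I i0 j0" and u: "flat u"
    and sh: "\<And>w. w \<in> pol S' g' I' \<Longrightarrow> \<exists>x. shadow w x"
  shows "(u, w) \<in> adj S' g' I' ^^ k \<Longrightarrow>
    (flat w \<and> (u, w) \<in> adj S g I ^^ k) \<or>
    (\<not> flat w \<and> (\<exists>m x. k = Suc m \<and> shadow w x \<and> (u, x) \<in> adj S g I ^^ m))"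
proof (induction k arbitrary: w)
  case 0
  then show ?case using u by simp
next
  case (Suc k)
  then obtain y where y: "(u, y) \<in> adj S' g' I' ^^ k" and yw: "(y, w) \<in> adj S' g' I'"
    by auto
  then have v: "vert S' g' I' y" "vert S' g' I' w" by (auto simp: adj_def)
  obtain x where x: "shadow w x" using sh vert_pol v by blast
  obtain x' where x': "shadow y x'" using sh vert_pol v by blast
  show ?case
  proof (cases "flat y")
    case True
    then have uy: "(u, y) \<in> adj S g I ^^ k" using Suc.IH[OF y] by blast
    have yy: "shadow y y" using flat_D(5)[OF True x'] .
    show ?thesis
    proof (cases "flat w")
      case w: True
      have "(y, w) \<in> adj S g I" using shadow_adj[OF yw yy flat_D(5)[OF w x]] .
      then show ?thesis using w uy by auto
    next
      case False
      then have "x = y" using flat_leave[OF ess True x' _ x yw] by blast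
      then show ?thesis using False uy x by blast
    qed
  next
    case False
    then obtain m z where m: "k = Suc m" "shadow y z" "(u, z) \<in> adj S g I ^^ m"
      using Suc.IH[OF y] by blast
    have zx: "(z, x) \<in> adj S g I" using shadow_adj[OF yw m(2) x] .
    then have ux: "(u, x) \<in> adj S g I ^^ k" using m by auto
    show ?thesis
    proof (cases "flat w")
      case w: True
      have "x = w" using shadow_unique[OF v(2) x flat_D(5)[OF w x]] .
      then have "(x, w) \<in> adj S g I" using vert'_shadow_vert(2)[OF v(2) x]
        by (simp add: adj_def vert_def del: dim_eq_0)
      then show ?thesis using w ux \<open>x = w\<close> by auto
    next
      case False
      then show ?thesis using ux x by blast
    qed
  qed
qed

end

section \<open>Essential rows of the tilted wedge\<close>

context wedge_tilt begin

text \<open>A deletion that keeps full rank upstairs would, by the rank comparison, keep full rank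
  at the shadow. Since \<open>a\<close> is not a wedge row, deleting it commutes with
  projecting.\<close>

lemma essential_other:
  assumes sh: "\<And>w. w \<in> pol S' g' I' \<Longrightarrow> \<exists>x. shadow w x"
    and ess: "essential S g I a b" and ab: "a \<in> I" "b \<in> I" "a \<noteq> j0" "b \<noteq> j0"
  shows "essential S' g' I' a b"
  unfolding essential_def
proof (intro allI impI notI)
  fix w assume w: "vert S' g' I' w" "a \<in> tight g' I' w" "b \<in> tight g' I' w"
    and d: "dim (ker S' g' (tight g' I' w - {a})) = 0"
  have abn: "a \<noteq> n" "b \<noteq> n" using ab n by auto
  obtain x where x: "shadow w x" using sh vert_pol[OF w(1)] by blast
  let ?C = "tight g' I' w - {a}"
  have "(j0 \<in> ?C) \<noteq> (n \<in> ?C) \<Longrightarrow> e \<bullet> w \<noteq> 0" using tight_one[of w] ab abn by blast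
  note sv = shadow_vert[OF vert_pol[OF w(1)] _ x this d]
  have ab': "a \<in> tight g I x" "b \<in> tight g I x"
    using x w ab abn by (auto simp: shadow_def pr_def)
  have "pr ?C \<subseteq> tight g I x - {a}"
    using x ab by (auto simp: shadow_def pr_def split: if_splits)
  then have "ker S g (tight g I x - {a}) \<subseteq> ker S g (pr ?C)" by (rule ker_mono)
  then have "dim (ker S g (tight g I x - {a})) = 0" using sv(1) dim_subset by fastforce
  then show False using ess ab' sv(2) unfolding essential_def by blast
qed

text \<open>A direction freed by deleting \<open>j0\<close> in the old spindle is lifted to the
  height at which the remaining copy of the row still vanishes. If the tilted row is tight, a
  direction freed by deleting \<open>i0\<close> corrects it.\<close>

lemma essential_wedge:
  assumes sh: "\<And>w. w \<in> pol S' g' I' \<Longrightarrow> \<exists>x. shadow w x"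
    and ess: "essential S g I j0 b" "essential S g I i0 j0" and b: "b \<in> I" "b \<noteq> j0"
    and k: "k = j0 \<or> k = n"
  shows "essential S' g' I' k b"
  unfolding essential_def
proof (intro allI impI notI)
  fix w assume w: "vert S' g' I' w" "k \<in> tight g' I' w" "b \<in> tight g' I' w"
    and d: "dim (ker S' g' (tight g' I' w - {k})) = 0"
  \<comment> \<open>\<open>k'\<close> is the copy that remains after deleting \<open>k\<close>, and
    \<open>s\<close> is the sign with which it sees the height.\<close>
  obtain k' s where k': "{k, k'} = {j0, n}" "k' \<noteq> k" "s * s = (1::real)"
    "\<And>w. g' k' \<bullet> w = g j0 \<bullet> w + s * (e \<bullet> w)"
  proof -
    from k show thesis
    proof
      assume "k = j0" with that[of n "-1"] j0n show thesis by (simp add: g'_n)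
    next
      assume "k = n" with that[of j0 1] j0n show thesis by (simp add: g'_j0 insert_commute)
    qed
  qed
  have bn: "b \<noteq> n" using b n by auto
  have wp: "w \<in> pol S' g' I'" using vert_pol[OF w(1)] .
  obtain x where x: "shadow w x" using sh wp by blast
  \<comment> \<open>If only \<open>k\<close> were tight, deleting it would leave no wedge row; the
    previous analysis then gives height zero, where both copies are tight or neither is.\<close>
  have both: "j0 \<in> tight g' I' w" "n \<in> tight g' I' w"
  proof -
    have "k' \<in> tight g' I' w"
    proof (rule ccontr)
      assume a: "k' \<notin> tight g' I' w"
      have "j0 \<notin> tight g' I' w - {k}" "n \<notin> tight g' I' w - {k}" using a k'(1) by blast+
      from flat_D_aux(2)[OF wp x _ this d] have "e \<bullet> w = 0" by blast
      from e0_both[OF this] a w(2) k'(1) show False unfolding doubleton_eq_iff by metis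
    qed
    then show "j0 \<in> tight g' I' w" "n \<in> tight g' I' w"
      using w(2) k'(1) unfolding doubleton_eq_iff by metis+
  qed
  have e0: "e \<bullet> w = 0" using both_e0(1)[OF both] .
  have t: "tight g I w = pr (tight g' I' w)" using tight_e0[OF e0] .
  have v: "vert S g I w" using vert'_shadow_vert(2)[OF w(1) shadow_e0[OF wp e0]] .
  have mem: "j0 \<in> tight g I w" "b \<in> tight g I w"
    using both w(3) b bn by (auto simp: t pr_def)
  have tv: "h = 0" if "h \<in> ker S g (tight g I w)" for h
    using v dim_0_D that unfolding vert_def by blast
  have "\<not> ker S g (tight g I w - {j0}) \<subseteq> {0}"
    using ess(1) v mem unfolding essential_def by (metis dim_eq_0)
  then obtain h where h: "h \<in> ker S g (tight g I w - {j0})" "h \<noteq> 0" by blast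
  have hS: "h \<in> S" using h by (simp add: ker_def)
  have hj: "g j0 \<bullet> h \<noteq> 0"
  proof
    assume "g j0 \<bullet> h = 0"
    then have "h \<in> ker S g (tight g I w)" using h(1) by (auto simp: ker_def)
    then show False using tv h(2) by blast
  qed
  define t where "t = - s * (g j0 \<bullet> h)"
  have t0: "t \<noteq> 0" using hj k'(3) by (auto simp: t_def)
  have "\<exists>y\<in>ker S g (tight g I w - {j0, i0}). g j0 \<bullet> y = g j0 \<bullet> h \<and>
      (i0 \<in> tight g I w \<longrightarrow> g i0 \<bullet> y + \<epsilon> * t = 0)"
  proof (cases "i0 \<in> tight g I w")
    case False
    then show ?thesis using h(1) by (intro bexI[of _ h]) (auto simp: ker_def)
  next
    case True
    have "\<not> ker S g (tight g I w - {i0}) \<subseteq> {0}"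
      using ess(2) v mem True unfolding essential_def by (metis dim_eq_0)
    then obtain k1 where k1: "k1 \<in> ker S g (tight g I w - {i0})" "k1 \<noteq> 0" by blast
    have k1i: "g i0 \<bullet> k1 \<noteq> 0"
    proof
      assume "g i0 \<bullet> k1 = 0"
      then have "k1 \<in> ker S g (tight g I w)" using k1(1) by (auto simp: ker_def)
      then show False using tv k1(2) by blast
    qed
    have k1j: "g j0 \<bullet> k1 = 0" using k1(1) mem(1) ij by (auto simp: ker_def)
    have hi: "g i0 \<bullet> h = 0" using h(1) True ij by (auto simp: ker_def)
    let ?y = "h + (- \<epsilon> * t / (g i0 \<bullet> k1)) *\<^sub>R k1"
    have "h \<in> ker S g (tight g I w - {j0, i0})" "k1 \<in> ker S g (tight g I w - {j0, i0})"
      using h(1) k1(1) by (auto simp: ker_def)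
    then have "?y \<in> ker S g (tight g I w - {j0, i0})"
      using subspace_ker[OF S] by (intro subspace_add subspace_scale)
    then show ?thesis using hi k1i k1j
      by (intro bexI[of _ ?y]) (auto simp: inner_add_right inner_diff_right)
  qed
  then obtain y where y: "y \<in> ker S g (tight g I w - {j0, i0})" "g j0 \<bullet> y = g j0 \<bullet> h"
    "i0 \<in> tight g I w \<longrightarrow> g i0 \<bullet> y + \<epsilon> * t = 0" by blast
  have yS: "y \<in> S" using y by (simp add: ker_def)
  have row: "g i \<bullet> (y + t *\<^sub>R e) = g i \<bullet> y" if "i \<in> I" for i
    using eS'[OF gS[OF that]] by (simp add: inner_add_right)
  have "g' i \<bullet> (y + t *\<^sub>R e) = 0" if i: "i \<in> tight g' I' w - {k}" for i
  proof -
    consider "i = k'" | "i = i0" "i \<noteq> k'" | "i \<noteq> k'" "i \<noteq> i0" by blast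
    then show ?thesis
    proof cases
      case 1
      have "g' k' \<bullet> (y + t *\<^sub>R e) = g j0 \<bullet> h - (s * s) * (g j0 \<bullet> h)"
        unfolding k'(4) e_lift[OF yS] row[OF j0] y(2) by (simp add: t_def)
      then show ?thesis using k'(3) 1 by simp
    next
      case 2
      then have "i0 \<in> tight g I w" using i ij i0n unfolding \<open>tight g I w = pr _\<close> pr_def by auto
      then show ?thesis using y(3) unfolding 2(1) g'_i0 e_lift[OF yS] row[OF i0] by blast
    next
      case 3
      have i': "i \<noteq> j0" "i \<noteq> n" using 3 i k'(1) by blast+
      then have "i \<in> tight g I w - {j0, i0}" using 3 i unfolding \<open>tight g I w = pr _\<close> pr_def by auto
      moreover from this have "i \<in> I" by (simp add: tight_def)
      ultimately show ?thesis unfolding g'_other[OF 3(2) i'] row[OF \<open>i \<in> I\<close>]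
        using y(1) by (simp add: ker_def)
    qed
  qed
  then have "y + t *\<^sub>R e \<in> ker S' g' (tight g' I' w - {k})"
    using lift_S'[OF yS] unfolding ker_def by blast
  from dim_0_D[OF d this] have "y + t *\<^sub>R e = 0" .
  then show False using e_lift[OF yS, of t] t0 by simp
qed

section \<open>Boundedness and existence of shadows for a small tilt\<close>

lemma pol'_rows:
  assumes "w \<in> pol S' g' I'" "i \<in> I" "i \<noteq> i0"
  shows "g i \<bullet> w \<le> 1"
proof (cases "i = j0")
  case True
  have "g' j0 \<bullet> w \<le> 1" "g' n \<bullet> w \<le> 1" using assms(1) j0 by (auto simp: pol_def I'_def)
  then show ?thesis using True by (simp add: g'_j0 g'_n)
next
  case False
  have "i \<noteq> n" using assms n by blast
  then have "g' i \<bullet> w = g i \<bullet> w" using g'_other False assms by blast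
  moreover have "g' i \<bullet> w \<le> 1" using assms by (auto simp: pol_def I'_def)
  ultimately show ?thesis by simp
qed

text \<open>Over the base only row \<open>i0\<close> is relaxed, by at most \<epsilon> times the
  absolute height, so the base point lies in a slightly enlarged copy of the old body. The wedge
  rows bound the height linearly in the norm of the base point. The smallness of \<epsilon> lets
  this circular estimate absorb itself with factor 1/2.\<close>

lemma pol'_bound:
  assumes R: "\<And>x. x \<in> pol S g I \<Longrightarrow> norm x \<le> R" "R \<ge> 0"
    and small: "\<epsilon> \<le> 1" "2 * \<epsilon> * R * norm (g j0) \<le> 1" and w: "w \<in> pol S' g' I'"
  shows "norm w \<le> 4 * R + (1 + 4 * R * norm (g j0))"
proof -
  let ?x = "base w" and ?t = "e \<bullet> w" and ?G = "norm (g j0)"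
  have xS: "?x \<in> S" using base_S pol'_S' w by blast
  have "g' j0 \<bullet> w \<le> 1" "g' n \<bullet> w \<le> 1" using w j0 by (auto simp: pol_def I'_def)
  then have "g j0 \<bullet> ?x + \<bar>?t\<bar> \<le> 1" using base_inner[OF j0] by (simp add: g'_j0 g'_n)
  moreover have "\<bar>g j0 \<bullet> ?x\<bar> \<le> ?G * norm ?x" by (rule Cauchy_Schwarz_ineq2)
  ultimately have t: "\<bar>?t\<bar> \<le> 1 + ?G * norm ?x" by linarith
  define m where "m = 1 + \<epsilon> * \<bar>?t\<bar>"
  have m: "m \<ge> 1" using eps by (simp add: m_def)
  have "g i \<bullet> ?x \<le> m" if i: "i \<in> I" for i
  proof (cases "i = i0")
    case True
    have "g' i0 \<bullet> w \<le> 1" using w i0 by (auto simp: pol_def I'_def)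
    moreover have "\<epsilon> * - ?t \<le> \<epsilon> * \<bar>?t\<bar>" using eps by (intro mult_left_mono) auto
    ultimately show ?thesis using True base_inner[OF i] by (simp add: g'_i0 m_def)
  next
    case False
    show ?thesis using pol'_rows[OF w i False] base_inner[OF i] m by simp
  qed
  then have "(1 / m) *\<^sub>R ?x \<in> pol S g I"
    using m xS S by (auto simp: pol_def subspace_scale field_simps)
  from R(1)[OF this] m have "norm ?x \<le> R * m" by (simp add: field_simps)
  also have "R * m \<le> R * (1 + \<epsilon> * (1 + ?G * norm ?x))"
    unfolding m_def using t R(2) eps by (intro mult_left_mono add_left_mono) auto
  also have "\<dots> = R * (1 + \<epsilon>) + (\<epsilon> * R * ?G) * norm ?x" by (simp add: algebra_simps)
  also have "\<dots> \<le> R * 2 + (1/2) * norm ?x"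
    using small R(2) by (intro add_mono mult_left_mono mult_right_mono) auto
  finally have x: "norm ?x \<le> 4 * R" by simp
  have "norm w \<le> norm ?x + norm (?t *\<^sub>R e)"
    using norm_triangle_ineq[of ?x "?t *\<^sub>R e"] by (simp add: base_def)
  also have "norm (?t *\<^sub>R e) = \<bar>?t\<bar>" using ee by (simp add: norm_eq_sqrt_inner)
  also have "\<dots> \<le> 1 + ?G * (4 * R)"
    using t x by (meson add_left_mono mult_left_mono norm_ge_zero order_trans)
  finally show ?thesis using x by (simp add: mult.commute)
qed

text \<open>The wedge before tilting, that is, the rows at \<epsilon> = 0.\<close>

definition g0 where "g0 i = (if i = j0 then g j0 + e else if i = n then g j0 - e else g i)"

lemma g'_g0: "g' i \<bullet> w = g0 i \<bullet> w + (if i = i0 then \<epsilon> * (e \<bullet> w) else 0)"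
  using ij i0n by (simp add: g0_def g'_def inner_add_left)

text \<open>Tightness enters as \<open>\<ge> 1\<close> next to \<open>\<le> 1\<close>, so that
  existence of \<open>w0\<close> is feasibility of a system of inequalities, to which the
  compactness argument applies.\<close>

lemma shadow_of_untilted:
  assumes w0: "w0 \<in> S'" "\<forall>i\<in>I'. g0 i \<bullet> w0 \<le> 1" "\<forall>i\<in>tight g' I' w. g0 i \<bullet> w0 \<ge> 1"
  shows "shadow w (base w0)"
proof -
  have eq1: "g0 i \<bullet> w0 = 1" if "i \<in> tight g' I' w" for i
    using w0 that tight_I' by (meson antisym subsetD)
  have j: "g0 j0 \<bullet> w0 = g j0 \<bullet> w0 + e \<bullet> w0" "g0 n \<bullet> w0 = g j0 \<bullet> w0 - e \<bullet> w0"
    using j0n by (auto simp: g0_def inner_add_left inner_diff_left)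
  have o: "g0 i \<bullet> w0 = g i \<bullet> w0" if "i \<noteq> j0" "i \<noteq> n" for i using that by (simp add: g0_def)
  have "g i \<bullet> base w0 \<le> 1" if i: "i \<in> I" for i
  proof (cases "i = j0")
    case True
    have "g0 j0 \<bullet> w0 \<le> 1" "g0 n \<bullet> w0 \<le> 1" using w0(2) j0 by (auto simp: I'_def)
    then show ?thesis using True j base_inner[OF j0] by simp
  next
    case False
    have "i \<noteq> n" using i n by blast
    then show ?thesis using w0(2) i o[OF False] base_inner[OF i] by (auto simp: I'_def)
  qed
  moreover have "g i \<bullet> base w0 = 1" if i: "i \<in> pr (tight g' I' w)" for i
  proof (cases "i = j0")
    case True
    then have "j0 \<in> tight g' I' w" "n \<in> tight g' I' w" using i by (auto simp: pr_def split: if_splits)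
    then show ?thesis using eq1 j True base_inner[OF j0] by fastforce
  next
    case False
    then have "i \<in> tight g' I' w" "i \<noteq> n" using i by (auto simp: pr_def split: if_splits)
    moreover from this have "i \<in> I" using tight_I' by (auto simp: I'_def)
    ultimately show ?thesis using eq1[of i] o[OF False] base_inner[of i] by simp
  qed
  moreover have "pr (tight g' I' w) \<subseteq> I"
    using tight_I' j0 by (auto simp: pr_def I'_def split: if_splits)
  ultimately show ?thesis using base_S[OF w0(1)] by (auto simp: shadow_def pol_def tight_def)
qed

end

text \<open>The sum of the positive parts of the violations attains a positive minimum on
  \<open>K\<close>, and at every point some violation must carry its share of it.\<close>

lemma compact_infeasible_gap:
  fixes f :: "'i \<Rightarrow> 'a::topological_space \<Rightarrow> real"
  assumes "compact K" "finite J" "\<And>i. i \<in> J \<Longrightarrow> continuous_on K (f i)"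
    and "\<not> (\<exists>w\<in>K. \<forall>i\<in>J. f i w \<le> 0)"
  shows "\<exists>d>0. \<forall>w\<in>K. \<exists>i\<in>J. f i w > d"
proof (cases "K = {}")
  case True
  then show ?thesis by (auto intro: exI[of _ 1])
next
  case False
  define F where "F w = (\<Sum>i\<in>J. max 0 (f i w))" for w
  have "continuous_on K F" unfolding F_def
    by (intro continuous_intros assms(3))
  from continuous_attains_inf[OF assms(1) False this]
  obtain m where m: "m \<in> K" "\<And>w. w \<in> K \<Longrightarrow> F m \<le> F w" by blast
  obtain i where "i \<in> J" "f i m > 0" using assms(4) m(1) by force
  then have Fm: "F m > 0" unfolding F_def
    by (intro sum_pos2[OF assms(2)]) auto
  \<comment> \<open>The \<open>+ 1\<close> turns the average share into a strict bound.\<close>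
  define d where "d = F m / (real (card J) + 1)"
  have d: "d > 0" using Fm by (simp add: d_def)
  have "\<exists>i\<in>J. f i w > d" if w: "w \<in> K" for w
  proof (rule ccontr)
    assume "\<not> ?thesis"
    then have "F w \<le> (\<Sum>i\<in>J. d)" unfolding F_def using d by (intro sum_mono) force
    also have "\<dots> = real (card J) * d" by simp
    also have "\<dots> < (real (card J) + 1) * d" using d by simp
    also have "\<dots> = F m" by (simp add: d_def)
    finally show False using m(2)[OF w] by simp
  qed
  then show ?thesis using d by blast
qed

section \<open>Dimension and facets of the tilted wedge\<close>

context wedge_tilt begin

lemma dim_S': "dim S' = Suc (dim S)"
proof -
  have "e \<notin> span S" using eS[of e] ee S by (auto simp: span_eq_iff[THEN iffD2])
  then have *: "dim (insert e S) = Suc (dim S)" by (simp add: dim_insert)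
  have "insert e S \<subseteq> S'" using e_S' S_S' by auto
  moreover have "S' \<subseteq> span (insert e S)"
  proof
    fix w assume w: "w \<in> S'"
    have "base w + (e \<bullet> w) *\<^sub>R e \<in> span (insert e S)"
      using base_S[OF w] by (intro span_add span_scale span_base) auto
    then show "w \<in> span (insert e S)" by (simp add: base_def)
  qed
  ultimately show ?thesis using * dim_subset dim_span by (metis antisym)
qed

lemma irredundant':
  assumes small: "\<epsilon> < 1"
    and irr: "\<And>i. i \<in> I \<Longrightarrow> \<exists>x\<in>S. g i \<bullet> x = 1 \<and> (\<forall>k\<in>I - {i}. g k \<bullet> x < 1)"
    and i: "i \<in> I'"
  shows "\<exists>w\<in>S'. g' i \<bullet> w = 1 \<and> (\<forall>k\<in>I' - {i}. g' k \<bullet> w < 1)"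
proof (cases "i = j0 \<or> i = n")
  case False
  then have iI: "i \<in> I" using i by (auto simp: I'_def)
  then obtain x where x: "x \<in> S" "g i \<bullet> x = 1" "\<forall>k\<in>I - {i}. g k \<bullet> x < 1" using irr by blast
  have e0: "e \<bullet> x = 0" using eS x by blast
  have "g' k \<bullet> x < 1" if k: "k \<in> I' - {i}" for k
  proof (cases "k = n")
    case True
    then show ?thesis using x(3) j0 False e0 by (auto simp: g'_n)
  next
    case False
    then show ?thesis using x(3) k g'_e0[OF e0] by (auto simp: I'_def)
  qed
  then show ?thesis using x g'_e0[OF e0 iI] S_S' by (intro bexI[of _ x]) auto
next
  case True
  obtain x where x: "x \<in> S" "g j0 \<bullet> x = 1" "\<forall>k\<in>I - {j0}. g k \<bullet> x < 1" using irr j0 by blast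
  have "(g i0 \<bullet> x) < 1" using x(3) i0 ij by blast
  \<comment> \<open>The witness for a wedge row is the midpoint of \<open>x\<close>, which lies on
    both copies, and of \<open>s *\<^sub>R e\<close> over the origin, which lies on copy
    \<open>i\<close> but strictly inside the other.\<close>
  define s where "s = (if i = j0 then 1 else - 1 :: real)"
  obtain c :: real where c: "0 < c" "c < 1" "\<forall>k\<in>I - {j0}. c * (g k \<bullet> x) < 1 - \<bar>\<epsilon> * (1 - c)\<bar> \<or> k \<noteq> i0"
  proof -
    have "(1/2) * (g i0 \<bullet> x) < 1 - \<bar>\<epsilon> * (1 - 1/2)\<bar>" using \<open>g i0 \<bullet> x < 1\<close> small eps by simp
    then show thesis by (intro that[of "1/2"]) auto
  qed
  let ?y = "c *\<^sub>R x" and ?w = "c *\<^sub>R x + (s * (1 - c)) *\<^sub>R e"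
  have yS: "?y \<in> S" using x S by (simp add: subspace_scale)
  have row: "g k \<bullet> ?w = c * (g k \<bullet> x)" if "k \<in> I" for k
    using eS'[OF gS[OF that]] by (simp add: inner_add_right)
  have rows: "g' k \<bullet> ?w < 1" if k: "k \<in> I" "k \<noteq> j0" for k
  proof (cases "k = i0")
    case True
    have "\<epsilon> * (s * (1 - c)) \<le> \<bar>\<epsilon> * (1 - c)\<bar>" using c eps by (auto simp: s_def)
    moreover have "c * (g i0 \<bullet> x) < 1 - \<bar>\<epsilon> * (1 - c)\<bar>" using c(3) i0 ij by blast
    ultimately show ?thesis unfolding True g'_i0 row[OF i0] e_lift[OF yS] by linarith
  next
    case False
    have kn: "k \<noteq> n" using k n by blast
    have "c * (g k \<bullet> x) < 1"
    proof (cases "g k \<bullet> x \<le> 0")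
      case True
      then show ?thesis using c by (meson less_eq_real_def mult_nonneg_nonpos order_le_less_trans zero_less_one)
    next
      case False
      have "g k \<bullet> x < 1" using x(3) k by blast
      then have "c * (g k \<bullet> x) < 1 * 1" using c False by (intro mult_strict_mono) auto
      then show ?thesis by simp
    qed
    then show ?thesis unfolding g'_other[OF False k(2) kn] row[OF k(1)] .
  qed
  have "g' j0 \<bullet> ?w = c + s * (1 - c)" "g' n \<bullet> ?w = c - s * (1 - c)"
    unfolding g'_j0 g'_n row[OF j0] e_lift[OF yS] x(2) by simp_all
  note jn = this
  have "g' k \<bullet> ?w < 1" if k: "k \<in> I' - {i}" for k
  proof (cases "k = j0 \<or> k = n")
    case False
    then show ?thesis using k rows by (auto simp: I'_def)
  next
    case k': True
    then show ?thesis using k True jn c j0n by (auto simp: s_def)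
  qed
  moreover have "g' i \<bullet> ?w = 1" using True jn j0n by (auto simp: s_def)
  ultimately show ?thesis using lift_S'[OF yS] by blast
qed

end

section \<open>One d-step: choice of the tilt and properties of the new spindle\<close>

theorem spindle_step:
  fixes g :: "nat \<Rightarrow> 'a::euclidean_space"
  assumes sp: "spindle S g U V U' V' l"
    and dims: "dim S < DIM('a)" "dim S < card U" and V': "V' \<noteq> {}"
  shows "\<exists>S2 (g2 :: nat \<Rightarrow> 'a) V2 V2'. spindle S2 g2 U V2 U' V2' (Suc l) \<and> dim S2 = Suc (dim S) \<and>
    card V2 = Suc (card V) \<and> card V' = Suc (card V2')"
proof -
  define I where "I = U \<union> V"
  from sp obtain u v where sub: "U' \<subseteq> U" "V' \<subseteq> V"
    and ess: "\<And>i j. i \<in> U \<Longrightarrow> j \<in> V' \<Longrightarrow> essential S g I i j"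
      "\<And>i j. j \<in> V \<Longrightarrow> i \<in> U' \<Longrightarrow> essential S g I j i"
    and pre: "pre_spindle S g U V u v"
    and len: "\<And>k. k < l \<Longrightarrow> (u, v) \<notin> adj S g I ^^ k"
    unfolding spindle_def I_def by blast
  from pre have S: "subspace S" and fin: "finite U" "finite V" and UV: "U \<inter> V = {}"
    and gS: "g ` I \<subseteq> S" and bdd: "bounded (pol S g I)"
    and irr: "\<And>i. i \<in> I \<Longrightarrow> \<exists>x\<in>S. g i \<bullet> x = 1 \<and> (\<forall>k\<in>I - {i}. g k \<bullet> x < 1)"
    and u: "u \<in> S" "\<And>i. i \<in> U \<Longrightarrow> g i \<bullet> u = 1" "\<And>i. i \<in> V \<Longrightarrow> g i \<bullet> u < 1"
    and v: "v \<in> S" "\<And>i. i \<in> V \<Longrightarrow> g i \<bullet> v = 1" "\<And>i. i \<in> U \<Longrightarrow> g i \<bullet> v < 1"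
    and kU: "dim (ker S g U) = 0" and kV: "dim (ker S g V) = 0"
    unfolding pre_spindle_def I_def by blast+
  have finI: "finite I" using fin by (simp add: I_def)
  obtain i0 where i0: "i0 \<in> U" "dim (ker S g (U - {i0})) = 0"
    using exists_redundant_row[OF S fin(1) _ kU dims(2)] gS by (auto simp: I_def)
  obtain j0 where j0: "j0 \<in> V'" using V' by blast
  then have j0V: "j0 \<in> V" using sub by blast
  obtain n where n: "n \<notin> I" using ex_new_if_finite[OF infinite_UNIV_nat finI] by blast
  obtain e where e: "e \<bullet> e = 1" "\<And>x. x \<in> S \<Longrightarrow> e \<bullet> x = 0"
  proof -
    obtain a where a: "a \<noteq> 0" "\<And>y. y \<in> span S \<Longrightarrow> orthogonal a y"
      using orthogonal_to_subspace_exists[OF dims(1)] by blast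
    show thesis
    proof (rule that[of "(1 / norm a) *\<^sub>R a"])
      show "((1 / norm a) *\<^sub>R a) \<bullet> ((1 / norm a) *\<^sub>R a) = 1"
        using a(1) by (simp add: dot_square_norm power2_eq_square)
      show "((1 / norm a) *\<^sub>R a) \<bullet> x = 0" if "x \<in> S" for x
        using a(2)[OF span_base[OF that]] by (simp add: orthogonal_def)
    qed
  qed
  have loc: "wedge_tilt S g I e i0 j0 n \<epsilon>" if "\<epsilon> > 0" for \<epsilon>
    using S gS e i0 j0V n that UV by unfold_locales (auto simp: I_def)
  \<comment> \<open>The tilt 1 is a placeholder. \<open>S'\<close>, \<open>I'\<close> and
    \<open>g0\<close> do not mention the tilt, so the gap below can be computed before \<epsilon> is
    chosen.\<close>
  interpret L1: wedge_tilt S g I e i0 j0 n 1 using loc by simp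
  obtain R where R: "\<And>x. x \<in> pol S g I \<Longrightarrow> norm x \<le> R" "R > 0"
    using bdd by (metis bounded_pos)
  define B where "B = 4 * R + (1 + 4 * R * norm (g j0))"
  have B: "B > 0" using R(2) by (simp add: B_def add_pos_nonneg)
  define K where "K = L1.S' \<inter> cball 0 B"
  have K: "compact K" unfolding K_def
    using closed_subspace[OF L1.subspace_S'] by (intro closed_Int_compact) auto
  \<comment> \<open>\<open>Inl i\<close> demands that row \<open>i\<close> of the untilted wedge is
    satisfied, \<open>Inr i\<close> that it is attained, both as nonpositivity.\<close>
  define f :: "nat + nat \<Rightarrow> 'a \<Rightarrow> real"
    where "f j w = (case j of Inl i \<Rightarrow> L1.g0 i \<bullet> w - 1 | Inr i \<Rightarrow> 1 - L1.g0 i \<bullet> w)" for j w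
  define J where "J A = Inl ` L1.I' \<union> Inr ` A" for A :: "nat set"
  have finI': "finite L1.I'" using finI by (simp add: L1.I'_def)
  have "\<exists>d>0. (\<exists>w\<in>K. \<forall>j\<in>J A. f j w \<le> 0) \<or> (\<forall>w\<in>K. \<exists>j\<in>J A. f j w > d)"
    if A: "A \<in> Pow L1.I'" for A
  proof (cases "\<exists>w\<in>K. \<forall>j\<in>J A. f j w \<le> 0")
    case True
    then show ?thesis by (intro exI[of _ 1]) auto
  next
    case False
    have "finite (J A)" using A finI' finite_subset by (auto simp: J_def)
    moreover have "continuous_on K (f j)" for j
      unfolding f_def by (cases j) (auto intro!: continuous_intros)
    ultimately show ?thesis using compact_infeasible_gap[OF K _ _ False] by blast
  qed
  then obtain d where d: "\<And>A. A \<in> Pow L1.I' \<Longrightarrow> d A > 0"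
    "\<And>A. A \<in> Pow L1.I' \<Longrightarrow> (\<exists>w\<in>K. \<forall>j\<in>J A. f j w \<le> 0) \<or> (\<forall>w\<in>K. \<exists>j\<in>J A. f j w > d A)"
    by metis
  \<comment> \<open>One gap for all candidates \<open>A\<close> of a tight set, since there are only
    finitely many.\<close>
  define D where "D = Min (d ` Pow L1.I')"
  have D: "D > 0" unfolding D_def using d(1) finI' by (subst Min_gr_iff) auto
  have D_le: "D \<le> d A" if "A \<in> Pow L1.I'" for A
    unfolding D_def using that finI' by (intro Min_le) auto
  \<comment> \<open>The bound 1/2 serves irredundancy, the second term boundedness. With the third,
    the tilt alters a row by at most \<open>D\<close> on the ball of radius \<open>B\<close>, so a
    tilted point violates the untilted system by no more than the gap, and that system must be
    feasible.\<close>
  define \<epsilon> where "\<epsilon> = min (1/2) (min (1 / (2 * R * norm (g j0) + 1)) (D / B))"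
  have RG: "R * norm (g j0) \<ge> 0" using R(2) by simp
  have eps: "\<epsilon> > 0" "\<epsilon> < 1" "2 * \<epsilon> * R * norm (g j0) \<le> 1" "\<epsilon> * B \<le> D"
  proof -
    show "\<epsilon> > 0" using D B RG by (simp add: \<epsilon>_def add_nonneg_pos)
    show "\<epsilon> < 1" by (simp add: \<epsilon>_def)
    have "\<epsilon> \<le> D / B" by (simp add: \<epsilon>_def)
    then show "\<epsilon> * B \<le> D" using B by (simp add: field_simps)
    have "\<epsilon> \<le> 1 / (2 * R * norm (g j0) + 1)" by (simp add: \<epsilon>_def)
    then have "\<epsilon> * (2 * R * norm (g j0) + 1) \<le> 1" using RG by (simp add: field_simps add_nonneg_pos)
    then show "2 * \<epsilon> * R * norm (g j0) \<le> 1" using \<open>\<epsilon> > 0\<close> by (simp add: algebra_simps)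
  qed
  interpret W: wedge_tilt S g I e i0 j0 n \<epsilon> using loc eps(1) .
  have bound: "norm w \<le> B" if "w \<in> pol W.S' W.g' W.I'" for w
    unfolding B_def using W.pol'_bound[OF R(1) _ _ eps(3) that] R(2) eps(2) by simp
  have sh: "\<exists>x. W.shadow w x" if w: "w \<in> pol W.S' W.g' W.I'" for w
  proof -
    let ?A = "tight W.g' W.I' w"
    have wK: "w \<in> K" using bound[OF w] W.pol'_S'[OF w] by (simp add: K_def)
    have A: "?A \<in> Pow L1.I'" using W.tight_I' by blast
    have "norm e = 1" using e(1) by (simp add: norm_eq_sqrt_inner)
    then have "\<bar>e \<bullet> w\<bar> \<le> B" using Cauchy_Schwarz_ineq2[of e w] bound[OF w] by simp
    then have "\<epsilon> * \<bar>e \<bullet> w\<bar> \<le> \<epsilon> * B" using eps(1) by (intro mult_left_mono) auto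
    then have "\<epsilon> * \<bar>e \<bullet> w\<bar> \<le> D" using eps(4) by (rule order_trans)
    then have ew: "\<bar>\<epsilon> * (e \<bullet> w)\<bar> \<le> D" using eps(1) by (simp add: abs_mult)
    have "\<not> f j w > d ?A" if j: "j \<in> J ?A" for j
    proof (cases j)
      case (Inl i)
      then have "W.g' i \<bullet> w \<le> 1" using j w by (auto simp: J_def pol_def)
      then show ?thesis using ew D_le[OF A] Inl W.g'_g0[of i w]
        by (auto simp: f_def split: if_splits)
    next
      case (Inr i)
      then have "W.g' i \<bullet> w = 1" using j W.tightD by (auto simp: J_def)
      then show ?thesis using ew D_le[OF A] Inr W.g'_g0[of i w] d(1)[OF A]
        by (auto simp: f_def split: if_splits)
    qed
    then obtain w0 where w0: "w0 \<in> K" "\<And>j. j \<in> J ?A \<Longrightarrow> f j w0 \<le> 0"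
      using d(2)[OF A] wK by blast
    have "\<forall>i\<in>W.I'. W.g0 i \<bullet> w0 \<le> 1" using w0(2)[of "Inl _"] by (auto simp: J_def f_def)
    moreover have "\<forall>i\<in>?A. W.g0 i \<bullet> w0 \<ge> 1" using w0(2)[of "Inr _"] by (auto simp: J_def f_def)
    moreover have "w0 \<in> W.S'" using w0(1) by (simp add: K_def)
    ultimately show ?thesis using W.shadow_of_untilted by blast
  qed
  have essI: "essential S g I i0 j0" using ess(1) i0 j0 by blast
  have UI: "U \<subseteq> I" "V \<subseteq> I" by (auto simp: I_def)
  have I'_eq: "U \<union> insert n V = W.I'" unfolding W.I'_def unfolding I_def by auto
  have nU: "n \<notin> U" "n \<notin> V" using n by (auto simp: I_def)
  have eu: "e \<bullet> u = 0" and ev: "e \<bullet> v = 0" using e u v by auto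
  have gU: "i \<in> U \<Longrightarrow> W.g' i \<bullet> w = g i \<bullet> w" and gV: "i \<in> V \<Longrightarrow> W.g' i \<bullet> w = g i \<bullet> w"
    if "e \<bullet> w = 0" for i w using W.g'_e0[OF that] by (auto simp: I_def)
  have gn: "W.g' n \<bullet> w = g j0 \<bullet> w" if "e \<bullet> w = 0" for w using that by (simp add: W.g'_n)
  \<comment> \<open>The redundancy of \<open>i0\<close> at \<open>u\<close> is spent here: the other
    rows of \<open>U\<close> already annihilate the base part, which frees the tilted row to
    annihilate the height.\<close>
  have kU': "dim (ker W.S' W.g' U) = 0"
  proof (rule dim_ker_eq_0I)
    fix h assume h: "h \<in> ker W.S' W.g' U"
    then have hS: "h \<in> W.S'" and h0: "\<And>i. i \<in> U \<Longrightarrow> W.g' i \<bullet> h = 0" by (auto simp: ker_def)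
    have "W.base h \<in> ker S g (U - {i0})"
    proof -
      have "g i \<bullet> W.base h = 0" if i: "i \<in> U - {i0}" for i
      proof -
        have "i \<noteq> j0" "i \<noteq> n" "i \<in> I" using i j0V UV nU by (auto simp: I_def)
        then show ?thesis using h0[of i] i by (simp add: W.base_inner W.g'_other)
      qed
      then show ?thesis using W.base_S[OF hS] by (simp add: ker_def)
    qed
    from dim_0_D[OF i0(2) this] have he: "h = (e \<bullet> h) *\<^sub>R e" by (simp add: W.base_def)
    have "g i0 \<bullet> h = 0" using W.base_inner[of i0 h] \<open>W.base h = 0\<close> i0 by (simp add: I_def)
    then have "e \<bullet> h = 0" using h0[OF i0(1)] eps(1) by (simp add: W.g'_i0)
    then show "h = 0" using he by simp
  qed
  have kV': "dim (ker W.S' W.g' (insert n V)) = 0"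
  proof (rule dim_ker_eq_0I)
    fix h assume h: "h \<in> ker W.S' W.g' (insert n V)"
    then have hS: "h \<in> W.S'" and h0: "\<And>i. i \<in> insert n V \<Longrightarrow> W.g' i \<bullet> h = 0" by (auto simp: ker_def)
    have eh: "e \<bullet> h = 0" using h0[of n] h0[of j0] j0V by (simp add: W.g'_n W.g'_j0)
    have "h \<in> ker S g V" using W.S'_e0[OF hS eh] h0 gV[OF eh] by (auto simp: ker_def)
    then show "h = 0" using dim_0_D[OF kV] by blast
  qed
  have pre': "pre_spindle W.S' W.g' U (insert n V) u v"
    unfolding pre_spindle_def I'_eq
  proof (intro conjI)
    show "W.g' ` W.I' \<subseteq> W.S'" using W.g'_S' by blast
    show "bounded (pol W.S' W.g' W.I')" using bound by (auto simp: bounded_iff)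
    show "\<forall>i\<in>W.I'. \<exists>x\<in>W.S'. W.g' i \<bullet> x = 1 \<and> (\<forall>k\<in>W.I' - {i}. W.g' k \<bullet> x < 1)"
      using W.irredundant'[OF eps(2) irr] by blast
    show "\<forall>i\<in>U. W.g' i \<bullet> u = 1" "\<forall>i\<in>insert n V. W.g' i \<bullet> u < 1"
      using u(2,3) gU[OF eu] gV[OF eu] gn[OF eu] j0V by auto
    show "\<forall>i\<in>insert n V. W.g' i \<bullet> v = 1" "\<forall>i\<in>U. W.g' i \<bullet> v < 1"
      using v(2,3) gU[OF ev] gV[OF ev] gn[OF ev] j0V by auto
  qed (use fin UV nU W.subspace_S' u v W.S_S' kU' kV' in auto)
  have u': "u \<in> pol W.S' W.g' W.I'" "tight W.g' W.I' u = U"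
    and v': "v \<in> pol W.S' W.g' W.I'" "tight W.g' W.I' v = insert n V"
    using pre' unfolding pre_spindle_def pol_def tight_def I'_eq[symmetric]
    by (auto simp: less_imp_le less_irrefl)
  have fu: "W.flat u"
    using u' kU' nU j0V UV by (auto simp: W.flat_def vert_def)
  have nfv: "\<not> W.flat v" and vv: "vert W.S' W.g' W.I' v"
    using v' j0V kV' by (auto simp: W.flat_def vert_def)
  have "(u, v) \<notin> adj W.S' W.g' W.I' ^^ k" if k: "k < Suc l" for k
  proof
    assume "(u, v) \<in> adj W.S' W.g' W.I' ^^ k"
    from W.walk_shadow[OF essI fu sh this] nfv obtain m x
      where m: "k = Suc m" "W.shadow v x" "(u, x) \<in> adj S g I ^^ m" by blast
    have "x = v" using W.shadow_unique[OF vv m(2) W.shadow_e0[OF v'(1) ev]] .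
    then show False using len[of m] m k by simp
  qed
  moreover have "essential W.S' W.g' W.I' i j" if "i \<in> U" "j \<in> V' - {j0}" for i j
    using W.essential_other[OF sh ess(1)[of i j]] that sub j0V UV UI by blast
  moreover have "essential W.S' W.g' W.I' j i" if j: "j \<in> insert n V" and i: "i \<in> U'" for i j
  proof (cases "j = j0 \<or> j = n")
    case True
    then show ?thesis using W.essential_wedge[OF sh ess(2)[OF j0V i] essI] i sub j0V UV UI
      by blast
  next
    case False
    then show ?thesis using W.essential_other[OF sh ess(2)[of j i]] j i sub j0V UV UI
      by blast
  qed
  ultimately have "spindle W.S' W.g' U (insert n V) U' (V' - {j0}) (Suc l)"
    unfolding spindle_def I'_eq using pre' sub by blast
  moreover have "card V' = Suc (card (V' - {j0}))"
    using j0 finite_subset[OF sub(2) fin(2)] by (rule card.remove[rotated])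
  moreover have "card (insert n V) = Suc (card V)" using fin(2) nU(2) by simp
  ultimately show ?thesis using W.dim_S' by blast
qed

lemma adj_sym: "(x, y) \<in> adj S g I \<Longrightarrow> (y, x) \<in> adj S g I"
  by (simp add: adj_def Int_commute)

lemma adj_relpow_sym: "(x, y) \<in> adj S g I ^^ k \<Longrightarrow> (y, x) \<in> adj S g I ^^ k"
proof (induction k arbitrary: x y)
  case (Suc k)
  then obtain z where "(x, z) \<in> adj S g I ^^ k" "(z, y) \<in> adj S g I" by auto
  from relpow_Suc_I2[OF adj_sym[OF this(2)] Suc.IH[OF this(1)]] show ?case .
qed simp

text \<open>A step adds rows to the second side only; reversing walks makes it available for the
  first side as well.\<close>

lemma spindle_swap:
  assumes "spindle S g U V U' V' l"
  shows "spindle S g V U V' U' l"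
proof -
  have "\<exists>u v. pre_spindle S g V U u v \<and> (\<forall>k<l. (u, v) \<notin> adj S g (V \<union> U) ^^ k)"
    if "pre_spindle S g U V u v" "\<forall>k<l. (u, v) \<notin> adj S g (U \<union> V) ^^ k" for u v
  proof (intro exI conjI allI impI)
    show "pre_spindle S g V U v u"
      using that(1) unfolding pre_spindle_def by (simp add: Un_commute Int_commute)
    show "(v, u) \<notin> adj S g (V \<union> U) ^^ k" if "k < l" for k
      using \<open>\<forall>k<l. _ k\<close> that adj_relpow_sym by (metis Un_commute)
  qed
  then show ?thesis using assms unfolding spindle_def by (auto simp: Un_commute)
qed

lemma spindle_steps:
  fixes g :: "nat \<Rightarrow> 'a::euclidean_space"
  assumes "spindle S g U V U' V' l" "dim S + k \<le> DIM('a)" "dim S + k \<le> card U" "k \<le> card V'"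
  shows "\<exists>S2 (g2 :: nat \<Rightarrow> 'a) V2 V2'. spindle S2 g2 U V2 U' V2' (l + k) \<and> dim S2 = dim S + k \<and>
    card V2 = card V + k"
  using assms
proof (induction k arbitrary: S g V V' l)
  case 0
  then show ?case by auto
next
  case (Suc k)
  have "V' \<noteq> {}" using Suc.prems(4) by auto
  then obtain S2 and g2 :: "nat \<Rightarrow> 'a" and V2 V2' where
    s: "spindle S2 g2 U V2 U' V2' (Suc l)" "dim S2 = Suc (dim S)" "card V2 = Suc (card V)"
      "card V' = Suc (card V2')"
    using spindle_step[OF Suc.prems(1)] Suc.prems(2,3) by auto
  then show ?case using Suc.IH[OF s(1)] Suc.prems by auto
qed

section \<open>From inequalities to polytopes\<close>

lemma pol_shift:
  assumes S: "subspace S" and fin: "finite I" and x: "x \<in> pol S g I"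
    and h: "h \<in> ker S g (tight g I x)"
  shows "\<exists>d>0. x + d *\<^sub>R h \<in> pol S g I \<and> x - d *\<^sub>R h \<in> pol S g I"
proof -
  have "\<exists>d>0. \<forall>t. \<bar>t\<bar> \<le> d \<longrightarrow> g i \<bullet> (x + t *\<^sub>R h) \<le> 1" if i: "i \<in> I" for i
  proof (cases "g i \<bullet> x = 1")
    case True
    then have "g i \<bullet> h = 0" using h i by (auto simp: ker_def tight_def)
    then show ?thesis using True by (intro exI[of _ 1]) (auto simp: inner_add_right)
  next
    case False
    then have lt: "g i \<bullet> x < 1" using x i by (force simp: pol_def)
    define d where "d = (1 - g i \<bullet> x) / (1 + \<bar>g i \<bullet> h\<bar>)"
    have d: "d > 0" using lt by (simp add: d_def)
    have "g i \<bullet> (x + t *\<^sub>R h) \<le> 1" if "\<bar>t\<bar> \<le> d" for t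
    proof -
      have "t * (g i \<bullet> h) \<le> \<bar>t\<bar> * \<bar>g i \<bullet> h\<bar>" by (metis abs_ge_self abs_mult)
      also have "\<dots> \<le> d * (1 + \<bar>g i \<bullet> h\<bar>)" using that d by (intro mult_mono) auto
      also have "\<dots> = 1 - g i \<bullet> x" by (simp add: d_def)
      finally show ?thesis by (simp add: inner_add_right)
    qed
    then show ?thesis using d by blast
  qed
  then obtain d where d: "\<And>i. i \<in> I \<Longrightarrow> d i > 0"
    "\<And>i t. i \<in> I \<Longrightarrow> \<bar>t\<bar> \<le> d i \<Longrightarrow> g i \<bullet> (x + t *\<^sub>R h) \<le> 1" by metis
  define D where "D = Min (insert 1 (d ` I))"
  have D: "D > 0" unfolding D_def using d(1) fin by (subst Min_gr_iff) auto
  have Dle: "D \<le> d i" if "i \<in> I" for i unfolding D_def using that fin by (intro Min_le) auto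
  have "x + t *\<^sub>R h \<in> pol S g I" if "\<bar>t\<bar> \<le> D" for t
    using d(2) Dle that x h S by (force simp: pol_def ker_def subspace_add subspace_scale)
  from this[of D] this[of "- D"] D show ?thesis by auto
qed

lemma face_contains_shift:
  assumes F: "F face_of P" and x: "x \<in> F" and d: "d > 0" and "x + d *\<^sub>R h \<in> P" "x - d *\<^sub>R h \<in> P"
  shows "x + d *\<^sub>R h \<in> F"
proof (cases "h = 0")
  case False
  have "x + d *\<^sub>R h \<noteq> x - d *\<^sub>R h"
  proof
    assume "x + d *\<^sub>R h = x - d *\<^sub>R h"
    then have "(2 * d) *\<^sub>R h = 0" by (simp add: algebra_simps flip: scaleR_2)
    then show False using False d by simp
  qed
  moreover have "midpoint (x + d *\<^sub>R h) (x - d *\<^sub>R h) = x"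
    by (simp add: midpoint_def flip: scaleR_2)
  ultimately have "x \<in> open_segment (x + d *\<^sub>R h) (x - d *\<^sub>R h)"
    using midpoint_in_open_segment by metis
  then show ?thesis using face_ofD[OF F _ assms(4,5) x] by blast
qed (use x in simp)

lemma extreme_point_imp_vert:
  assumes S: "subspace S" and fin: "finite I" and x: "x extreme_point_of pol S g I"
  shows "vert S g I x"
proof -
  have f: "{x} face_of pol S g I" using x by (simp add: face_of_singleton)
  then have xP: "x \<in> pol S g I" using face_of_imp_subset by blast
  have "h = 0" if h: "h \<in> ker S g (tight g I x)" for h
  proof -
    obtain d where d: "d > 0" "x + d *\<^sub>R h \<in> pol S g I" "x - d *\<^sub>R h \<in> pol S g I"
      using pol_shift[OF S fin xP h] by blast
    have "x + d *\<^sub>R h \<in> {x}" using face_contains_shift[OF f _ d] by blast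
    then show "h = 0" using d(1) by simp
  qed
  then have "dim (ker S g (tight g I x)) = 0" by (rule dim_ker_eq_0I)
  then show ?thesis using xP by (simp add: vert_def)
qed

text \<open>A row tight at the midpoint of an edge is tight at both ends, and a small move along a
  kernel direction of the midpoint stays in the edge. Hence the kernel is at most the line of the
  edge.\<close>

lemma edge_rel_subset_adj:
  assumes S: "subspace S" and fin: "finite I"
  shows "edge_rel (pol S g I) \<subseteq> adj S g I"
proof clarify
  fix v w assume "(v, w) \<in> edge_rel (pol S g I)"
  then have e: "closed_segment v w face_of pol S g I"
    by (simp add: edge_rel_def edge_of_def)
  have ext: "v extreme_point_of pol S g I" "w extreme_point_of pol S g I"
    using extreme_point_of_face[OF e] extreme_point_of_segment by blast+
  then have vw: "v \<in> pol S g I" "w \<in> pol S g I" by (auto simp: extreme_point_of_def)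
  let ?m = "midpoint v w"
  have m: "?m \<in> closed_segment v w" by simp
  then have mP: "?m \<in> pol S g I" using face_of_imp_subset[OF e] by blast
  have gm: "g i \<bullet> ?m = (g i \<bullet> v + g i \<bullet> w) / 2" for i
    by (simp add: midpoint_def inner_add_right)
  have "tight g I ?m \<subseteq> tight g I v \<inter> tight g I w"
  proof
    fix i assume "i \<in> tight g I ?m"
    then have i: "i \<in> I" "g i \<bullet> v + g i \<bullet> w = 2" by (auto simp: tight_def gm)
    moreover have "g i \<bullet> v \<le> 1" "g i \<bullet> w \<le> 1" using vw i by (auto simp: pol_def)
    ultimately show "i \<in> tight g I v \<inter> tight g I w" by (simp add: tight_def)
  qed
  then have "ker S g (tight g I v \<inter> tight g I w) \<subseteq> ker S g (tight g I ?m)" by (rule ker_mono)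
  also have "\<dots> \<subseteq> span {w - v}"
  proof
    fix h assume h: "h \<in> ker S g (tight g I ?m)"
    obtain d where d: "d > 0" "?m + d *\<^sub>R h \<in> pol S g I" "?m - d *\<^sub>R h \<in> pol S g I"
      using pol_shift[OF S fin mP h] by blast
    have "?m + d *\<^sub>R h \<in> closed_segment v w" using face_contains_shift[OF e m d] .
    then obtain t where "?m + d *\<^sub>R h = (1 - t) *\<^sub>R v + t *\<^sub>R w" by (auto simp: in_segment)
    then have "d *\<^sub>R h = ((1 - t) *\<^sub>R v + t *\<^sub>R w) - (1/2) *\<^sub>R (v + w)"
      by (simp add: midpoint_def eq_diff_eq add.commute)
    also have "\<dots> = (1 - t - 1/2) *\<^sub>R v + (t - 1/2) *\<^sub>R w"
      by (simp only: scaleR_diff_left scaleR_add_right) simp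
    also have "1 - t - 1/2 = - (t - 1/2)" by simp
    also have "- (t - 1/2) *\<^sub>R v + (t - 1/2) *\<^sub>R w = (t - 1/2) *\<^sub>R (w - v)"
      by (simp only: scaleR_diff_right scaleR_minus_left) simp
    finally have "d *\<^sub>R h = (t - 1/2) *\<^sub>R (w - v)" .
    then have "h = ((t - 1/2) / d) *\<^sub>R (w - v)"
      using d(1) by (metis divide_inverse_commute eq_vector_fraction_iff less_irrefl scaleR_scaleR)
    then show "h \<in> span {w - v}" by (simp add: span_mul span_base)
  qed
  finally have "dim (ker S g (tight g I v \<inter> tight g I w)) \<le> dim {w - v}"
    using dim_subset dim_span by metis
  also have "\<dots> \<le> 1" using dim_le_card'[of "{w - v}"] by simp
  finally show "(v, w) \<in> adj S g I"
    using ext extreme_point_imp_vert[OF S fin] by (simp add: adj_def)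
qed

lemma vert_imp_extreme_point:
  assumes S: "subspace S" and x: "vert S g I x"
  shows "x extreme_point_of pol S g I"
proof -
  have xP: "x \<in> pol S g I" and d: "dim (ker S g (tight g I x)) = 0" using x by (auto simp: vert_def)
  have False if ab: "a \<in> pol S g I" "b \<in> pol S g I" "x \<in> open_segment a b" for a b
  proof -
    obtain t where t: "a \<noteq> b" "0 < t" "t < 1" "x = (1 - t) *\<^sub>R a + t *\<^sub>R b"
      using ab(3) by (auto simp: in_segment)
    have "g i \<bullet> a = g i \<bullet> b" if i: "i \<in> tight g I x" for i
    proof -
      have le: "g i \<bullet> a \<le> 1" "g i \<bullet> b \<le> 1" using ab i by (auto simp: pol_def tight_def)
      have "(1 - t) * (1 - g i \<bullet> a) + t * (1 - g i \<bullet> b) = 0"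
        using i t(4) by (simp add: tight_def inner_add_right algebra_simps)
      moreover have "(1 - t) * (1 - g i \<bullet> a) \<ge> 0" "t * (1 - g i \<bullet> b) \<ge> 0" using le t by auto
      ultimately have "(1 - t) * (1 - g i \<bullet> a) = 0" "t * (1 - g i \<bullet> b) = 0" by linarith+
      then show ?thesis using t by simp
    qed
    then have "a = b" using ker_eq_0_unique[OF S d] ab by (auto simp: pol_def)
    then show False using t(1) by blast
  qed
  then show ?thesis using xP by (auto simp: extreme_point_of_def)
qed

lemma relpow_subset: "Q \<subseteq> R \<Longrightarrow> Q ^^ k \<subseteq> R ^^ k" for Q R :: "('a \<times> 'a) set"
  by (induction k) (auto intro: relcomp_mono)

lemma spindle_polytope:
  fixes g :: "'i \<Rightarrow> 'a::euclidean_space"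
  assumes sp: "spindle S g U V U' V' l" and d: "dim S = DIM('a)"
  defines "P \<equiv> pol S g (U \<union> V)"
  shows "polytope P" "aff_dim P = DIM('a)" "num_facets P = card U + card V"
    "combinatorial_diameter P \<ge> enat l"
proof -
  define I where "I = U \<union> V"
  from sp obtain u v where pre: "pre_spindle S g U V u v"
    and len: "\<And>k. k < l \<Longrightarrow> (u, v) \<notin> adj S g I ^^ k"
    unfolding spindle_def I_def by blast
  then have S: "subspace S" and fin: "finite U" "finite V" and UV: "U \<inter> V = {}"
    and bdd: "bounded P"
    and irr: "\<And>i. i \<in> I \<Longrightarrow> \<exists>x\<in>S. g i \<bullet> x = 1 \<and> (\<forall>k\<in>I - {i}. g k \<bullet> x < 1)"
    and u: "u \<in> S" "\<And>i. i \<in> U \<Longrightarrow> g i \<bullet> u = 1" "\<And>i. i \<in> V \<Longrightarrow> g i \<bullet> u < 1"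
    and v: "v \<in> S" "\<And>i. i \<in> V \<Longrightarrow> g i \<bullet> v = 1" "\<And>i. i \<in> U \<Longrightarrow> g i \<bullet> v < 1"
    and kU: "dim (ker S g U) = 0" and kV: "dim (ker S g V) = 0"
    unfolding pre_spindle_def I_def P_def by blast+
  have finI: "finite I" using fin by (simp add: I_def)
  have SU: "S = UNIV" using d S by (metis dim_eq_full span_eq_iff)
  define H where "H i = {x. g i \<bullet> x \<le> 1}" for i
  have P: "P = \<Inter>(H ` I)" by (auto simp: P_def pol_def SU H_def I_def)
  show pP: "polytope P"
    unfolding polytope_eq_bounded_polyhedron
    using bdd unfolding P by (auto intro!: polyhedron_Inter simp: H_def polyhedron_halfspace_le finI)
  have int: "{x. \<forall>i\<in>I. g i \<bullet> x < 1} \<subseteq> interior P"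
  proof (rule interior_maximal)
    show "{x. \<forall>i\<in>I. g i \<bullet> x < 1} \<subseteq> P" by (auto simp: P H_def less_imp_le)
    have "{x. \<forall>i\<in>I. g i \<bullet> x < 1} = (\<Inter>i\<in>I. {x. g i \<bullet> x < 1})" by auto
    then show "open {x. \<forall>i\<in>I. g i \<bullet> x < 1}" using finI by (simp add: open_INT open_halfspace_lt)
  qed
  then have "0 \<in> interior P" by auto
  then show ad: "aff_dim P = DIM('a)" using aff_dim_nonempty_interior by blast
  have aff: "affine hull P = UNIV" using ad aff_dim_eq_full by blast
  \<comment> \<open>\<open>x\<close> lies on row \<open>i\<close> and strictly inside row
    \<open>j\<close>, so it can be scaled outwards within \<open>H j\<close> but not within
    \<open>H i\<close>.\<close>
  have injH: "inj_on H I"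
  proof (rule inj_onI, rule ccontr)
    fix i j assume ij: "i \<in> I" "j \<in> I" "H i = H j" "i \<noteq> j"
    obtain x where x: "g i \<bullet> x = 1" "\<forall>k\<in>I - {i}. g k \<bullet> x < 1" using irr ij by blast
    have "g j \<bullet> x < 1" using x ij by blast
    define c where "c = (if g j \<bullet> x > 0 then 1 / (g j \<bullet> x) else 2)"
    have "c > 1" using \<open>g j \<bullet> x < 1\<close> by (simp add: c_def)
    have "c *\<^sub>R x \<in> H j"
      by (auto simp: H_def c_def mult_nonneg_nonpos)
    then have "c *\<^sub>R x \<in> H i" using ij(3) by simp
    then have "c \<le> 1" using x(1) by (simp add: H_def)
    with \<open>c > 1\<close> show False by simp
  qed
  have g0: "g i \<noteq> 0" if "i \<in> I" for i using irr[OF that] by auto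
  \<comment> \<open>The description of facets used below indexes normals by halfspaces, so the row
    is recovered from its halfspace by injectivity.\<close>
  define a where "a h = g (inv_into I H h)" for h
  have aH: "a (H i) = g i" if "i \<in> I" for i using injH that by (simp add: a_def)
  have facets: "c facet_of P \<longleftrightarrow> (\<exists>h. h \<in> H ` I \<and> c = P \<inter> {x. a h \<bullet> x = 1})" for c
  proof (rule facet_of_polyhedron_explicit[of "H ` I" P a "\<lambda>_. 1"])
    show "finite (H ` I)" using finI by simp
    show "P = affine hull P \<inter> \<Inter> (H ` I)" using aff P by simp
    show "\<And>h. h \<in> H ` I \<Longrightarrow> a h \<noteq> 0 \<and> h = {x. a h \<bullet> x \<le> 1}" using aH g0 by (auto simp: H_def)
    show "P \<subset> affine hull P \<inter> \<Inter> F'" if F': "F' \<subset> H ` I" for F'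
    proof -
      obtain i where i: "i \<in> I" "H i \<notin> F'" using F' by blast
      obtain x where x: "g i \<bullet> x = 1" "\<forall>k\<in>I - {i}. g k \<bullet> x < 1" using irr i by blast
      \<comment> \<open>The factor at which the ray through \<open>x\<close> meets row
        \<open>k\<close>. The value 2 is a default for rows that the ray never meets; any number
        above 1 would do.\<close>
      define c where "c k = (if g k \<bullet> x > 0 then 1 / (g k \<bullet> x) else 2)" for k
      define m where "m = Min (insert 2 (c ` (I - {i})))"
      have "\<forall>k\<in>I - {i}. c k > 1" using x(2) by (simp add: c_def)
      then have m1: "m > 1" unfolding m_def using finI by (subst Min_gr_iff) auto
      have "g k \<bullet> (m *\<^sub>R x) \<le> 1" if k: "k \<in> I - {i}" for k
      proof (cases "g k \<bullet> x > 0")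
        case True
        have "m \<le> c k" unfolding m_def using k finI by (intro Min_le) auto
        then show ?thesis using True by (simp add: c_def field_simps)
      next
        case False
        then have "m * (g k \<bullet> x) \<le> 0" using m1 by (intro mult_nonneg_nonpos) auto
        then show ?thesis by simp
      qed
      then have "m *\<^sub>R x \<in> \<Inter> F'" using F' i(2) by (fastforce simp: H_def)
      moreover have "m *\<^sub>R x \<notin> P" using x(1) m1 i(1) by (auto simp: P H_def intro!: bexI[of _ i])
      moreover have "P \<subseteq> \<Inter> F'" using F' by (auto simp: P)
      ultimately show ?thesis using aff by auto
    qed
  qed
  have "{F. F facet_of P} = (\<lambda>i. P \<inter> {x. g i \<bullet> x = 1}) ` I"
    using facets aH by auto
  moreover have "inj_on (\<lambda>i. P \<inter> {x. g i \<bullet> x = 1}) I"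
  proof (rule inj_onI, rule ccontr)
    fix i j assume ij: "i \<in> I" "j \<in> I" "P \<inter> {x. g i \<bullet> x = 1} = P \<inter> {x. g j \<bullet> x = 1}" "i \<noteq> j"
    obtain x where x: "g i \<bullet> x = 1" "\<forall>k\<in>I - {i}. g k \<bullet> x < 1" using irr ij by blast
    have "x \<in> P" using x by (force simp: P H_def less_imp_le)
    moreover have "g j \<bullet> x < 1" using x ij by blast
    ultimately show False using x(1) ij(3) by (metis (mono_tags, lifting) Int_iff less_irrefl mem_Collect_eq)
  qed
  ultimately show "num_facets P = card U + card V"
    unfolding num_facets_def using fin UV by (simp add: card_image card_Un_disjoint I_def)
  have "tight g I u = U" "tight g I v = V"
    using u v by (force simp: tight_def I_def)+
  moreover have "u \<in> pol S g I" "v \<in> pol S g I"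
    using u v by (auto simp: I_def pol_def less_imp_le)
  ultimately have ext: "u extreme_point_of P" "v extreme_point_of P"
    using vert_imp_extreme_point[OF S, of g I] kU kV unfolding vert_def P_def I_def by auto
  have "enat l \<le> graph_dist P u v"
    unfolding graph_dist_def
  proof (rule INF_greatest)
    fix k assume "k \<in> {k. (u, v) \<in> edge_rel P ^^ k}"
    moreover have "edge_rel P ^^ k \<subseteq> adj S g I ^^ k"
      using relpow_subset[OF edge_rel_subset_adj[OF S finI, of g]] by (simp add: P_def I_def)
    ultimately have "(u, v) \<in> adj S g I ^^ k" by blast
    then have "\<not> k < l" using len by blast
    then show "enat l \<le> enat k" by simp
  qed
  also have "\<dots> \<le> combinatorial_diameter P"
    unfolding combinatorial_diameter_def using ext
    by (intro SUP_upper2[of u] SUP_upper2[of v]) auto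
  finally show "combinatorial_diameter P \<ge> enat l" .
qed

section \<open>A 5-dimensional spindle of length 6\<close>

type_synonym real5 = "real \<times> real \<times> real \<times> real \<times> real"

fun flip1 :: "real5 \<Rightarrow> real5" where "flip1 (a, b, c, d, s) = (- a, b, c, d, s)"
fun flip2 :: "real5 \<Rightarrow> real5" where "flip2 (a, b, c, d, s) = (a, - b, c, d, s)"
fun flip3 :: "real5 \<Rightarrow> real5" where "flip3 (a, b, c, d, s) = (a, b, - c, d, s)"
fun flip4 :: "real5 \<Rightarrow> real5" where "flip4 (a, b, c, d, s) = (a, b, c, - d, s)"
text \<open>Of order four: it exchanges the two sides, and its square swaps the coordinates within
  each of the two pairs.\<close>

fun turn :: "real5 \<Rightarrow> real5" where "turn (a, b, c, d, s) = (c, d, b, a, - s)"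
fun absv :: "real5 \<Rightarrow> real5" where "absv (a, b, c, d, s) = (\<bar>a\<bar>, \<bar>b\<bar>, \<bar>c\<bar>, \<bar>d\<bar>, s)"

text \<open>Up to signs, the vertices of a perturbation of Santos' 48-vertex prismatoid. The numbers are chosen
  so that the polar spindle is simple except at its apices.\<close>
definition absU :: "real5 set" where
  "absU = {(6, 0, 0, 0, 1), (0, 6, 0, 0, 1), (0, 0, 15, 0, 1), (0, 0, 0, 15, 1), (4, 4, 0, 0, 1),
    (0, 0, 9, 9, 1), (0, 3, 12, 0, 1), (3, 0, 0, 12, 1)}"
definition absV :: "real5 set" where
  "absV = {(0, 0, 0, 6, -1), (0, 0, 6, 0, -1), (15, 0, 0, 0, -1), (0, 15, 0, 0, -1), (0, 0, 4, 4, -1),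
    (9, 9, 0, 0, -1), (12, 0, 3, 0, -1), (0, 12, 0, 3, -1)}"

definition rowsU :: "real5 set" where "rowsU = {r. absv r \<in> absU}"
definition rowsV :: "real5 set" where "rowsV = {r. absv r \<in> absV}"

abbreviation "rows5 \<equiv> rowsU \<union> rowsV"
abbreviation "P5 \<equiv> pol UNIV (\<lambda>r. r) rows5"
abbreviation "tight5 \<equiv> tight (\<lambda>r. r) rows5"
abbreviation "ker5 \<equiv> ker UNIV (\<lambda>r::real5. r)"
abbreviation "vert5 \<equiv> vert UNIV (\<lambda>r. r) rows5"
abbreviation "adj5 \<equiv> adj UNIV (\<lambda>r. r) rows5"
abbreviation apexU :: real5 where "apexU \<equiv> (0, 0, 0, 0, 1)"
abbreviation apexV :: real5 where "apexV \<equiv> (0, 0, 0, 0, -1)"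

text \<open>Representatives of the 448 vertices other than the apices under the group of order 64 that is
  generated by the sign changes and \<open>turn\<close>.\<close>
definition point1 :: real5 where "point1 = (1 / 84) *\<^sub>R (2, 3, 8, 4, -36)"
definition point2 :: real5 where "point2 = (1 / 210) *\<^sub>R (5, 8, 20, 8, -90)"
definition point3 :: real5 where "point3 = (1 / 75) *\<^sub>R (2, 3, 7, 3, -30)"
definition point4 :: real5 where "point4 = (1 / 390) *\<^sub>R (11, 14, 36, 24, -150)"
definition point5 :: real5 where "point5 = (1 / 270) *\<^sub>R (9, 11, 24, 16, -90)"
definition point6 :: real5 where "point6 = (1 / 225) *\<^sub>R (8, 12, 18, 12, -45)"
definition point7 :: real5 where "point7 = (1 / 45) *\<^sub>R (2, 3, 2, 3, 0)"

lemmas point_defs = point1_def point2_def point3_def point4_def point5_def point6_def point7_def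

definition moves :: "(real5 \<Rightarrow> real5) set" where "moves = {flip1, flip2, flip3, flip4, turn}"

text \<open>All moves have finite order, so closing under them alone gives full group
  orbits.\<close>

inductive_set orbit :: "real5 set" where
  rep: "x \<in> {point1, point2, point3, point4, point5, point6, point7} \<Longrightarrow> x \<in> orbit"
| move: "F \<in> moves \<Longrightarrow> x \<in> orbit \<Longrightarrow> F x \<in> orbit"

definition has_neighbours :: "real5 \<Rightarrow> bool" where
  "has_neighbours x \<longleftrightarrow> (\<forall>i\<in>tight5 x. \<exists>z\<in>orbit \<union> {apexU, apexV}.
     (\<forall>r\<in>tight5 x. r \<noteq> i \<longrightarrow> r \<bullet> z = 1) \<and> i \<bullet> z \<noteq> 1)"

lemma orbit_moves:
  "x \<in> orbit \<Longrightarrow> flip1 x \<in> orbit" "x \<in> orbit \<Longrightarrow> flip2 x \<in> orbit"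
  "x \<in> orbit \<Longrightarrow> flip3 x \<in> orbit" "x \<in> orbit \<Longrightarrow> flip4 x \<in> orbit" "x \<in> orbit \<Longrightarrow> turn x \<in> orbit"
  using orbit.move[of flip1 x] orbit.move[of flip2 x] orbit.move[of flip3 x] orbit.move[of flip4 x]
    orbit.move[of turn x] by (simp_all add: moves_def)

lemma orbit_points:
  "point1 \<in> orbit" "point2 \<in> orbit" "point3 \<in> orbit" "point4 \<in> orbit" "point5 \<in> orbit"
  "point6 \<in> orbit" "point7 \<in> orbit"
  by (simp_all add: orbit.rep)

text \<open>At a point with positive first four coordinates a row never exceeds its version with
  absolute values, with equality only if the two agree. This reduces 48 rows to 16; the common
  denominator \<open>D\<close> keeps the arithmetic integral.\<close>

lemma nonneg_point:
  fixes a b c d s D :: real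
  assumes pos: "a > 0" "b > 0" "c > 0" "d > 0" "D > 0"
    and le: "\<forall>r\<in>absU \<union> absV. r \<bullet> (a, b, c, d, s) \<le> D \<and> (r \<bullet> (a, b, c, d, s) = D \<longrightarrow> r \<in> T)"
    and T: "\<forall>r\<in>T. r \<in> absU \<union> absV \<and> r \<bullet> (a, b, c, d, s) = D"
  shows "(1 / D) *\<^sub>R (a, b, c, d, s) \<in> P5 \<and> tight5 ((1 / D) *\<^sub>R (a, b, c, d, s)) = T"
proof
  let ?x = "(a, b, c, d, s)"
  have key: "r \<bullet> ?x \<le> absv r \<bullet> ?x \<and> (r \<bullet> ?x = absv r \<bullet> ?x \<longrightarrow> absv r = r)" for r :: real5
  proof (cases r)
    case (fields p q t w z)
    have le: "p * a \<le> \<bar>p\<bar> * a" "q * b \<le> \<bar>q\<bar> * b" "t * c \<le> \<bar>t\<bar> * c" "w * d \<le> \<bar>w\<bar> * d"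
      using pos by (auto intro!: mult_right_mono)
    moreover have "\<bar>p\<bar> = p \<and> \<bar>q\<bar> = q \<and> \<bar>t\<bar> = t \<and> \<bar>w\<bar> = w"
      if "p * a + q * b + t * c + w * d = \<bar>p\<bar> * a + \<bar>q\<bar> * b + \<bar>t\<bar> * c + \<bar>w\<bar> * d"
    proof -
      have "p * a = \<bar>p\<bar> * a" "q * b = \<bar>q\<bar> * b" "t * c = \<bar>t\<bar> * c" "w * d = \<bar>w\<bar> * d"
        using le that by linarith+
      then show ?thesis using pos by auto
    qed
    ultimately show ?thesis by (simp add: fields)
  qed
  have absv_id: "absv r = r" if "r \<in> absU \<union> absV" for r
    using that by (auto simp: absU_def absV_def)
  have mem: "r \<in> rows5 \<longleftrightarrow> absv r \<in> absU \<union> absV" for r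
    by (simp add: rowsU_def rowsV_def)
  have scale: "r \<bullet> ((1 / D) *\<^sub>R ?x) = (r \<bullet> ?x) / D" for r :: real5
    by (simp only: inner_scaleR_right) simp
  have "r \<bullet> ?x \<le> D" if "r \<in> rows5" for r
  proof -
    have "r \<bullet> ?x \<le> absv r \<bullet> ?x" using key by blast
    also have "\<dots> \<le> D" using le that unfolding mem by blast
    finally show ?thesis .
  qed
  then have "r \<bullet> ((1 / D) *\<^sub>R ?x) \<le> 1" if "r \<in> rows5" for r
    unfolding scale using that pos(5) by simp
  then show "(1 / D) *\<^sub>R ?x \<in> P5" unfolding pol_def by blast
  have "r \<bullet> ((1 / D) *\<^sub>R ?x) = 1 \<longleftrightarrow> r \<bullet> ?x = D" for r :: real5
    unfolding scale using pos(5) by auto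
  then have tight: "r \<in> tight5 ((1 / D) *\<^sub>R ?x) \<longleftrightarrow> r \<in> rows5 \<and> r \<bullet> ?x = D" for r
    unfolding tight_def by blast
  show "tight5 ((1 / D) *\<^sub>R ?x) = T"
  proof (intro set_eqI iffI)
    fix r assume "r \<in> tight5 ((1 / D) *\<^sub>R ?x)"
    then have r: "absv r \<in> absU \<union> absV" "r \<bullet> ?x = D" using mem tight by blast+
    have "absv r \<bullet> ?x \<le> D" using le r(1) by blast
    then have "r \<bullet> ?x = absv r \<bullet> ?x" using key[of r] r(2) by linarith
    then have "absv r = r" using key[of r] by blast
    then show "r \<in> T" using le r by metis
  next
    fix r assume "r \<in> T"
    then have r: "r \<in> absU \<union> absV" "r \<bullet> ?x = D" using T by blast+
    then show "r \<in> tight5 ((1 / D) *\<^sub>R ?x)" unfolding tight mem using absv_id[OF r(1)] by simp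
  qed
qed

text \<open>\<open>N\<close> pairs each tight row with the vertex reached by releasing that
  row.\<close>

lemma neighboursI:
  assumes T: "tight5 x = fst ` N" and Z: "snd ` N \<subseteq> orbit \<union> {apexU, apexV}"
    and N: "\<forall>(i, z)\<in>N. (\<forall>(r, y)\<in>N. r \<noteq> i \<longrightarrow> r \<bullet> z = 1) \<and> i \<bullet> z \<noteq> 1"
  shows "has_neighbours x"
  unfolding has_neighbours_def
proof
  fix i assume "i \<in> tight5 x"
  then have "i \<in> fst ` N" unfolding T .
  then obtain z where z: "(i, z) \<in> N" unfolding image_iff by (metis prod.collapse)
  then have "z \<in> snd ` N" by (rule image_eqI[rotated]) simp
  then have *: "z \<in> orbit \<union> {apexU, apexV}" using Z by blast
  have Nz: "(\<forall>(r, y)\<in>N. r \<noteq> i \<longrightarrow> r \<bullet> z = 1) \<and> i \<bullet> z \<noteq> 1" using N z by blast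
  have "r \<bullet> z = 1" if "r \<in> tight5 x" "r \<noteq> i" for r
  proof -
    from that(1) have "r \<in> fst ` N" unfolding T .
    then obtain y where "(r, y) \<in> N" unfolding image_iff by (metis prod.collapse)
    then show ?thesis using Nz that(2) by blast
  qed
  with * Nz show "\<exists>z\<in>orbit \<union> {apexU, apexV}. (\<forall>r\<in>tight5 x. r \<noteq> i \<longrightarrow> r \<bullet> z = 1) \<and> i \<bullet> z \<noteq> 1"
    by blast
qed

lemma moves_scaleR:
  "flip1 (c *\<^sub>R x) = c *\<^sub>R flip1 x" "flip2 (c *\<^sub>R x) = c *\<^sub>R flip2 x"
  "flip3 (c *\<^sub>R x) = c *\<^sub>R flip3 x" "flip4 (c *\<^sub>R x) = c *\<^sub>R flip4 x"
  "turn (c *\<^sub>R x) = c *\<^sub>R turn x"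
  by (cases x; simp)+

section \<open>The seven representatives: tight rows and neighbours\<close>

lemma tight_point1: "point1 \<in> P5 \<and> tight5 point1 = {(0, 0, 15, 0, 1), (0, 0, 6, 0, -1), (0, 0, 4, 4, -1), (12, 0, 3, 0, -1), (0, 12, 0, 3, -1)}"
  unfolding point1_def by (rule nonneg_point) (simp_all add: absU_def absV_def)

lemma neighbours_point1: "has_neighbours point1"
  by (rule neighboursI[of _ "{((0, 0, 15, 0, 1), apexV), ((0, 0, 6, 0, -1), point4), ((0, 0, 4, 4, -1), point2), ((12, 0, 3, 0, -1), flip1 point1), ((0, 12, 0, 3, -1), flip2 point1)}"])
    (simp add: tight_point1, simp add: orbit_points orbit_moves, simp add: point_defs moves_scaleR inner_scaleR_right del: scaleR_Pair)

lemma tight_point2: "point2 \<in> P5 \<and> tight5 point2 = {(0, 0, 15, 0, 1), (0, 0, 6, 0, -1), (0, 15, 0, 0, -1), (12, 0, 3, 0, -1), (0, 12, 0, 3, -1)}"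
  unfolding point2_def by (rule nonneg_point) (simp_all add: absU_def absV_def)

lemma neighbours_point2: "has_neighbours point2"
  by (rule neighboursI[of _ "{((0, 0, 15, 0, 1), apexV), ((0, 0, 6, 0, -1), point3), ((0, 15, 0, 0, -1), point1), ((12, 0, 3, 0, -1), flip1 point2), ((0, 12, 0, 3, -1), flip4 point2)}"])
    (simp add: tight_point2, simp add: orbit_points orbit_moves, simp add: point_defs moves_scaleR inner_scaleR_right del: scaleR_Pair)

lemma tight_point3: "point3 \<in> P5 \<and> tight5 point3 = {(0, 0, 15, 0, 1), (0, 15, 0, 0, -1), (9, 9, 0, 0, -1), (12, 0, 3, 0, -1), (0, 12, 0, 3, -1)}"
  unfolding point3_def by (rule nonneg_point) (simp_all add: absU_def absV_def)

lemma neighbours_point3: "has_neighbours point3"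
  by (rule neighboursI[of _ "{((0, 0, 15, 0, 1), apexV), ((0, 15, 0, 0, -1), point5), ((9, 9, 0, 0, -1), point2), ((12, 0, 3, 0, -1), point6), ((0, 12, 0, 3, -1), flip4 point3)}"])
    (simp add: tight_point3, simp add: orbit_points orbit_moves, simp add: point_defs moves_scaleR inner_scaleR_right del: scaleR_Pair)

lemma tight_point4: "point4 \<in> P5 \<and> tight5 point4 = {(0, 0, 15, 0, 1), (0, 0, 9, 9, 1), (0, 0, 4, 4, -1), (12, 0, 3, 0, -1), (0, 12, 0, 3, -1)}"
  unfolding point4_def by (rule nonneg_point) (simp_all add: absU_def absV_def)

lemma neighbours_point4: "has_neighbours point4"
  by (rule neighboursI[of _ "{((0, 0, 15, 0, 1), turn (turn point4)), ((0, 0, 9, 9, 1), point1), ((0, 0, 4, 4, -1), point5), ((12, 0, 3, 0, -1), flip1 point4), ((0, 12, 0, 3, -1), flip2 point4)}"])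
    (simp add: tight_point4, simp add: orbit_points orbit_moves, simp add: point_defs moves_scaleR inner_scaleR_right del: scaleR_Pair)

lemma tight_point5: "point5 \<in> P5 \<and> tight5 point5 = {(0, 0, 15, 0, 1), (0, 0, 9, 9, 1), (9, 9, 0, 0, -1), (12, 0, 3, 0, -1), (0, 12, 0, 3, -1)}"
  unfolding point5_def by (rule nonneg_point) (simp_all add: absU_def absV_def)

lemma neighbours_point5: "has_neighbours point5"
  by (rule neighboursI[of _ "{((0, 0, 15, 0, 1), turn (turn point5)), ((0, 0, 9, 9, 1), point3), ((9, 9, 0, 0, -1), point4), ((12, 0, 3, 0, -1), point6), ((0, 12, 0, 3, -1), turn (turn point7))}"])
    (simp add: tight_point5, simp add: orbit_points orbit_moves, simp add: point_defs moves_scaleR inner_scaleR_right del: scaleR_Pair)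

lemma tight_point6: "point6 \<in> P5 \<and> tight5 point6 = {(0, 0, 15, 0, 1), (0, 0, 9, 9, 1), (0, 15, 0, 0, -1), (9, 9, 0, 0, -1), (0, 12, 0, 3, -1)}"
  unfolding point6_def by (rule nonneg_point) (simp_all add: absU_def absV_def)

lemma neighbours_point6: "has_neighbours point6"
  by (rule neighboursI[of _ "{((0, 0, 15, 0, 1), point7), ((0, 0, 9, 9, 1), point3), ((0, 15, 0, 0, -1), point5), ((9, 9, 0, 0, -1), flip1 point6), ((0, 12, 0, 3, -1), turn point7)}"])
    (simp add: tight_point6, simp add: orbit_points orbit_moves, simp add: point_defs moves_scaleR inner_scaleR_right del: scaleR_Pair)

lemma tight_point7: "point7 \<in> P5 \<and> tight5 point7 = {(0, 0, 0, 15, 1), (0, 0, 9, 9, 1), (0, 15, 0, 0, -1), (9, 9, 0, 0, -1), (0, 12, 0, 3, -1)}"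
  unfolding point7_def by (rule nonneg_point) (simp_all add: absU_def absV_def)

lemma neighbours_point7: "has_neighbours point7"
  by (rule neighboursI[of _ "{((0, 0, 0, 15, 1), point6), ((0, 0, 9, 9, 1), flip3 point7), ((0, 15, 0, 0, -1), turn (turn point5)), ((9, 9, 0, 0, -1), flip1 point7), ((0, 12, 0, 3, -1), turn (turn (turn point6)))}"])
    (simp add: tight_point7, simp add: orbit_points orbit_moves, simp add: point_defs moves_scaleR inner_scaleR_right del: scaleR_Pair)

section \<open>Symmetries of the base spindle\<close>

lemma absv_flip:
  "absv (flip1 r) = absv r" "absv (flip2 r) = absv r" "absv (flip3 r) = absv r" "absv (flip4 r) = absv r"
  "absv (turn r) = turn (absv r)"
  by (cases r; simp)+

lemma turn_abs: "x \<in> absU \<Longrightarrow> turn x \<in> absV" "x \<in> absV \<Longrightarrow> turn x \<in> absU"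
  by (auto simp: absU_def absV_def)

lemma turn4: "turn (turn (turn (turn x))) = x"
  by (cases x) simp

lemma involution_image:
  assumes "\<And>r. f (f r) = r" "\<And>r. r \<in> A \<Longrightarrow> f r \<in> A" shows "f ` A = A"
  using assms by (metis image_subsetI subsetI subset_antisym image_eqI)

lemma flips_rows:
  assumes "F \<in> {flip1, flip2, flip3, flip4}"
  shows "F ` rowsU = rowsU" "F ` rowsV = rowsV"
proof -
  have inv: "F (F r) = r" and abs: "absv (F r) = absv r" for r
    using assms by (cases r; auto simp: absv_flip)+
  show "F ` rowsU = rowsU" "F ` rowsV = rowsV"
    by (rule involution_image[OF inv]; simp add: rowsU_def rowsV_def abs)+
qed

lemma turn_rows: "turn ` rowsU = rowsV" "turn ` rowsV = rowsU"
proof -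
  have 1: "turn r \<in> rowsV" if "r \<in> rowsU" for r
    using that turn_abs(1) by (simp add: rowsU_def rowsV_def absv_flip)
  have 2: "turn r \<in> rowsU" if "r \<in> rowsV" for r
    using that turn_abs(2) by (simp add: rowsU_def rowsV_def absv_flip)
  show "turn ` rowsU = rowsV"
  proof (intro equalityI subsetI)
    fix r assume "r \<in> rowsV"
    then have "turn (turn (turn r)) \<in> rowsU" using 1 2 by blast
    then show "r \<in> turn ` rowsU" using turn4[of r] by (metis image_eqI)
  qed (use 1 in blast)
  show "turn ` rowsV = rowsU"
  proof (intro equalityI subsetI)
    fix r assume "r \<in> rowsU"
    then have "turn (turn (turn r)) \<in> rowsV" using 1 2 by blast
    then show "r \<in> turn ` rowsV" using turn4[of r] by (metis image_eqI)
  qed (use 2 in blast)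
qed

lemma move_rows: "F \<in> moves \<Longrightarrow> F ` rows5 = rows5"
  unfolding image_Un using flips_rows[of F] turn_rows
  by (cases "F = turn") (simp_all only: moves_def insert_iff empty_iff Un_commute simp_thms)

lemma move_inner:
  assumes "F \<in> moves" shows "F x \<bullet> F y = x \<bullet> y"
  using assms by (cases x; cases y) (auto simp: moves_def algebra_simps)

lemma tight_isometry:
  fixes f :: "'a::euclidean_space \<Rightarrow> 'a"
  assumes I: "f ` I = I" and f: "\<And>x y. f x \<bullet> f y = x \<bullet> y"
  shows "tight (\<lambda>r. r) I (f x) = f ` tight (\<lambda>r. r) I x"
proof (intro equalityI subsetI)
  fix r assume r: "r \<in> tight (\<lambda>r. r) I (f x)"
  then have "r \<in> f ` I" using I by (simp add: tight_def)
  then obtain q where "q \<in> I" "r = f q" by blast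
  then show "r \<in> f ` tight (\<lambda>r. r) I x" using r f by (simp add: tight_def)
next
  fix r assume "r \<in> f ` tight (\<lambda>r. r) I x"
  then obtain q where "q \<in> I" "q \<bullet> x = 1" "r = f q" by (auto simp: tight_def)
  then show "r \<in> tight (\<lambda>r. r) I (f x)" using f I by (auto simp: tight_def)
qed

lemma pol_isometry:
  fixes f :: "'a::euclidean_space \<Rightarrow> 'a"
  assumes I: "f ` I = I" and f: "\<And>x y. f x \<bullet> f y = x \<bullet> y" and x: "x \<in> pol UNIV (\<lambda>r. r) I"
  shows "f x \<in> pol UNIV (\<lambda>r. r) I"
proof -
  have "r \<bullet> f x \<le> 1" if r: "r \<in> I" for r
  proof -
    obtain q where "q \<in> I" "r = f q" using r I by blast
    then show ?thesis using f x by (simp add: pol_def)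
  qed
  then show ?thesis by (simp add: pol_def)
qed

lemma tight_move: "F \<in> moves \<Longrightarrow> tight5 (F x) = F ` tight5 x"
  by (rule tight_isometry[OF move_rows move_inner])

lemma pol_move: "F \<in> moves \<Longrightarrow> x \<in> P5 \<Longrightarrow> F x \<in> P5"
  by (rule pol_isometry[OF move_rows move_inner])

lemma move_inj: "F \<in> moves \<Longrightarrow> inj F"
proof (rule injI)
  fix x y assume "F \<in> moves" "F x = F y"
  then show "x = y" by (cases x; cases y) (auto simp: moves_def)
qed

lemma move_apex: "F \<in> moves \<Longrightarrow> x \<in> {apexU, apexV} \<Longrightarrow> F x \<in> {apexU, apexV}"
  by (auto simp: moves_def)

lemma has_neighbours_move:
  assumes F: "F \<in> moves" and x: "has_neighbours x" shows "has_neighbours (F x)"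
  unfolding has_neighbours_def
proof
  fix i assume "i \<in> tight5 (F x)"
  then obtain j where j: "j \<in> tight5 x" "i = F j" using tight_move[OF F] by blast
  then obtain z where z: "z \<in> orbit \<union> {apexU, apexV}"
    "\<forall>r\<in>tight5 x. r \<noteq> j \<longrightarrow> r \<bullet> z = 1" "j \<bullet> z \<noteq> 1"
    using x unfolding has_neighbours_def by blast
  have "F z \<in> orbit \<union> {apexU, apexV}" using z(1) move_apex[OF F] orbit.move[OF F] by blast
  moreover have "\<forall>r\<in>tight5 (F x). r \<noteq> i \<longrightarrow> r \<bullet> F z = 1"
  proof (intro ballI impI)
    fix r assume r: "r \<in> tight5 (F x)" "r \<noteq> i"
    then obtain q where "q \<in> tight5 x" "r = F q" using tight_move[OF F] by blast
    then show "r \<bullet> F z = 1" using z(2) r(2) j(2) move_inner[OF F] by metis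
  qed
  ultimately show "\<exists>z\<in>orbit \<union> {apexU, apexV}. (\<forall>r\<in>tight5 (F x). r \<noteq> i \<longrightarrow> r \<bullet> z = 1) \<and> i \<bullet> z \<noteq> 1"
    using z(3) j(2) move_inner[OF F] by metis
qed

section \<open>Sides, types and simplicity of the vertices\<close>

lemma rowsU_V_disjoint: "rowsU \<inter> rowsV = {}"
  by (auto simp: rowsU_def rowsV_def absU_def absV_def)

lemma apex_rows:
  "r \<in> rowsU \<Longrightarrow> r \<bullet> apexU = 1" "r \<in> rowsV \<Longrightarrow> r \<bullet> apexU = -1"
  "r \<in> rowsU \<Longrightarrow> r \<bullet> apexV = -1" "r \<in> rowsV \<Longrightarrow> r \<bullet> apexV = 1"
  by (cases r; auto simp: rowsU_def rowsV_def absU_def absV_def)+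

text \<open>The first and the last vertex of a walk of length 5 between the apices, the apices excluded, would
  have to share a row of either side; the types of these vertices rule this out.\<close>
definition typeV :: "real5 \<Rightarrow> bool" where
  "typeV x \<longleftrightarrow>
     absv ` (tight5 x \<inter> rowsU) \<subseteq> {(0, 0, 15, 0, 1)} \<and> (15, 0, 0, 0, -1) \<notin> absv ` tight5 x \<or>
     absv ` (tight5 x \<inter> rowsU) \<subseteq> {(0, 0, 0, 15, 1)} \<and> (0, 15, 0, 0, -1) \<notin> absv ` tight5 x"

definition typeU :: "real5 \<Rightarrow> bool" where
  "typeU x \<longleftrightarrow>
     absv ` (tight5 x \<inter> rowsV) \<subseteq> {(15, 0, 0, 0, -1)} \<and> (0, 0, 0, 15, 1) \<notin> absv ` tight5 x \<or>
     absv ` (tight5 x \<inter> rowsV) \<subseteq> {(0, 15, 0, 0, -1)} \<and> (0, 0, 15, 0, 1) \<notin> absv ` tight5 x"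

definition simple_vertex :: "real5 \<Rightarrow> bool" where
  "simple_vertex x \<longleftrightarrow> x \<in> P5 \<and> card (tight5 x) = 5 \<and>
     tight5 x \<inter> rowsU \<noteq> {} \<and> tight5 x \<inter> rowsV \<noteq> {} \<and>
     (card (tight5 x \<inter> rowsU) = 1 \<longrightarrow> typeV x) \<and> (card (tight5 x \<inter> rowsV) = 1 \<longrightarrow> typeU x)"

lemma inj_image_subset_singleton: "inj f \<Longrightarrow> f ` B \<subseteq> {f z} \<longleftrightarrow> B \<subseteq> {z}"
  by (auto dest: injD)

lemma simple_vertex_move:
  assumes F: "F \<in> moves" and x: "simple_vertex x" shows "simple_vertex (F x)"
proof -
  note inj = move_inj[OF F]
  have T: "tight5 (F x) = F ` tight5 x" by (rule tight_move[OF F])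
  have c: "card (F ` A) = card A" for A using inj by (intro card_image inj_on_subset[OF inj]) auto
  have I: "F ` A \<inter> F ` B = F ` (A \<inter> B)" for A B using inj by (rule image_Int[symmetric])
  show ?thesis
  proof (cases "F = turn")
    case False
    then have F': "F \<in> {flip1, flip2, flip3, flip4}" using F by (simp add: moves_def)
    have U: "tight5 (F x) \<inter> rowsU = F ` (tight5 x \<inter> rowsU)"
      unfolding T I[symmetric] flips_rows(1)[OF F'] ..
    have V: "tight5 (F x) \<inter> rowsV = F ` (tight5 x \<inter> rowsV)"
      unfolding T I[symmetric] flips_rows(2)[OF F'] ..
    have a: "absv ` F ` A = absv ` A" for A
      using F' unfolding insert_iff empty_iff by (elim disjE) (simp_all only: image_image absv_flip simp_thms)
    have "typeV (F x) = typeV x" "typeU (F x) = typeU x"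
      unfolding typeV_def typeU_def U V unfolding T a by simp_all
    then show ?thesis using x pol_move[OF F]
      unfolding simple_vertex_def U V unfolding T c by simp
  next
    case True
    have U: "tight5 (turn x) \<inter> rowsU = turn ` (tight5 x \<inter> rowsV)"
      using T I[of "tight5 x" rowsV] turn_rows(2) True by simp
    have V: "tight5 (turn x) \<inter> rowsV = turn ` (tight5 x \<inter> rowsU)"
      using T I[of "tight5 x" rowsU] turn_rows(1) True by simp
    have a: "absv ` turn ` A = turn ` absv ` A" for A
      by (simp only: image_image absv_flip)
    have t: "turn ` B \<subseteq> {turn z} \<longleftrightarrow> B \<subseteq> {z}" "turn z \<in> turn ` B \<longleftrightarrow> z \<in> B" for B z
      using inj True by (simp_all only: inj_image_subset_singleton inj_image_mem_iff)
    \<comment> \<open>\<open>turn\<close> permutes the four alternatives of the two types in one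
      cycle. In this direction the two alternatives arrive in reverse order, hence
      \<open>disj_commute\<close>; in the other direction they keep it.\<close>
    have "typeV (turn x) \<longleftrightarrow> typeU x"
      using t(1)[of _ "(15, 0, 0, 0, -1)"] t(1)[of _ "(0, 15, 0, 0, -1)"]
        t(2)[of "(0, 0, 0, 15, 1)"] t(2)[of "(0, 0, 15, 0, 1)"] T True
      unfolding typeV_def typeU_def U a by (simp add: a disj_commute)
    moreover have "typeU (turn x) \<longleftrightarrow> typeV x"
      using t(1)[of _ "(0, 0, 15, 0, 1)"] t(1)[of _ "(0, 0, 0, 15, 1)"]
        t(2)[of "(15, 0, 0, 0, -1)"] t(2)[of "(0, 15, 0, 0, -1)"] T True
      unfolding typeV_def typeU_def V a by (simp add: a)
    moreover have "card (tight5 (turn x)) = card (tight5 x)" using T c True by metis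
    moreover have "tight5 (turn x) \<inter> rowsU \<noteq> {} \<longleftrightarrow> tight5 x \<inter> rowsV \<noteq> {}"
      "card (tight5 (turn x) \<inter> rowsU) = card (tight5 x \<inter> rowsV)"
      unfolding U using c True by simp_all
    moreover have "tight5 (turn x) \<inter> rowsV \<noteq> {} \<longleftrightarrow> tight5 x \<inter> rowsU \<noteq> {}"
      "card (tight5 (turn x) \<inter> rowsV) = card (tight5 x \<inter> rowsU)"
      unfolding V using c True by simp_all
    ultimately show ?thesis using x pol_move[OF F] True
      unfolding simple_vertex_def by metis
  qed
qed

lemma rows_explicit:
  "r \<in> absU \<Longrightarrow> r \<in> rowsU" "r \<in> absU \<Longrightarrow> r \<notin> rowsV"
  "r \<in> absV \<Longrightarrow> r \<in> rowsV" "r \<in> absV \<Longrightarrow> r \<notin> rowsU"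
  by (auto simp: absU_def absV_def rowsU_def rowsV_def)

lemma absv_abs: "r \<in> absU \<union> absV \<Longrightarrow> absv r = r"
  by (auto simp: absU_def absV_def)

text \<open>Tailored to the representatives: each lies on at least three rows of \<open>V\<close>,
  so the condition on \<open>typeU\<close> is void, and whenever only one row of \<open>U\<close> is
  tight the first alternative of \<open>typeV\<close> holds.\<close>

lemma simple_vertexI:
  assumes x: "x \<in> P5 \<and> tight5 x = T" and T0: "T \<subseteq> A \<union> B" "A \<subseteq> T" "B \<subseteq> T"
    and AB: "A \<subseteq> absU" "B \<subseteq> absV" "A \<noteq> {}" "B \<noteq> {}"
    and card: "card T = 5" "card B \<noteq> 1"
    and A: "card A = 1 \<longrightarrow> A \<subseteq> {(0, 0, 15, 0, 1)} \<and> (15, 0, 0, 0, -1) \<notin> T"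
  shows "simple_vertex x"
proof -
  have T: "T = A \<union> B" "A \<subseteq> absU" "B \<subseteq> absV" using T0 AB by blast+
  have U: "tight5 x \<inter> rowsU = A" and V: "tight5 x \<inter> rowsV = B"
    using x T rows_explicit by blast+
  have "absv ` C = C" if "C \<subseteq> absU \<union> absV" for C
  proof -
    have "absv ` C = id ` C"
      by (rule image_cong[OF refl]) (use that absv_abs in \<open>simp only: id_apply subset_iff\<close>)
    then show ?thesis by simp
  qed
  then have "absv ` A = A" "absv ` T = T" using T(1-3) by (metis le_supI1 le_supI2 Un_mono)+
  then have "card A = 1 \<longrightarrow> typeV x" using A x unfolding typeV_def U by metis
  then show ?thesis using x AB(3,4) card unfolding simple_vertex_def U V by metis
qed

lemma simple_points:
  "simple_vertex point1"
  "simple_vertex point2"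
  "simple_vertex point3"
  "simple_vertex point4"
  "simple_vertex point5"
  "simple_vertex point6"
  "simple_vertex point7"
  subgoal by (rule simple_vertexI[OF tight_point1, of "{(0, 0, 15, 0, 1)}" "{(0, 0, 6, 0, -1), (0, 0, 4, 4, -1), (12, 0, 3, 0, -1), (0, 12, 0, 3, -1)}"])
    (simp_all add: absU_def absV_def)
  subgoal by (rule simple_vertexI[OF tight_point2, of "{(0, 0, 15, 0, 1)}" "{(0, 0, 6, 0, -1), (0, 15, 0, 0, -1), (12, 0, 3, 0, -1), (0, 12, 0, 3, -1)}"])
    (simp_all add: absU_def absV_def)
  subgoal by (rule simple_vertexI[OF tight_point3, of "{(0, 0, 15, 0, 1)}" "{(0, 15, 0, 0, -1), (9, 9, 0, 0, -1), (12, 0, 3, 0, -1), (0, 12, 0, 3, -1)}"])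
    (simp_all add: absU_def absV_def)
  subgoal by (rule simple_vertexI[OF tight_point4, of "{(0, 0, 15, 0, 1), (0, 0, 9, 9, 1)}" "{(0, 0, 4, 4, -1), (12, 0, 3, 0, -1), (0, 12, 0, 3, -1)}"])
    (simp_all add: absU_def absV_def)
  subgoal by (rule simple_vertexI[OF tight_point5, of "{(0, 0, 15, 0, 1), (0, 0, 9, 9, 1)}" "{(9, 9, 0, 0, -1), (12, 0, 3, 0, -1), (0, 12, 0, 3, -1)}"])
    (simp_all add: absU_def absV_def)
  subgoal by (rule simple_vertexI[OF tight_point6, of "{(0, 0, 15, 0, 1), (0, 0, 9, 9, 1)}" "{(0, 15, 0, 0, -1), (9, 9, 0, 0, -1), (0, 12, 0, 3, -1)}"])
    (simp_all add: absU_def absV_def)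
  subgoal by (rule simple_vertexI[OF tight_point7, of "{(0, 0, 0, 15, 1), (0, 0, 9, 9, 1)}" "{(0, 15, 0, 0, -1), (9, 9, 0, 0, -1), (0, 12, 0, 3, -1)}"])
    (simp_all add: absU_def absV_def)
  done

lemma orbit_good:
  assumes "x \<in> orbit" shows "simple_vertex x" "has_neighbours x"
  using assms
proof (induction rule: orbit.induct)
  case (rep x)
  {
    case 1 then show ?case using rep simple_points by blast
  next
    case 2 then show ?case using rep neighbours_point1 neighbours_point2 neighbours_point3
      neighbours_point4 neighbours_point5 neighbours_point6 neighbours_point7 by blast
  }
next
  case (move F x)
  {
    case 1 then show ?case using move simple_vertex_move by blast
  next
    case 2 then show ?case using move has_neighbours_move by blast
  }
qed

section \<open>Completeness of the vertex list by linear optimisation\<close>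

lemma finite_verts:
  assumes S: "subspace S" and I: "finite I" shows "finite {x. vert S g I x}"
proof (rule inj_on_finite)
  show "inj_on (tight g I) {x. vert S g I x}"
  proof (rule inj_onI)
    fix x y assume xy: "x \<in> {x. vert S g I x}" "y \<in> {x. vert S g I x}" "tight g I x = tight g I y"
    then have "dim (ker S g (tight g I x)) = 0" "x \<in> S" "y \<in> S" by (auto simp: vert_def pol_def)
    moreover have "\<forall>i\<in>tight g I x. g i \<bullet> x = g i \<bullet> y"
      using xy(3) unfolding tight_def by (metis (mono_tags, lifting) mem_Collect_eq)
    ultimately show "x = y" using ker_eq_0_unique[OF S] by blast
  qed
  show "tight g I ` {x. vert S g I x} \<subseteq> Pow I" by (auto simp: tight_def)
  show "finite (Pow I)" using I by simp
qed

lemma subspace_inner_eq_0: "subspace {b. b \<bullet> h = 0}"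
  by (simp add: subspace_def inner_add_left)

lemma ker_independent_full:
  fixes T :: "'a::euclidean_space set"
  assumes "independent T" "card T = DIM('a)" "h \<in> ker UNIV (\<lambda>r. r) T"
  shows "h = 0"
proof -
  have "finite T" using assms(1) independent_imp_finite by blast
  then have "UNIV \<subseteq> span T" using card_eq_dim[of T UNIV] assms(1,2) by simp
  moreover have "span T \<subseteq> {b. b \<bullet> h = 0}"
    using assms(3) subspace_inner_eq_0 by (intro span_minimal) (auto simp: ker_def)
  ultimately have "h \<bullet> h = 0" by blast
  then show ?thesis by simp
qed

text \<open>The edge vectors \<open>z i - x\<close> are, up to negative factors, the dual basis of
  the tight rows. Hence the tight rows are independent and the polytope lies in the cone spanned by
  its edges at \<open>x\<close>; a functional that increases along none of them is maximal at
  \<open>x\<close>.\<close>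

lemma simple_vertex_cone:
  fixes I :: "'a::euclidean_space set"
  defines "P \<equiv> pol UNIV (\<lambda>r. r) I" and "T \<equiv> tight (\<lambda>r. r) I"
  assumes x: "x \<in> P" "card (T x) = DIM('a)"
    and z: "\<And>i. i \<in> T x \<Longrightarrow> z i \<in> P" "\<And>i r. i \<in> T x \<Longrightarrow> r \<in> T x \<Longrightarrow> r \<noteq> i \<Longrightarrow> r \<bullet> z i = 1"
      "\<And>i. i \<in> T x \<Longrightarrow> i \<bullet> z i \<noteq> 1"
  shows "vert UNIV (\<lambda>r. r) I x"
    and "\<And>c p. p \<in> P \<Longrightarrow> (\<And>i. i \<in> T x \<Longrightarrow> c \<bullet> z i \<le> c \<bullet> x) \<Longrightarrow> c \<bullet> p \<le> c \<bullet> x"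
proof -
  let ?T = "T x"
  have fin: "finite ?T" using x(2) by (metis DIM_positive card.infinite less_irrefl)
  have T1: "r \<bullet> x = 1" "r \<in> I" if "r \<in> ?T" for r using that by (auto simp: T_def tight_def)
  define d where "d i = z i - x" for i
  have d0: "r \<bullet> d i = 0" if "i \<in> ?T" "r \<in> ?T" "r \<noteq> i" for i r
    using z(2)[OF that] T1(1)[OF that(2)] by (simp add: d_def inner_diff_right)
  have dn: "i \<bullet> d i < 0" if "i \<in> ?T" for i
  proof -
    have "i \<bullet> z i \<le> 1" using z(1)[OF that] T1(2)[OF that] by (simp add: P_def pol_def)
    then show ?thesis using z(3)[OF that] T1(1)[OF that] by (simp add: d_def inner_diff_right)
  qed
  have sum_d: "r \<bullet> (\<Sum>i\<in>?T. a i *\<^sub>R d i) = a r * (r \<bullet> d r)" if r: "r \<in> ?T" for a r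
  proof -
    have "r \<bullet> (\<Sum>i\<in>?T. a i *\<^sub>R d i) = (\<Sum>i\<in>?T. a i * (r \<bullet> d i))" by (simp add: inner_sum_right)
    also have "\<dots> = (\<Sum>i\<in>?T. if i = r then a r * (r \<bullet> d r) else 0)"
      using d0 r by (intro sum.cong) auto
    also have "\<dots> = a r * (r \<bullet> d r)" using fin r by (simp add: sum.delta)
    finally show ?thesis .
  qed
  have "independent ?T"
  proof (rule independent_if_scalars_zero[OF fin])
    fix a i assume a: "(\<Sum>v\<in>?T. a v *\<^sub>R v) = 0" and i: "i \<in> ?T"
    have "0 = (\<Sum>v\<in>?T. a v *\<^sub>R v) \<bullet> d i" by (simp add: a)
    also have "\<dots> = (\<Sum>v\<in>?T. a v * (v \<bullet> d i))" by (simp add: inner_sum_left)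
    also have "\<dots> = (\<Sum>v\<in>?T. if v = i then a i * (i \<bullet> d i) else 0)"
      using d0 i by (intro sum.cong) auto
    also have "\<dots> = a i * (i \<bullet> d i)" using fin i by (simp add: sum.delta)
    finally show "a i = 0" using dn[OF i] by simp
  qed
  note ker0 = ker_independent_full[OF this x(2)]
  show "vert UNIV (\<lambda>r. r) I x"
    using x(1) dim_ker_eq_0I[of UNIV "\<lambda>r. r" ?T] ker0 unfolding vert_def P_def T_def by blast
  fix c p assume p: "p \<in> P" and c: "\<And>i. i \<in> ?T \<Longrightarrow> c \<bullet> z i \<le> c \<bullet> x"
  define a where "a i = (i \<bullet> (p - x)) / (i \<bullet> d i)" for i
  have "p - x - (\<Sum>i\<in>?T. a i *\<^sub>R d i) \<in> ker UNIV (\<lambda>r. r) ?T"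
  proof -
    have "r \<bullet> (p - x - (\<Sum>i\<in>?T. a i *\<^sub>R d i)) = 0" if r: "r \<in> ?T" for r
      unfolding inner_diff_right[of r "p - x"] sum_d[OF r] a_def using dn[OF r] by simp
    then show ?thesis by (simp add: ker_def)
  qed
  then have px: "p - x = (\<Sum>i\<in>?T. a i *\<^sub>R d i)" using ker0 by fastforce
  have "c \<bullet> (p - x) = (\<Sum>i\<in>?T. a i * (c \<bullet> d i))" unfolding px by (simp add: inner_sum_right)
  also have "\<dots> \<le> 0"
  proof (rule sum_nonpos)
    fix i assume i: "i \<in> ?T"
    have "i \<bullet> p \<le> 1" using p T1(2)[OF i] by (simp add: P_def pol_def)
    then have "i \<bullet> (p - x) \<le> 0" using T1(1)[OF i] by (simp add: inner_diff_right)
    then have "a i \<ge> 0" using dn[OF i] unfolding a_def by (simp add: divide_nonpos_neg)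
    moreover have "c \<bullet> d i \<le> 0" using c[OF i] by (simp add: d_def inner_diff_right)
    ultimately show "a i * (c \<bullet> d i) \<le> 0" by (simp add: mult_nonneg_nonpos)
  qed
  finally show "c \<bullet> p \<le> c \<bullet> x" by (simp add: inner_diff_right)
qed

text \<open>The simplex method: a vertex in \<open>Q\<close> that is optimal among \<open>Q\<close> has no improving edge.\<close>
lemma maximizer_in_closed_set:
  fixes I Q A :: "'a::euclidean_space set"
  defines "P \<equiv> pol UNIV (\<lambda>r. r) I" and "T \<equiv> tight (\<lambda>r. r) I"
  assumes Q: "finite Q" "Q \<union> A \<subseteq> P" "\<And>x. x \<in> Q \<Longrightarrow> card (T x) = DIM('a)"
    and nb: "\<And>x i. x \<in> Q \<Longrightarrow> i \<in> T x \<Longrightarrow>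
       \<exists>z\<in>Q \<union> A. (\<forall>r\<in>T x. r \<noteq> i \<longrightarrow> r \<bullet> z = 1) \<and> i \<bullet> z \<noteq> 1"
    and c: "\<And>a. a \<in> A \<Longrightarrow> c \<bullet> a \<le> 0" "\<exists>y\<in>Q. c \<bullet> y \<ge> 0"
    and max: "p \<in> P" "\<And>q. q \<in> P \<Longrightarrow> c \<bullet> q \<ge> c \<bullet> p \<Longrightarrow> q = p"
  shows "p \<in> Q"
proof -
  obtain y0 where y0: "y0 \<in> Q" "c \<bullet> y0 \<ge> 0" using c by blast
  define m where "m = Max ((\<bullet>) c ` Q)"
  have "m \<in> (\<bullet>) c ` Q" unfolding m_def using Q(1) y0(1) by (intro Max_in) auto
  then obtain x where x: "x \<in> Q" "c \<bullet> x = m" by auto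
  have le: "c \<bullet> q \<le> c \<bullet> x" if "q \<in> Q" for q
    unfolding x(2) m_def using Q(1) that by (intro Max_ge) auto
  obtain z where z: "\<And>i. i \<in> T x \<Longrightarrow> z i \<in> Q \<union> A"
    "\<And>i r. i \<in> T x \<Longrightarrow> r \<in> T x \<Longrightarrow> r \<noteq> i \<Longrightarrow> r \<bullet> z i = 1"
    "\<And>i. i \<in> T x \<Longrightarrow> i \<bullet> z i \<noteq> 1"
    using nb[OF x(1)] by metis
  have zc: "c \<bullet> z i \<le> c \<bullet> x" if "i \<in> T x" for i
    using z(1)[OF that] le le[OF y0(1)] y0(2) c(1)[of "z i"] by force
  have zP: "\<And>i. i \<in> T x \<Longrightarrow> z i \<in> P" and xP: "x \<in> P" using z(1) Q(2) x(1) by blast+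
  have "c \<bullet> p \<le> c \<bullet> x"
    using simple_vertex_cone(2)[of x I z p c] xP Q(3)[OF x(1)] zP z(2,3) max(1) zc
    unfolding P_def T_def by blast
  then show ?thesis using max(2)[OF xP] x(1) by simp
qed

text \<open>Every summand is maximal at \<open>p\<close>, so a point with as large a total attains
  each tight row, and these rows determine \<open>p\<close>.\<close>

lemma weighted_rows_maximizer:
  fixes I :: "'a::euclidean_space set"
  defines "P \<equiv> pol UNIV (\<lambda>r. r) I"
  assumes I: "finite I" and p: "vert UNIV (\<lambda>r. r) I p"
    and w: "\<And>r. r \<in> tight (\<lambda>r. r) I p \<Longrightarrow> w r > (0::real)"
    and c: "c = (\<Sum>r\<in>tight (\<lambda>r. r) I p. w r *\<^sub>R r)"
    and q: "q \<in> P" "c \<bullet> q \<ge> c \<bullet> p"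
  shows "q = p"
proof -
  let ?T = "tight (\<lambda>r. r) I p"
  have fin: "finite ?T" using I by (simp add: tight_def)
  have c_eq: "c \<bullet> x = (\<Sum>r\<in>?T. w r * (r \<bullet> x))" for x by (simp add: c inner_sum_left)
  have le: "w r * (r \<bullet> q) \<le> w r * (r \<bullet> p)" if "r \<in> ?T" for r
    using w[OF that] that q(1) by (intro mult_left_mono) (auto simp: tight_def P_def pol_def)
  have "r \<bullet> p = r \<bullet> q" if r: "r \<in> ?T" for r
  proof (rule ccontr)
    assume ne: "r \<bullet> p \<noteq> r \<bullet> q"
    have "w r * (r \<bullet> q) \<noteq> w r * (r \<bullet> p)" using w[OF r] ne by simp
    then have "w r * (r \<bullet> q) < w r * (r \<bullet> p)"
      using order.not_eq_order_implies_strict[OF _ le[OF r]] by blast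
    then have "c \<bullet> q < c \<bullet> p" unfolding c_eq using fin r le by (intro sum_strict_mono_ex1) auto
    then show False using q(2) by simp
  qed
  then show ?thesis
    using ker_eq_0_unique[OF subspace_UNIV, of "\<lambda>r. r" ?T p q] p by (simp add: vert_def del: dim_eq_0)
qed

lemma finite_rowsU: "finite rowsU" and card_rowsU: "card rowsU = 24"
proof -
  have eq: "rowsU = set [(6, 0, 0, 0, 1), (-6, 0, 0, 0, 1), (0, 6, 0, 0, 1), (0, -6, 0, 0, 1),
    (0, 0, 15, 0, 1), (0, 0, -15, 0, 1), (0, 0, 0, 15, 1), (0, 0, 0, -15, 1),
    (4, 4, 0, 0, 1), (4, -4, 0, 0, 1), (-4, 4, 0, 0, 1), (-4, -4, 0, 0, 1),
    (0, 0, 9, 9, 1), (0, 0, 9, -9, 1), (0, 0, -9, 9, 1), (0, 0, -9, -9, 1),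
    (0, 3, 12, 0, 1), (0, 3, -12, 0, 1), (0, -3, 12, 0, 1), (0, -3, -12, 0, 1),
    (3, 0, 0, 12, 1), (3, 0, 0, -12, 1), (-3, 0, 0, 12, 1), (-3, 0, 0, -12, 1)]" (is "_ = set ?l")
  proof (intro equalityI subsetI)
    fix r assume "r \<in> rowsU"
    then have r: "absv r \<in> absU" by (simp add: rowsU_def)
    obtain a b c d s where "r = (a, b, c, d, s)" by (cases r)
    with r show "r \<in> set ?l" unfolding absU_def
      by (simp add: abs_eq_iff') (elim disjE conjE; simp)
  next
    fix r assume "r \<in> set ?l"
    then show "r \<in> rowsU" unfolding rowsU_def absU_def by (simp; elim disjE; simp)
  qed
  have dist: "distinct ?l" by simp
  show "finite rowsU" unfolding eq by (rule finite_set)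
  show "card rowsU = 24" unfolding eq distinct_card[OF dist] by simp
qed

lemma finite_rowsV: "finite rowsV" and card_rowsV: "card rowsV = 24"
proof -
  have "inj turn" by (rule move_inj) (simp add: moves_def)
  then show "finite rowsV" "card rowsV = 24"
    using turn_rows(1) finite_rowsU card_rowsU by (metis finite_imageI, metis card_image inj_on_subset subset_UNIV)
qed

lemma finite_rows5: "finite rows5"
  using finite_rowsU finite_rowsV by simp

lemma apex_pol: "apexU \<in> P5" "apexV \<in> P5"
proof -
  have "r \<bullet> apexU \<le> 1" if "r \<in> rows5" for r using apex_rows(1,2)[of r] that by fastforce
  then show "apexU \<in> P5" by (simp only: pol_def) blast
  have "r \<bullet> apexV \<le> 1" if "r \<in> rows5" for r using apex_rows(3,4)[of r] that by fastforce
  then show "apexV \<in> P5" by (simp only: pol_def) blast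
qed

lemma tight_apex: "tight5 apexU = rowsU" "tight5 apexV = rowsV"
proof -
  have "r \<bullet> apexU = 1 \<longleftrightarrow> r \<in> rowsU" if "r \<in> rows5" for r using apex_rows(1,2)[of r] that by fastforce
  then show "tight5 apexU = rowsU" unfolding tight_def by blast
  have "r \<bullet> apexV = 1 \<longleftrightarrow> r \<in> rowsV" if "r \<in> rows5" for r using apex_rows(3,4)[of r] that by fastforce
  then show "tight5 apexV = rowsV" unfolding tight_def by blast
qed

lemma DIM_real5: "DIM(real5) = 5" by simp

lemma orbit_vert:
  assumes x: "x \<in> orbit" shows "vert5 x"
proof -
  have sv: "simple_vertex x" and nb: "has_neighbours x" using orbit_good[OF x] by auto
  have orb: "z \<in> P5" if "z \<in> orbit \<union> {apexU, apexV}" for z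
    using that orbit_good(1) apex_pol unfolding simple_vertex_def by blast
  obtain z where z: "\<And>i. i \<in> tight5 x \<Longrightarrow> z i \<in> orbit \<union> {apexU, apexV}"
    "\<And>i r. i \<in> tight5 x \<Longrightarrow> r \<in> tight5 x \<Longrightarrow> r \<noteq> i \<Longrightarrow> r \<bullet> z i = 1"
    "\<And>i. i \<in> tight5 x \<Longrightarrow> i \<bullet> z i \<noteq> 1"
    using nb unfolding has_neighbours_def by metis
  show ?thesis
    by (rule simple_vertex_cone(1)[OF _ _ orb[OF z(1)] z(2,3)])
      (use sv DIM_real5 in \<open>auto simp only: simple_vertex_def\<close>)
qed

lemma finite_orbit: "finite orbit"
proof (rule finite_subset)
  show "orbit \<subseteq> {x. vert5 x}" using orbit_vert by blast
  show "finite {x. vert5 x}" by (rule finite_verts[OF subspace_UNIV finite_rows5])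
qed

text \<open>The objective is the sum of the rows tight at \<open>p\<close>, balanced so that it vanishes at both apices.\<close>
lemma vert5_cases:
  assumes p: "vert5 p" shows "p \<in> orbit \<union> {apexU, apexV}"
proof (cases "p = apexU \<or> p = apexV")
  case False
  let ?T = "tight5 p"
  define kU where "kU = real (card (?T \<inter> rowsU))"
  define kV where "kV = real (card (?T \<inter> rowsV))"
  define w where "w r = (if r \<in> rowsU then kV else kU)" for r
  define c where "c = (\<Sum>r\<in>?T. w r *\<^sub>R r)"
  have T_sub: "?T \<subseteq> rows5" by (auto simp only: tight_def)
  then have finT: "finite ?T" using finite_rows5 finite_subset by blast
  have d0: "dim (ker5 ?T) = 0" using p by (simp only: vert_def)
  have T1: "r \<bullet> p = 1" if "r \<in> ?T" for r using that by (simp only: tight_def mem_Collect_eq)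
  \<comment> \<open>If all tight rows came from one side, the apex of that side would solve the
    equations that determine \<open>p\<close>.\<close>
  have "?T \<inter> rowsV \<noteq> {}"
  proof
    assume "?T \<inter> rowsV = {}"
    then have "\<forall>r\<in>?T. r \<bullet> p = r \<bullet> apexU" using T_sub T1 apex_rows(1) by fastforce
    then show False using ker_eq_0_unique[OF subspace_UNIV d0, of p apexU] False by blast
  qed
  moreover have "?T \<inter> rowsU \<noteq> {}"
  proof
    assume "?T \<inter> rowsU = {}"
    then have "\<forall>r\<in>?T. r \<bullet> p = r \<bullet> apexV" using T_sub T1 apex_rows(4) by fastforce
    then show False using ker_eq_0_unique[OF subspace_UNIV d0, of p apexV] False by blast
  qed
  ultimately have k: "kU > 0" "kV > 0" using finT by (simp_all add: kU_def kV_def card_gt_0_iff)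
  have c_eq: "c \<bullet> x = (\<Sum>r\<in>?T. w r * (r \<bullet> x))" for x by (simp only: c_def inner_sum_left inner_scaleR_left)
  have split: "(\<Sum>r\<in>?T. f r) = (\<Sum>r\<in>?T \<inter> rowsU. f r) + (\<Sum>r\<in>?T \<inter> rowsV. f r)" for f :: "real5 \<Rightarrow> real"
  proof -
    have "?T = (?T \<inter> rowsU) \<union> (?T \<inter> rowsV)" using T_sub by blast
    moreover have "(?T \<inter> rowsU) \<inter> (?T \<inter> rowsV) = {}" using rowsU_V_disjoint by blast
    ultimately show ?thesis using finT by (metis finite_Int sum.union_disjoint)
  qed
  have c_apexU: "c \<bullet> apexU = 0"
  proof -
    have "(\<Sum>r\<in>?T \<inter> rowsU. w r * (r \<bullet> apexU)) = (\<Sum>r\<in>?T \<inter> rowsU. kV)"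
      using apex_rows(1) by (intro sum.cong) (simp_all only: w_def Int_iff if_True mult_1_right)
    moreover have "(\<Sum>r\<in>?T \<inter> rowsV. w r * (r \<bullet> apexU)) = (\<Sum>r\<in>?T \<inter> rowsV. - kU)"
    proof (rule sum.cong[OF refl])
      fix r assume "r \<in> ?T \<inter> rowsV"
      then have "r \<in> rowsV" "r \<notin> rowsU" using rowsU_V_disjoint by blast+
      then show "w r * (r \<bullet> apexU) = - kU" using apex_rows(2)[of r] by (simp only: w_def if_False)
    qed
    ultimately show ?thesis unfolding c_eq split by (simp add: kU_def kV_def)
  qed
  have neg: "apexV = - apexU" by simp
  have c_apexV: "c \<bullet> apexV = 0" unfolding neg inner_minus_right c_apexU by simp
  have c_apex: "c \<bullet> a \<le> 0" if "a \<in> {apexU, apexV}" for a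
    using that by (elim insertE emptyE; simp only: c_apexU c_apexV order_refl)
  have pos: "\<exists>y\<in>orbit. c \<bullet> y \<ge> 0"
  proof -
    \<comment> \<open>The antipode of \<open>point1\<close> in the first four coordinates. The two
      points sum to a multiple of an apex, where \<open>c\<close> vanishes, so \<open>c\<close> is
      nonnegative at one of them.\<close>
    let ?y = "flip1 (flip2 (flip3 (flip4 point1)))"
    have y: "point1 \<in> orbit" "?y \<in> orbit" by (intro orbit_moves orbit_points)+
    have "point1 + ?y = (- 6 / 7) *\<^sub>R apexU" by (simp add: point1_def)
    then have "c \<bullet> point1 + c \<bullet> ?y = (- 6 / 7) * (c \<bullet> apexU)"
      by (simp only: inner_scaleR_right flip: inner_add_right)
    then have "c \<bullet> point1 \<ge> 0 \<or> c \<bullet> ?y \<ge> 0" using c_apexU by linarith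
    then show ?thesis using y by blast
  qed
  have "w r > 0" for r using k by (simp only: w_def) simp
  note max = weighted_rows_maximizer[OF finite_rows5 p this c_def]
  have "p \<in> orbit"
  proof (rule maximizer_in_closed_set[OF finite_orbit _ _ _ c_apex pos _ max])
    show "orbit \<union> {apexU, apexV} \<subseteq> P5"
      using orbit_good(1) apex_pol unfolding simple_vertex_def by blast
    show "card (tight5 x) = DIM(real5)" if "x \<in> orbit" for x
      using orbit_good(1)[OF that] DIM_real5 by (simp only: simple_vertex_def)
    show "\<exists>z\<in>orbit \<union> {apexU, apexV}. (\<forall>r\<in>tight5 x. r \<noteq> i \<longrightarrow> r \<bullet> z = 1) \<and> i \<bullet> z \<noteq> 1"
      if "x \<in> orbit" "i \<in> tight5 x" for x i
      using orbit_good(2)[OF that(1)] that(2) unfolding has_neighbours_def by blast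
    show "p \<in> P5" using p by (simp only: vert_def)
  qed
  then show ?thesis by blast
qed blast

lemma orbit_card:
  assumes "x \<in> orbit"
  shows "finite (tight5 x)" "card (tight5 x) = 5"
    "card (tight5 x \<inter> rowsU) + card (tight5 x \<inter> rowsV) = 5"
    "card (tight5 x \<inter> rowsU) \<ge> 1" "card (tight5 x \<inter> rowsV) \<ge> 1"
proof -
  have s: "card (tight5 x) = 5" "tight5 x \<inter> rowsU \<noteq> {}" "tight5 x \<inter> rowsV \<noteq> {}"
    using orbit_good(1)[OF assms] unfolding simple_vertex_def by blast+
  then show f: "finite (tight5 x)" "card (tight5 x) = 5" by (auto intro: card_ge_0_finite)
  show "card (tight5 x \<inter> rowsU) \<ge> 1" "card (tight5 x \<inter> rowsV) \<ge> 1"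
    using f(1) s(2,3) by (simp_all add: Suc_le_eq card_gt_0_iff)
  have "tight5 x = (tight5 x \<inter> rowsU) \<union> (tight5 x \<inter> rowsV)" by (auto simp only: tight_def)
  moreover have "(tight5 x \<inter> rowsU) \<inter> (tight5 x \<inter> rowsV) = {}" using rowsU_V_disjoint by blast
  ultimately show "card (tight5 x \<inter> rowsU) + card (tight5 x \<inter> rowsV) = 5"
    using f by (metis card_Un_disjoint finite_Int)
qed

text \<open>A vertex on rows of both sides is not an apex, hence lies on exactly five rows, and the
  four that remain cannot have rank five.\<close>

lemma essential5:
  assumes i: "i \<in> rows5" and j: "j \<in> rows5" and ij: "i \<in> rowsU \<longleftrightarrow> j \<in> rowsV"
  shows "essential UNIV (\<lambda>r. r) rows5 i j"
  unfolding essential_def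
proof (intro allI impI)
  fix x assume x: "vert5 x" "i \<in> tight5 x" "j \<in> tight5 x"
  have "x \<noteq> apexU" "x \<noteq> apexV"
    using x(2,3) i j ij tight_apex rowsU_V_disjoint by blast+
  then have o: "x \<in> orbit" using vert5_cases[OF x(1)] by blast
  have c: "card (tight5 x - {i}) = 4" using orbit_card(1,2)[OF o] x(2) by simp
  have "dim (UNIV :: real5 set) \<le> dim (ker5 (tight5 x - {i})) + card (tight5 x - {i})"
    by (rule dim_le_dim_ker_plus_card) (use orbit_card(1)[OF o] in simp_all)
  then have "5 \<le> dim (ker5 (tight5 x - {i})) + 4" unfolding c dim_UNIV DIM_real5 .
  then show "dim (ker5 (tight5 x - {i})) \<noteq> 0" by linarith
qed

section \<open>The distance between the apices\<close>

lemma adj5_card: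
  assumes "(x, y) \<in> adj5" shows "card (tight5 x \<inter> tight5 y) \<ge> 4"
proof -
  have "finite (tight5 x \<inter> tight5 y)" using finite_rows5 by (simp add: tight_def)
  then have "dim (UNIV :: real5 set) \<le> dim (ker5 (tight5 x \<inter> tight5 y)) + card (tight5 x \<inter> tight5 y)"
    by (intro dim_le_dim_ker_plus_card) auto
  moreover have "dim (ker5 (tight5 x \<inter> tight5 y)) \<le> 1" using assms by (simp only: adj_def) blast
  ultimately show ?thesis unfolding dim_UNIV DIM_real5 by linarith
qed

text \<open>The number of tight rows at \<open>apexU\<close> is 24. The value 5 is used instead
  because a neighbour of \<open>apexU\<close> in the orbit has at least four tight rows in
  \<open>U\<close>; so no step changes the height by more than one.\<close>

definition height :: "real5 \<Rightarrow> nat" where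
  "height x = (if x = apexU then 5 else if x = apexV then 0 else card (tight5 x \<inter> rowsU))"

lemma apex_neq: "apexU \<noteq> apexV" by simp

lemma apex_not_orbit: "apexU \<notin> orbit" "apexV \<notin> orbit"
proof -
  have "x \<noteq> apexU" "x \<noteq> apexV" if "x \<in> orbit" for x
    using orbit_card(2)[OF that] tight_apex card_rowsU card_rowsV by auto
  then show "apexU \<notin> orbit" "apexV \<notin> orbit" by blast+
qed

lemma height_orbit: "x \<in> orbit \<Longrightarrow> height x = card (tight5 x \<inter> rowsU)"
  using apex_not_orbit unfolding height_def by metis

lemma height_adj:
  assumes xy: "(x, y) \<in> adj5" shows "height x \<le> Suc (height y)"
proof -
  have v: "vert5 x" "vert5 y" using xy by (simp_all only: adj_def mem_Collect_eq case_prod_conv)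
  have c4: "card (tight5 x \<inter> tight5 y) \<ge> 4" by (rule adj5_card[OF xy])
  have h0: "height apexV = 0" "height apexU = 5" using apex_neq by (simp_all add: height_def)
  consider "x = apexV" | "y = apexU" | "x = apexU" "y = apexV" | "x = apexU" "y \<in> orbit"
    | "x \<in> orbit" "y = apexV" | "x \<in> orbit" "y \<in> orbit"
    using vert5_cases[OF v(1)] vert5_cases[OF v(2)] by blast
  then show ?thesis
  proof cases
    case 1 then show ?thesis using h0 by simp
  next
    case 2
    have "height x \<le> 5"
      using vert5_cases[OF v(1)] h0 height_orbit[of x] orbit_card(3)[of x] by auto
    then show ?thesis using 2 h0 by simp
  next
    case 3
    then have "tight5 x \<inter> tight5 y = {}" using tight_apex rowsU_V_disjoint by simp
    then show ?thesis using c4 by simp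
  next
    case 4
    then have "tight5 x \<inter> tight5 y = tight5 y \<inter> rowsU" using tight_apex by blast
    then show ?thesis using c4 4 h0 height_orbit by simp
  next
    case 5
    then have "tight5 x \<inter> tight5 y = tight5 x \<inter> rowsV" using tight_apex by blast
    then show ?thesis using c4 5 h0 height_orbit[of x] orbit_card(3)[of x] by simp
  next
    case 6
    note f = orbit_card(1)[OF 6(1)] orbit_card(1)[OF 6(2)]
    have "card (tight5 x) = card (tight5 x \<inter> tight5 y) + card (tight5 x - tight5 y)"
      using f(1) by (metis card_Diff_subset_Int card_mono finite_Int inf_le1 le_add_diff_inverse)
    then have d: "card (tight5 x - tight5 y) \<le> 1" using c4 orbit_card(2)[OF 6(1)] by simp
    have "tight5 x \<inter> rowsU \<subseteq> (tight5 y \<inter> rowsU) \<union> (tight5 x - tight5 y)" by blast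
    then have "card (tight5 x \<inter> rowsU) \<le> card ((tight5 y \<inter> rowsU) \<union> (tight5 x - tight5 y))"
      using f by (intro card_mono) auto
    also have "\<dots> \<le> card (tight5 y \<inter> rowsU) + card (tight5 x - tight5 y)" by (rule card_Un_le)
    finally show ?thesis using d height_orbit 6 by simp
  qed
qed

text \<open>The type of \<open>y\<close> fixes the kind of the common \<open>U\<close> row, the type
  of \<open>x\<close> the kind of the common \<open>V\<close> row. In each of the four combinations
  one of the two types forbids the common row of the other side.\<close>

lemma type_conflict:
  assumes x: "typeU x" and y: "typeV y"
    and a: "a \<in> rowsU" "a \<in> tight5 x" "a \<in> tight5 y"
    and z: "z \<in> rowsV" "z \<in> tight5 x" "z \<in> tight5 y"
  shows False
proof -
  have m: "absv a \<in> absv ` (tight5 y \<inter> rowsU)" "absv a \<in> absv ` tight5 x"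
    "absv z \<in> absv ` (tight5 x \<inter> rowsV)" "absv z \<in> absv ` tight5 y"
    using a z by blast+
  from y have "absv a = (0, 0, 15, 0, 1) \<and> (15, 0, 0, 0, -1) \<notin> absv ` tight5 y \<or>
      absv a = (0, 0, 0, 15, 1) \<and> (0, 15, 0, 0, -1) \<notin> absv ` tight5 y"
    unfolding typeV_def using subsetD[OF _ m(1), THEN singletonD] by metis
  moreover from x have "absv z = (15, 0, 0, 0, -1) \<and> (0, 0, 0, 15, 1) \<notin> absv ` tight5 x \<or>
      absv z = (0, 15, 0, 0, -1) \<and> (0, 0, 15, 0, 1) \<notin> absv ` tight5 x"
    unfolding typeU_def using subsetD[OF _ m(3), THEN singletonD] by metis
  ultimately show False using m(2,4) by (elim disjE conjE) (simp_all only: simp_thms)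
qed

lemma card_Int_ge:
  assumes "finite B" "card (A \<inter> B) + card (B \<inter> C) \<ge> card B + k"
  shows "card (A \<inter> B \<inter> C) \<ge> k"
proof -
  have "card (A \<inter> B) + card (B \<inter> C) = card ((A \<inter> B) \<union> (B \<inter> C)) + card ((A \<inter> B) \<inter> (B \<inter> C))"
    using assms(1) by (intro card_Un_Int) auto
  moreover have "card ((A \<inter> B) \<union> (B \<inter> C)) \<le> card B" using assms(1) by (intro card_mono) auto
  moreover have "(A \<inter> B) \<inter> (B \<inter> C) = A \<inter> B \<inter> C" by blast
  ultimately show ?thesis using assms(2) by simp
qed

lemma relpow_refl_on: "(x, x) \<in> R \<Longrightarrow> (x, x) \<in> R ^^ n"
  by (induction n) auto

lemma no_short_walk: "k < 6 \<Longrightarrow> (apexU, apexV) \<notin> adj5 ^^ k"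
proof
  assume k: "k < 6" and walk: "(apexU, apexV) \<in> adj5 ^^ k"
  have "k \<noteq> 0" using walk apex_neq by (cases k) auto
  then have v: "vert5 apexV" using walk by (cases k) (auto simp: adj_def)
  then have "(apexV, apexV) \<in> adj5" unfolding adj_def vert_def by (simp del: dim_eq_0)
  \<comment> \<open>Pausing at \<open>apexV\<close> turns a shorter walk into one of length exactly
    5.\<close>
  then have "(apexU, apexV) \<in> adj5 ^^ (k + (5 - k))"
    using walk relpow_refl_on by (metis relpow_add relcompI)
  then have "(apexU, apexV) \<in> adj5 ^^ Suc (Suc (Suc (Suc (Suc 0))))" using k by (simp add: eval_nat_numeral)
  then obtain x1 x2 x3 x4 where x: "(apexU, x1) \<in> adj5" "(x1, x2) \<in> adj5" "(x2, x3) \<in> adj5"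
    "(x3, x4) \<in> adj5" "(x4, apexV) \<in> adj5"
    unfolding relpow.simps relcomp_unfold by blast
  have h: "height apexV = 0" "height apexU = 5" using apex_neq by (simp_all add: height_def)
  \<comment> \<open>Five steps take the height from 5 to 0 and lower it by at most one each, so
    every step lowers it by exactly one.\<close>
  have hx: "height x1 = 4" "height x2 = 3" "height x3 = 2" "height x4 = 1"
    using x[THEN height_adj] unfolding h by linarith+
  then have "x1 \<noteq> apexU" "x1 \<noteq> apexV" "x2 \<noteq> apexU" "x2 \<noteq> apexV" "x3 \<noteq> apexU" "x3 \<noteq> apexV"
    "x4 \<noteq> apexU" "x4 \<noteq> apexV"
    using h by auto
  moreover have "vert5 x1" "vert5 x2" "vert5 x3" "vert5 x4"
    using x by (simp_all only: adj_def mem_Collect_eq case_prod_conv)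
  ultimately have o: "x1 \<in> orbit" "x2 \<in> orbit" "x3 \<in> orbit" "x4 \<in> orbit"
    using vert5_cases by blast+
  note fin = o[THEN orbit_card(1)] and card = o[THEN orbit_card(2)]
  \<comment> \<open>Each of the three inner steps gives up at most one of five tight rows, so two
    rows persist from \<open>x1\<close> to \<open>x4\<close>.\<close>
  have "card (tight5 x1 \<inter> tight5 x2 \<inter> tight5 x3) \<ge> 3"
    using card_Int_ge[OF fin(2), where A = "tight5 x1" and C = "tight5 x3" and k = 3] adj5_card[OF x(2)] adj5_card[OF x(3)] card by simp
  then have "card (tight5 x1 \<inter> tight5 x2 \<inter> tight5 x3 \<inter> tight5 x4) \<ge> 2"
    using card_Int_ge[OF fin(3), where A = "tight5 x1 \<inter> tight5 x2" and C = "tight5 x4" and k = 2] adj5_card[OF x(4)] card by simp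
  also have "card (tight5 x1 \<inter> tight5 x2 \<inter> tight5 x3 \<inter> tight5 x4) \<le> card (tight5 x1 \<inter> tight5 x4)"
    using fin by (intro card_mono) auto
  finally have c14: "card (tight5 x1 \<inter> tight5 x4) \<ge> 2" .
  have V1: "card (tight5 x1 \<inter> rowsV) = 1" using hx(1) height_orbit[OF o(1)] orbit_card(3)[OF o(1)] by simp
  have U4: "card (tight5 x4 \<inter> rowsU) = 1" using hx(4) height_orbit[OF o(4)] by simp
  have rows: "tight5 x \<subseteq> rows5" for x by (auto simp only: tight_def)
  \<comment> \<open>\<open>x1\<close> has a single \<open>V\<close> row and \<open>x4\<close> a
    single \<open>U\<close> row, so two common rows cannot lie on the same side.\<close>
  have "\<exists>a\<in>rowsU. a \<in> tight5 x1 \<inter> tight5 x4"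
  proof (rule ccontr)
    assume "\<not> ?thesis"
    then have "tight5 x1 \<inter> tight5 x4 \<subseteq> tight5 x1 \<inter> rowsV" using rows[of x1] by blast
    then have "card (tight5 x1 \<inter> tight5 x4) \<le> card (tight5 x1 \<inter> rowsV)" using fin by (intro card_mono) auto
    then show False using c14 V1 by simp
  qed
  moreover have "\<exists>z\<in>rowsV. z \<in> tight5 x1 \<inter> tight5 x4"
  proof (rule ccontr)
    assume "\<not> ?thesis"
    then have "tight5 x1 \<inter> tight5 x4 \<subseteq> tight5 x4 \<inter> rowsU" using rows[of x4] by blast
    then have "card (tight5 x1 \<inter> tight5 x4) \<le> card (tight5 x4 \<inter> rowsU)" using fin by (intro card_mono) auto
    then show False using c14 U4 by simp
  qed
  moreover have "typeU x1" "typeV x4"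
    using orbit_good(1)[OF o(1)] orbit_good(1)[OF o(4)] V1 U4 unfolding simple_vertex_def by blast+
  ultimately show False using type_conflict[of x1 x4] by blast
qed

section \<open>Irredundancy, rank and boundedness of the base spindle\<close>

definition irredundant5 :: "real5 \<Rightarrow> bool" where
  "irredundant5 r \<longleftrightarrow> (\<exists>x. r \<bullet> x = 1 \<and> (\<forall>k\<in>rows5 - {r}. k \<bullet> x < 1))"

lemma irredundant5I:
  assumes "x \<in> P5 \<and> tight5 x = {r}" shows "irredundant5 r"
proof -
  have "r \<bullet> x = 1" using assms unfolding tight_def by blast
  moreover have "k \<bullet> x < 1" if k: "k \<in> rows5 - {r}" for k
  proof -
    have "k \<bullet> x \<le> 1" using assms k unfolding pol_def by blast
    moreover have "k \<bullet> x \<noteq> 1" using assms k unfolding tight_def by blast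
    ultimately show ?thesis by simp
  qed
  ultimately show ?thesis unfolding irredundant5_def by blast
qed

lemma irredundant5_move:
  assumes F: "F \<in> moves" and r: "irredundant5 r" shows "irredundant5 (F r)"
proof -
  obtain x where x: "r \<bullet> x = 1" "\<forall>k\<in>rows5 - {r}. k \<bullet> x < 1"
    using r unfolding irredundant5_def by blast
  have "k \<bullet> F x < 1" if k: "k \<in> rows5 - {F r}" for k
  proof -
    obtain q where q: "q \<in> rows5" "k = F q" using k move_rows[OF F] by blast
    then have "q \<noteq> r" using k by blast
    then show ?thesis using q x(2) move_inner[OF F] by simp
  qed
  moreover have "F r \<bullet> F x = 1" using x(1) move_inner[OF F] by simp
  ultimately show ?thesis unfolding irredundant5_def by blast
qed

text \<open>Near \<open>apexU\<close>, in a direction in which the given row is the unique maximum.\<close>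
lemma irredundant5_reps:
  "irredundant5 (6, 0, 0, 0, 1)" "irredundant5 (0, 0, 15, 0, 1)" "irredundant5 (4, 4, 0, 0, 1)"
  "irredundant5 (0, 0, 9, 9, 1)" "irredundant5 (0, 3, 12, 0, 1)"
  subgoal by (rule irredundant5I[OF nonneg_point[of 10 1 1 1 160 100]]) (simp_all add: absU_def absV_def)
  subgoal by (rule irredundant5I[OF nonneg_point[of 1 1 10 1 250 100]]) (simp_all add: absU_def absV_def)
  subgoal by (rule irredundant5I[OF nonneg_point[of 10 10 1 1 180 100]]) (simp_all add: absU_def absV_def)
  subgoal by (rule irredundant5I[OF nonneg_point[of 1 1 10 10 280 100]]) (simp_all add: absU_def absV_def)
  subgoal by (rule irredundant5I[OF nonneg_point[of 1 20 10 1 380 200]]) (simp_all add: absU_def absV_def)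
  done

lemma irredundant5_abs:
  assumes "irredundant5 (absv r)" shows "irredundant5 r"
proof -
  obtain a b c d s where r: "r = (a, b, c, d, s)" by (cases r)
  note mv = irredundant5_move[of flip1] irredundant5_move[of flip2] irredundant5_move[of flip3]
    irredundant5_move[of flip4]
  have "irredundant5 (\<bar>a\<bar>, \<bar>b\<bar>, \<bar>c\<bar>, \<bar>d\<bar>, s)" using assms by (simp add: r)
  then have "irredundant5 (a, \<bar>b\<bar>, \<bar>c\<bar>, \<bar>d\<bar>, s)"
    using mv(1)[of "(\<bar>a\<bar>, \<bar>b\<bar>, \<bar>c\<bar>, \<bar>d\<bar>, s)"] by (cases "a \<ge> 0") (simp_all add: moves_def)
  then have "irredundant5 (a, b, \<bar>c\<bar>, \<bar>d\<bar>, s)"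
    using mv(2)[of "(a, \<bar>b\<bar>, \<bar>c\<bar>, \<bar>d\<bar>, s)"] by (cases "b \<ge> 0") (simp_all add: moves_def)
  then have "irredundant5 (a, b, c, \<bar>d\<bar>, s)"
    using mv(3)[of "(a, b, \<bar>c\<bar>, \<bar>d\<bar>, s)"] by (cases "c \<ge> 0") (simp_all add: moves_def)
  then show ?thesis
    using mv(4)[of "(a, b, c, \<bar>d\<bar>, s)"] by (cases "d \<ge> 0") (simp_all add: moves_def r)
qed

lemma irredundant5_rows: "r \<in> rows5 \<Longrightarrow> irredundant5 r"
proof -
  have t: "irredundant5 (turn q)" if "irredundant5 q" for q
    using irredundant5_move[OF _ that, of turn] by (simp add: moves_def)
  have "irredundant5 (0, 6, 0, 0, 1)" "irredundant5 (0, 0, 0, 15, 1)" "irredundant5 (3, 0, 0, 12, 1)"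
    using irredundant5_reps(1,2,5)[THEN t, THEN t] by simp_all
  then have U: "irredundant5 q" if "q \<in> absU" for q
    using that irredundant5_reps unfolding absU_def by blast
  have V: "irredundant5 q" if "q \<in> absV" for q
  proof -
    have "turn (turn (turn q)) \<in> absU" using that turn_abs by blast
    from t[OF U[OF this]] show ?thesis by (simp only: turn4)
  qed
  show "irredundant5 r" if "r \<in> rows5"
    using that U V irredundant5_abs unfolding rowsU_def rowsV_def by blast
qed

lemma axis_rows:
  "(6, 0, 0, 0, 1) \<in> rowsU" "(-6, 0, 0, 0, 1) \<in> rowsU" "(0, 6, 0, 0, 1) \<in> rowsU" "(0, -6, 0, 0, 1) \<in> rowsU"
  "(0, 0, 15, 0, 1) \<in> rowsU" "(0, 0, -15, 0, 1) \<in> rowsU" "(0, 0, 0, 15, 1) \<in> rowsU" "(0, 0, 0, -15, 1) \<in> rowsU"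
  "(0, 0, 0, 6, -1) \<in> rowsV" "(0, 0, 0, -6, -1) \<in> rowsV" "(0, 0, 6, 0, -1) \<in> rowsV" "(0, 0, -6, 0, -1) \<in> rowsV"
  "(15, 0, 0, 0, -1) \<in> rowsV" "(-15, 0, 0, 0, -1) \<in> rowsV" "(0, 15, 0, 0, -1) \<in> rowsV" "(0, -15, 0, 0, -1) \<in> rowsV"
  by (simp_all add: rowsU_def rowsV_def absU_def absV_def)

lemma ker5_rowsU: "dim (ker5 rowsU) = 0"
proof (rule dim_ker_eq_0I)
  fix h assume "h \<in> ker5 rowsU"
  then have h0: "r \<bullet> h = 0" if "r \<in> rowsU" for r using that by (simp add: ker_def)
  obtain a b c d s where h: "h = (a, b, c, d, s)" by (cases h)
  have "6 * a + s = 0" "- 6 * a + s = 0" "6 * b + s = 0" "15 * c + s = 0" "15 * d + s = 0"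
    using axis_rows(1,2,3,5,7)[THEN h0] unfolding h by simp_all
  then show "h = 0" by (simp add: h zero_prod_def)
qed

lemma ker5_rowsV: "dim (ker5 rowsV) = 0"
proof (rule dim_ker_eq_0I)
  fix h assume "h \<in> ker5 rowsV"
  then have h0: "r \<bullet> h = 0" if "r \<in> rowsV" for r using that by (simp add: ker_def)
  obtain a b c d s where h: "h = (a, b, c, d, s)" by (cases h)
  have "15 * a - s = 0" "- 15 * a - s = 0" "15 * b - s = 0" "6 * c - s = 0" "6 * d - s = 0"
    using axis_rows(13,14,15,11,9)[THEN h0] unfolding h by simp_all
  then show "h = 0" by (simp add: h zero_prod_def)
qed

lemma bounded_P5: "bounded P5"
proof (rule boundedI)
  fix x assume "x \<in> P5"
  then have le: "r \<bullet> x \<le> 1" if "r \<in> rows5" for r using that by (simp add: pol_def)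
  then have leU: "r \<bullet> x \<le> 1" if "r \<in> rowsU" for r using that by blast
  have leV: "r \<bullet> x \<le> 1" if "r \<in> rowsV" for r using that le by blast
  obtain a b c d s where x: "x = (a, b, c, d, s)" by (cases x)
  have "6 * a + s \<le> 1" "- 6 * a + s \<le> 1" "6 * b + s \<le> 1" "- 6 * b + s \<le> 1"
    "15 * c + s \<le> 1" "- 15 * c + s \<le> 1" "15 * d + s \<le> 1" "- 15 * d + s \<le> 1"
    using axis_rows(1-8)[THEN leU] unfolding x by simp_all
  moreover have "15 * a - s \<le> 1" "- 15 * a - s \<le> 1" "15 * b - s \<le> 1" "- 15 * b - s \<le> 1"
    "6 * c - s \<le> 1" "- 6 * c - s \<le> 1" "6 * d - s \<le> 1" "- 6 * d - s \<le> 1"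
    using axis_rows(13-16,11,12,9,10)[THEN leV] unfolding x by simp_all
  ultimately have "\<bar>a\<bar> \<le> 1" "\<bar>b\<bar> \<le> 1" "\<bar>c\<bar> \<le> 1" "\<bar>d\<bar> \<le> 1" "\<bar>s\<bar> \<le> 1" by linarith+
  moreover have "norm x \<le> \<bar>a\<bar> + (\<bar>b\<bar> + (\<bar>c\<bar> + (\<bar>d\<bar> + \<bar>s\<bar>)))"
    unfolding x by (intro order_trans[OF norm_Pair_le] add_mono) (simp_all add: norm_Pair_le)
  ultimately show "norm x \<le> 5" by linarith
qed

text \<open>Places the base spindle in a space large enough for all later dimensions and renames its
  rows by natural numbers, so that every wedge finds a fresh row. Every condition on a spindle is
  expressed by inner products and dimensions, which an isometry preserves.\<close>

lemma spindle_transfer: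
  fixes g :: "'i \<Rightarrow> 'b::euclidean_space" and f :: "'b \<Rightarrow> 'a::euclidean_space" and h :: "'j \<Rightarrow> 'i"
  assumes sp: "spindle S g U V U' V' l"
    and f: "linear f" "\<And>x y. f x \<bullet> f y = x \<bullet> y"
    and h: "bij_betw h J (U \<union> V)"
  defines "B A \<equiv> {n \<in> J. h n \<in> A}"
  shows "spindle (f ` S) (\<lambda>n. f (g (h n))) (B U) (B V) (B U') (B V') l"
    and "dim (f ` S) = dim S" "card (B U) = card U" "card (B V) = card V"
      "card (B U') = card U'" "card (B V') = card V'"
proof -
  let ?g = "\<lambda>n. f (g (h n))"
  define I where "I = U \<union> V"
  from sp obtain u v where sub: "U' \<subseteq> U" "V' \<subseteq> V"
    and ess: "\<And>i j. i \<in> U \<Longrightarrow> j \<in> V' \<Longrightarrow> essential S g I i j"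
      "\<And>i j. j \<in> V \<Longrightarrow> i \<in> U' \<Longrightarrow> essential S g I j i"
    and pre: "pre_spindle S g U V u v"
    and len: "\<And>k. k < l \<Longrightarrow> (u, v) \<notin> adj S g I ^^ k"
    unfolding spindle_def I_def by blast
  from pre have S: "subspace S" and fin: "finite U" "finite V" and UV: "U \<inter> V = {}"
    and gS: "g ` I \<subseteq> S" and bdd: "bounded (pol S g I)"
    and irr: "\<And>i. i \<in> I \<Longrightarrow> \<exists>x\<in>S. g i \<bullet> x = 1 \<and> (\<forall>k\<in>I - {i}. g k \<bullet> x < 1)"
    and u: "u \<in> S" "\<And>i. i \<in> U \<Longrightarrow> g i \<bullet> u = 1" "\<And>i. i \<in> V \<Longrightarrow> g i \<bullet> u < 1"
    and v: "v \<in> S" "\<And>i. i \<in> V \<Longrightarrow> g i \<bullet> v = 1" "\<And>i. i \<in> U \<Longrightarrow> g i \<bullet> v < 1"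
    and kU: "dim (ker S g U) = 0" and kV: "dim (ker S g V) = 0"
    unfolding pre_spindle_def I_def by blast+
  have inj: "inj f" using f by (metis (no_types, lifting) inner_eq_zero_iff linear_injective_0)
  have dimf: "dim (f ` K) = dim K" for K using f(1) inj by (metis dim_image_eq inj_on_subset subset_UNIV)
  have hJ: "inj_on h J" "h ` J = I" using h by (auto simp: bij_betw_def I_def)
  have hB: "h ` B A = A" if "A \<subseteq> I" for A using that hJ(2) by (auto simp: B_def)
  have cB: "card (B A) = card A" if "A \<subseteq> I" for A
    using hB[OF that] hJ(1) by (metis (no_types, lifting) B_def card_image inj_on_subset mem_Collect_eq subsetI)
  have BI: "B U \<union> B V = J" using hJ(2) by (auto simp: B_def I_def)
  have UI: "U \<subseteq> I" "V \<subseteq> I" "U' \<subseteq> I" "V' \<subseteq> I" using sub by (auto simp: I_def)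
  show "dim (f ` S) = dim S" "card (B U) = card U" "card (B V) = card V"
    "card (B U') = card U'" "card (B V') = card V'"
    using dimf cB UI by blast+
  have ker_eq: "ker (f ` S) ?g A = f ` ker S g (h ` A)" for A
    using f(2) by (auto simp: ker_def)
  have pol_eq: "pol (f ` S) ?g J = f ` pol S g I"
    using f(2) hJ(2)[symmetric] by (auto simp: pol_def)
  have tight_eq: "tight ?g J (f x) = B (tight g I x)" for x
    using f(2) hJ(2) by (auto simp: tight_def B_def)
  have TI: "tight g I x \<subseteq> I" for x by (auto simp: tight_def)
  have vert_eq: "vert (f ` S) ?g J (f x) \<longleftrightarrow> vert S g I x" for x
    unfolding vert_def pol_eq tight_eq ker_eq hB[OF TI] dimf inj_image_mem_iff[OF inj] ..
  have pre_img: "\<exists>x. y = f x" if "vert (f ` S) ?g J y" for y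
    using that unfolding vert_def pol_eq by blast
  have BInt: "h ` (B A \<inter> B C) = A \<inter> C" if "A \<subseteq> I" for A C
    using that hJ(2) by (auto simp: B_def)
  have adj_eq: "(f x, f y) \<in> adj (f ` S) ?g J \<longleftrightarrow> (x, y) \<in> adj S g I" for x y
    by (simp add: adj_def vert_eq tight_eq ker_eq BInt[OF TI] dimf)
  have walk: "(f x, y) \<in> adj (f ` S) ?g J ^^ k \<Longrightarrow> \<exists>z. y = f z \<and> (x, z) \<in> adj S g I ^^ k" for x y k
  proof (induction k arbitrary: y)
    case (Suc k)
    then obtain w where w: "(f x, w) \<in> adj (f ` S) ?g J ^^ k" "(w, y) \<in> adj (f ` S) ?g J" by auto
    then obtain z where z: "w = f z" "(x, z) \<in> adj S g I ^^ k" using Suc.IH by blast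
    have "vert (f ` S) ?g J y" using w(2) by (simp add: adj_def)
    then obtain z' where "y = f z'" using pre_img by blast
    then show ?case using z w(2) adj_eq by auto
  qed auto
  have ess_eq: "essential (f ` S) ?g J n m" if nm: "n \<in> J" "essential S g I (h n) (h m)" for n m
    unfolding essential_def
  proof (intro allI impI)
    fix y assume y: "vert (f ` S) ?g J y" "n \<in> tight ?g J y" "m \<in> tight ?g J y"
    then obtain x where x: "y = f x" using pre_img by blast
    have "h ` (B (tight g I x) - {n}) = tight g I x - {h n}"
      using hJ nm(1) TI[of x] by (auto simp: B_def inj_on_def)
    moreover have "vert S g I x" "h n \<in> tight g I x" "h m \<in> tight g I x"
      using y unfolding x vert_eq tight_eq B_def by auto
    ultimately show "dim (ker (f ` S) ?g (tight ?g J y - {n})) \<noteq> 0"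
      using nm(2) unfolding x tight_eq ker_eq dimf essential_def by metis
  qed
  have "pre_spindle (f ` S) ?g (B U) (B V) (f u) (f v)"
    unfolding pre_spindle_def BI
  proof (intro conjI)
    show "subspace (f ` S)" using S f(1) by (simp add: linear_subspace_image)
    have "finite J" using fin h bij_betw_finite by (metis finite_UnI)
    then show "finite (B U)" "finite (B V)" by (simp_all add: B_def)
    show "B U \<inter> B V = {}" using UV by (auto simp: B_def)
    show "?g ` J \<subseteq> f ` S" using gS hJ(2) by auto
    show "bounded (pol (f ` S) ?g J)" unfolding pol_eq
      using bdd f(1) by (simp add: bounded_linear_image linear_conv_bounded_linear)
    show "\<forall>n\<in>J. \<exists>x\<in>f ` S. ?g n \<bullet> x = 1 \<and> (\<forall>k\<in>J - {n}. ?g k \<bullet> x < 1)"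
    proof
      fix n assume n: "n \<in> J"
      then obtain x where x: "x \<in> S" "g (h n) \<bullet> x = 1" "\<forall>k\<in>I - {h n}. g k \<bullet> x < 1"
        using irr hJ(2) by blast
      have "h k \<in> I - {h n}" if "k \<in> J - {n}" for k using that hJ n by (auto simp: inj_on_def)
      then show "\<exists>x\<in>f ` S. ?g n \<bullet> x = 1 \<and> (\<forall>k\<in>J - {n}. ?g k \<bullet> x < 1)"
        using x f(2) by (intro bexI[of _ "f x"]) auto
    qed
    show "dim (ker (f ` S) ?g (B U)) = 0" "dim (ker (f ` S) ?g (B V)) = 0"
      unfolding ker_eq dimf using hB UI kU kV by metis+
  qed (use u v f(2) in \<open>auto simp: B_def\<close>)
  moreover have "(f u, f v) \<notin> adj (f ` S) ?g J ^^ k" if "k < l" for k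
    using walk[of u "f v" k] len[OF that] injD[OF inj] by metis
  moreover have "B U' \<subseteq> B U" "B V' \<subseteq> B V" using sub by (auto simp: B_def)
  moreover have "essential (f ` S) ?g J n m" if "n \<in> B U" "m \<in> B V'" for n m
    using that ess(1) ess_eq unfolding B_def by blast
  moreover have "essential (f ` S) ?g J n m" if "n \<in> B V" "m \<in> B U'" for n m
    using that ess(2) ess_eq unfolding B_def by blast
  ultimately show "spindle (f ` S) ?g (B U) (B V) (B U') (B V') l"
    unfolding spindle_def BI by blast
qed

lemma base_spindle: "spindle UNIV (\<lambda>r. r) rowsU rowsV rowsU rowsV 6"
proof -
  have "pre_spindle UNIV (\<lambda>r. r) rowsU rowsV apexU apexV"
    unfolding pre_spindle_def
  proof (intro conjI)
    show "\<forall>i\<in>rows5. \<exists>x\<in>UNIV. i \<bullet> x = 1 \<and> (\<forall>k\<in>rows5 - {i}. k \<bullet> x < 1)"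
      using irredundant5_rows unfolding irredundant5_def by blast
    show "\<forall>i\<in>rowsU. i \<bullet> apexU = 1" "\<forall>i\<in>rowsV. i \<bullet> apexV = 1"
      using apex_rows(1,4) by blast+
    show "\<forall>i\<in>rowsV. i \<bullet> apexU < 1" "\<forall>i\<in>rowsU. i \<bullet> apexV < 1"
      using apex_rows(2,3) by fastforce+
  qed (fact subspace_UNIV finite_rowsU finite_rowsV rowsU_V_disjoint subset_UNIV bounded_P5 UNIV_I
      ker5_rowsU ker5_rowsV)+
  moreover have "essential UNIV (\<lambda>r. r) rows5 i j" "essential UNIV (\<lambda>r. r) rows5 j i"
    if "i \<in> rowsU" "j \<in> rowsV" for i j
    using essential5 that rowsU_V_disjoint by blast+
  ultimately show ?thesis
    unfolding spindle_def using no_short_walk by blast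
qed

theorem corollary1p7:
  shows "\<exists>P :: (real ^ 43) set.
    polytope P \<and> aff_dim P = 43 \<and> num_facets P = 86 \<and> non_Hirsch P"
proof -
  have dim43: "DIM(real ^ 43) = 43" by simp
  obtain f :: "real5 \<Rightarrow> real ^ 43" where f: "linear f" "\<And>x. norm (f x) = norm x"
  proof -
    have "dim (UNIV :: real5 set) \<le> dim (UNIV :: (real ^ 43) set)" by simp
    from isometry_subset_subspace[OF subspace_UNIV subspace_UNIV this]
    obtain f :: "real5 \<Rightarrow> real ^ 43" where "linear f" "\<And>x. x \<in> UNIV \<Longrightarrow> norm (f x) = norm x"
      by blast
    then show thesis using that by blast
  qed
  have inner: "f x \<bullet> f y = x \<bullet> y" for x y
    using f by (simp add: dot_norm flip: linear_add)
  obtain h where "bij_betw h {0..<card rows5} rows5"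
    using ex_bij_betw_nat_finite[OF finite_rows5] by blast
  note t = spindle_transfer[OF base_spindle f(1) inner this, unfolded card_rowsU card_rowsV dim_UNIV DIM_real5]
  obtain S1 g1 U U' V V' where
    1: "spindle S1 (g1 :: nat \<Rightarrow> real ^ 43) U V U' V' 6" "dim S1 = 5" "card U = 24" "card V = 24"
      "card U' = 24" "card V' = 24"
    using that[OF t] .
  \<comment> \<open>19 = 24 - 5: wedging continues until the dimension reaches the number 24 of rows
    on the first side, where a redundant row is no longer guaranteed. The second side grows to 43
    rows, the length to 25.\<close>
  obtain S2 and g2 :: "nat \<Rightarrow> real ^ 43" and V2 V2' where
    2: "spindle S2 g2 U V2 U' V2' 25" "dim S2 = 24" "card V2 = 43"
    using spindle_steps[OF 1(1), of 19] 1 dim43 by auto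
  obtain S3 and g3 :: "nat \<Rightarrow> real ^ 43" and U3 U3' where
    3: "spindle S3 g3 V2 U3 V2' U3' 44" "dim S3 = 43" "card U3 = 43"
    using spindle_steps[OF spindle_swap[OF 2(1)], of 19] 1 2 dim43 by auto
  let ?P = "pol S3 g3 (V2 \<union> U3)"
  have "dim S3 = DIM(real ^ 43)" using 3(2) by simp
  note P = spindle_polytope[OF 3(1) this]
  have "aff_dim ?P = 43" "num_facets ?P = 86" using P(2,3) 2(3) 3(3) by simp_all
  moreover have "enat (nat (int 86 - 43)) < combinatorial_diameter ?P"
  proof -
    have "enat (nat (int 86 - 43)) < enat 44" by simp
    then show ?thesis using P(4) by (rule less_le_trans)
  qed
  ultimately show ?thesis
    using P(1) unfolding non_Hirsch_def by (intro exI[of _ ?P]) simp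
qed

end
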